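(* There exist constants $\eta_0>0$ and $C_{\rm nrg}>0$, depending only on $V$ (and the fixed choice of $\mu_0$), such that the following holds. Let $\Omega\subset\mathbb R^2$ be a smooth bounded domain, let $x_0\in\Omega$ and $0<\varepsilon\le r$ with $\mathbb D^2(x_0,r)\subset\Omega$, and let $u_\varepsilon:\Omega\to\mathbb R^k$ be a solution of $-\Delta u_\varepsilon=-\varepsilon^{-2}\nabla V(u_\varepsilon)$ on $\Omega$. If $$\frac{E_\varepsilon(u_\varepsilon,\mathbb D^2(x_0,r))}{r}\le\eta_0,$$ then there exists some $\sigma\in\Sigma$ such that $$|u_\varepsilon(x)-\sigma|\le\frac{\mu_0}2\ \text{ for } x\in\mathbb D^2(x_0,\tfrac{3r}4)\quad\text{and}\quad E_\varepsilon\big(u_\varepsilon,\mathbb D^2(x_0,\tfrac{5r}8)\big)\le C_{\rm nrg}\,\frac{\varepsilon}{r}\,E_\varepsilon\big(u_\varepsilon,\mathbb D^2(x_0,r)\big).$$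
   Context: Let $k\ge 1$ and let $V:\mathbb R^k\to\mathbb R$ be smooth with $\inf V=0$ and satisfying: (1) $\Sigma:=\{y\in\mathbb R^k: V(y)=0\}=\{\sigma_1,\dots,\sigma_q\}$ is finite with $q\ge2$; (2) the Hessian $\nabla^2V(\sigma_i)$ is positive definite for every $i$, with smallest eigenvalue $\lambda_i^->0$ and largest eigenvalue $\lambda_i^+$; (3) there are constants $\alpha_\infty>0$, $R_\infty>0$ such that $y\cdot\nabla V(y)\ge\alpha_\infty|y|^2$ if $|y|>R_\infty$, and $V(y)\to+\infty$ as $|y|\to+\infty$. A sufficiently small constant $\mu_0>0$ (depending only on $V$) is fixed so that the balls $\mathbb B^k(\sigma_i,2\mu_0)$ are pairwise disjoint and $\frac12\lambda_i^-\mathrm{Id}\le\nabla^2V(y)\le2\lambda_i^+\mathrm{Id}$ for all $i$ and all $y\in \mathbb B^k(\sigma_i,2\mu_0)$. $\mathbb D^2(x,r)$ is the open disc of $\mathbb R^2$ centered at $x$ with radius $r$. For a domain $G$, $E_\varepsilon(u,G)=\int_G e_\varepsilon(u)\,dx$ with $e_\varepsilon(u)=\varepsilon\frac{|\nabla u|^2}{2}+\frac1\varepsilon V(u)$. Solutions are smooth maps satisfying the equation pointwise. *)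

theory Defs
  imports "HOL-Analysis.Analysis"
begin

text \<open>Iterated directional derivatives. Both notions are meant for open sets S: the derivatives
  are unrestricted ones, which at points of an open S do not depend on the values outside S.\<close>

primrec Ck_on :: "nat \<Rightarrow> ('a::real_normed_vector \<Rightarrow> 'b::real_normed_vector) \<Rightarrow> 'a set \<Rightarrow> bool" where
  "Ck_on 0 f S \<longleftrightarrow> continuous_on S f"
| "Ck_on (Suc n) f S \<longleftrightarrow>
     (\<forall>x\<in>S. f differentiable (at x)) \<and> (\<forall>v. Ck_on n (\<lambda>x. frechet_derivative f (at x) v) S)"

definition smooth_on :: "('a::real_normed_vector \<Rightarrow> 'b::real_normed_vector) \<Rightarrow> 'a set \<Rightarrow> bool" where
  "smooth_on f S \<longleftrightarrow> (\<forall>n. Ck_on n f S)"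

definition partial_deriv :: "'n::finite \<Rightarrow> (real^'n \<Rightarrow> 'b::real_normed_vector) \<Rightarrow> real^'n \<Rightarrow> 'b" where
  "partial_deriv i f x = frechet_derivative f (at x) (axis i 1)"

definition gradient :: "(real^'n::finite \<Rightarrow> real) \<Rightarrow> real^'n \<Rightarrow> real^'n" where
  "gradient f x = (\<chi> i. partial_deriv i f x)"

definition hessian :: "(real^'n::finite \<Rightarrow> real) \<Rightarrow> real^'n \<Rightarrow> real^'n^'n" where
  "hessian f x = (\<chi> i j. partial_deriv i (partial_deriv j f) x)"

definition laplacian :: "(real^'n::finite \<Rightarrow> 'b::real_normed_vector) \<Rightarrow> real^'n \<Rightarrow> 'b" where
  "laplacian f x = (\<Sum>i\<in>UNIV. partial_deriv i (partial_deriv i f) x)"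

definition eigenvalues :: "real^'n::finite^'n \<Rightarrow> real set" where
  "eigenvalues A = {l. \<exists>v. v \<noteq> 0 \<and> A *v v = l *\<^sub>R v}"

definition pos_definite :: "real^'n::finite^'n \<Rightarrow> bool" where
  "pos_definite A \<longleftrightarrow> (\<forall>v. v \<noteq> 0 \<longrightarrow> v \<bullet> (A *v v) > 0)"

definition loewner_le :: "real^'n::finite^'n \<Rightarrow> real^'n^'n \<Rightarrow> bool" where
  "loewner_le A B \<longleftrightarrow> (\<forall>v. v \<bullet> (A *v v) \<le> v \<bullet> (B *v v))"

definition zero_set :: "(real^'k::finite \<Rightarrow> real) \<Rightarrow> (real^'k) set" where
  "zero_set V = {y. V y = 0}"

text \<open>Since Inf is unspecified on sets without lower bound, boundedness below is
  stated separately.\<close>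

definition multi_well_potential :: "(real^'k::finite \<Rightarrow> real) \<Rightarrow> bool" where
  "multi_well_potential V \<longleftrightarrow>
     smooth_on V UNIV \<and> bdd_below (range V) \<and> Inf (range V) = 0 \<and>
     finite (zero_set V) \<and> card (zero_set V) \<ge> 2 \<and>
     (\<forall>\<sigma>\<in>zero_set V. pos_definite (hessian V \<sigma>)) \<and>
     (\<exists>\<alpha>>0. \<exists>R>0. \<forall>y. norm y > R \<longrightarrow> y \<bullet> gradient V y \<ge> \<alpha> * (norm y)\<^sup>2) \<and>
     filterlim V at_top at_infinity"

definition lambda_minus :: "(real^'k::finite \<Rightarrow> real) \<Rightarrow> real^'k \<Rightarrow> real" where
  "lambda_minus V \<sigma> = Min (eigenvalues (hessian V \<sigma>))"

definition lambda_plus :: "(real^'k::finite \<Rightarrow> real) \<Rightarrow> real^'k \<Rightarrow> real" where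
  "lambda_plus V \<sigma> = Max (eigenvalues (hessian V \<sigma>))"

definition well_radius :: "(real^'k::finite \<Rightarrow> real) \<Rightarrow> real \<Rightarrow> bool" where
  "well_radius V \<mu> \<longleftrightarrow>
     \<mu> > 0 \<and>
     disjoint_family_on (\<lambda>\<sigma>. ball \<sigma> (2 * \<mu>)) (zero_set V) \<and>
     (\<forall>\<sigma>\<in>zero_set V. \<forall>y\<in>ball \<sigma> (2 * \<mu>).
        loewner_le (mat (lambda_minus V \<sigma> / 2)) (hessian V y) \<and>
        loewner_le (hessian V y) (mat (2 * lambda_plus V \<sigma>)))"

text \<open>Smoothness of the boundary is expressed by local defining functions: near each boundary
  point the set is a strict sublevel set of a smooth function without critical points.\<close>

definition smooth_bounded_domain :: "(real^'n::finite) set \<Rightarrow> bool" where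
  "smooth_bounded_domain \<Omega> \<longleftrightarrow>
     open \<Omega> \<and> connected \<Omega> \<and> \<Omega> \<noteq> {} \<and> bounded \<Omega> \<and>
     (\<forall>p\<in>frontier \<Omega>. \<exists>U \<phi>. open U \<and> p \<in> U \<and> smooth_on \<phi> U \<and>
        (\<forall>x\<in>U. gradient \<phi> x \<noteq> 0) \<and> \<Omega> \<inter> U = {x\<in>U. \<phi> x < 0})"

text \<open>The norm of the Jacobian matrix, as an element of \<^typ>\<open>real^'n^'m\<close>, is its
  Frobenius norm.\<close>

definition energy_density ::
    "(real^'k::finite \<Rightarrow> real) \<Rightarrow> real \<Rightarrow> (real^'n::finite \<Rightarrow> real^'k) \<Rightarrow> real^'n \<Rightarrow> real" where
  "energy_density V \<epsilon> u x = \<epsilon> * (norm (jacobian u (at x)))\<^sup>2 / 2 + 1 / \<epsilon> * V (u x)"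

text \<open>The energy is extended-valued: a map that is smooth only on the open domain may have infinite
  energy on a disc touching the boundary. The coercion to \<^typ>\<open>ennreal\<close> loses nothing when
  V is nonnegative.\<close>

definition energy ::
    "(real^'k::finite \<Rightarrow> real) \<Rightarrow> real \<Rightarrow> (real^'n::finite \<Rightarrow> real^'k) \<Rightarrow> (real^'n) set \<Rightarrow> ennreal" where
  "energy V \<epsilon> u G = (\<integral>\<^sup>+x\<in>G. ennreal (energy_density V \<epsilon> u x) \<partial>lborel)"

definition allen_cahn_solution ::
    "(real^'k::finite \<Rightarrow> real) \<Rightarrow> real \<Rightarrow> (real^'n::finite) set \<Rightarrow> (real^'n \<Rightarrow> real^'k) \<Rightarrow> bool" where
  "allen_cahn_solution V \<epsilon> \<Omega> u \<longleftrightarrow>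
     smooth_on u \<Omega> \<and> (\<forall>x\<in>\<Omega>. - laplacian u x = - ((1 / \<epsilon>\<^sup>2) *\<^sub>R gradient V (u x)))"

end

theory Submission
  imports Defs
begin

text \<open>After rescaling to \<open>\<epsilon> = 1\<close> a solution satisfies \<open>\<Delta>u = \<nabla>V(u)\<close> on large squares, and a small ratio
  of energy to side length \<open>m\<close> has to be propagated down to unit scale although no monotonicity formula is
  available for systems. If the ratio is small, most horizontal and vertical lines carry little energy, and
  along such a line \<open>V(u)\<close> stays small because \<open>|\<nabla>V|\<^sup>2 \<le> C V\<close> near the wells; so \<open>u\<close> is close
  to the wells on a grid of good lines. Three estimates then combine. Testing the equation with
  \<open>(u - \<sigma>) g(|u - \<sigma>|\<^sup>2)\<close>, where \<open>g\<close> is a logarithmic cutoff with \<open>q |g'(q)| \<le> C \<tau>\<close>, shows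
  that the energy stored where \<open>u\<close> is close to a well is at most \<open>C (\<tau> + 1/m)\<close> times the total energy.
  The Pohozaev identity, with a cutoff that varies only across good lines, bounds the potential energy
  by this part alone. Inside a good square the maximum principle bounds \<open>|u|\<close>, Bernstein's method bounds
  \<open>|\<nabla>u|\<close>, and so the gradient energy away from the wells is controlled by the potential energy.
  Hence the energy drops by any prescribed factor on a square of a quarter of the size, which can be iterated
  down to unit scale; there \<open>V(u)\<close> is Lipschitz with small mean, hence small, and \<open>u\<close> is close to a
  single well by connectedness. The energy estimate is the same test with \<open>u - \<sigma>\<close>, on small squares
  covering the disc.\<close>

subsection \<open>Integration over squares\<close>

text \<open>The test near a well helps only if its error is a small multiple of the energy. A cutoff
  \<open>g\<close> that drops from 1 to 0 over a fixed range of scales has q |g'(q)| of order one;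
  spreading the drop over a logarithmic range makes this O(\<tau>). The price is that
  \<open>g\<close> is bounded below only on a set exponentially small in 1/\<tau>
  (\<open>well_scale\<close>), and it is affordable because \<open>u\<close> has to reach that set
  on good lines only. The constants must then be chosen without circularity. Passing from potential
  to full energy divides by a \<open>well_scale\<close>, so that step uses the fixed value \<tau> =
  1/2, and its constant is known before the small \<tau> is picked. The order is: \<delta>0, \<tau>,
  then the level \<delta> and the size m1, and last the energy threshold. The required decay factor
  is 1/4 because each step quarters the square: a bound E \<le> \<eta> m then reproduces itself.
  Squares and coordinate lines take the place of discs and circles, so that all integral identities
  reduce to Fubini and the one-dimensional fundamental theorem, and all maximum arguments to second
  derivative tests on lines.\<close>

lemma integral_cbox_fst_snd:
  fixes f :: "real \<times> real \<Rightarrow> 'b::euclidean_space"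
  assumes "continuous_on (cbox (a,c) (b,d)) f"
  shows "integral (cbox (a,c) (b,d)) f = integral {a..b} (\<lambda>s. integral {c..d} (\<lambda>t. f (s,t)))"
  using integral_prod_continuous[OF assms] by simp

lemma integral_cbox_snd_fst:
  fixes f :: "real \<times> real \<Rightarrow> 'b::euclidean_space"
  assumes "continuous_on (cbox (a,c) (b,d)) f"
  shows "integral (cbox (a,c) (b,d)) f = integral {c..d} (\<lambda>t. integral {a..b} (\<lambda>s. f (s,t)))"
proof -
  have "continuous_on (cbox (a,c) (b,d)) (\<lambda>(x,y). f (x,y))" using assms by (simp add: case_prod_beta')
  from integral_swap_continuous[OF this] show ?thesis
    using integral_prod_continuous[OF assms] by simp
qed

lemma integral_partial_fst:
  fixes f :: "real \<times> real \<Rightarrow> 'b::euclidean_space"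
  assumes "a \<le> b" and c: "continuous_on (cbox (a,c) (b,d)) f1"
    and d: "\<And>s t. s \<in> {a..b} \<Longrightarrow> t \<in> {c..d} \<Longrightarrow>
        ((\<lambda>s. f (s,t)) has_vector_derivative f1 (s,t)) (at s within {a..b})"
  shows "integral (cbox (a,c) (b,d)) f1 = integral {c..d} (\<lambda>t. f (b,t) - f (a,t))"
proof -
  have "integral {a..b} (\<lambda>s. f1 (s,t)) = f (b,t) - f (a,t)" if "t \<in> {c..d}" for t
    using fundamental_theorem_of_calculus[OF \<open>a \<le> b\<close> d[OF _ that]] by (simp add: integral_unique)
  then show ?thesis unfolding integral_cbox_snd_fst[OF c] by (intro integral_cong) auto
qed

lemma integral_partial_snd:
  fixes f :: "real \<times> real \<Rightarrow> 'b::euclidean_space"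
  assumes "c \<le> d" and c: "continuous_on (cbox (a,c) (b,d)) f2"
    and d: "\<And>s t. s \<in> {a..b} \<Longrightarrow> t \<in> {c..d} \<Longrightarrow>
        ((\<lambda>t. f (s,t)) has_vector_derivative f2 (s,t)) (at t within {c..d})"
  shows "integral (cbox (a,c) (b,d)) f2 = integral {a..b} (\<lambda>s. f (s,d) - f (s,c))"
proof -
  have "integral {c..d} (\<lambda>t. f2 (s,t)) = f (s,d) - f (s,c)" if "s \<in> {a..b}" for s
    using fundamental_theorem_of_calculus[OF \<open>c \<le> d\<close> d[OF that]] by (simp add: integral_unique)
  then show ?thesis unfolding integral_cbox_fst_snd[OF c] by (intro integral_cong) auto
qed

definition sq :: "real \<Rightarrow> (real \<times> real) set" where
  "sq r = cbox (-r,-r) (r,r)"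

lemma mem_sq: "(s,t) \<in> sq r \<longleftrightarrow> \<bar>s\<bar> \<le> r \<and> \<bar>t\<bar> \<le> r"
  by (auto simp: sq_def cbox_Pair_eq abs_le_iff)

lemma sq_mono: "r \<le> r' \<Longrightarrow> sq r \<subseteq> sq r'"
  by (auto simp: mem_sq)

text \<open>Fubini and the fundamental theorem are applied to each component. Derivatives are
  one-sided at the end points, which fits cutoffs specified only on \<open>{-r..r}\<close>.\<close>

lemma divergence_theorem_vanishing:
  fixes f g :: "real \<times> real \<Rightarrow> real"
  assumes r: "0 \<le> r" and c: "continuous_on (sq r) f1" "continuous_on (sq r) g2"
    and d: "\<And>s t. (s,t) \<in> sq r \<Longrightarrow> ((\<lambda>s. f (s,t)) has_real_derivative f1 (s,t)) (at s within {-r..r})"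
           "\<And>s t. (s,t) \<in> sq r \<Longrightarrow> ((\<lambda>t. g (s,t)) has_real_derivative g2 (s,t)) (at t within {-r..r})"
    and z: "\<And>s t. \<bar>s\<bar> = r \<Longrightarrow> f (s,t) = 0" "\<And>s t. \<bar>t\<bar> = r \<Longrightarrow> g (s,t) = 0"
  shows "integral (sq r) (\<lambda>x. f1 x + g2 x) = 0"
proof -
  have "integral (sq r) f1 = integral {-r..r} (\<lambda>t. f (r,t) - f (-r,t))"
    unfolding sq_def using r c d
    by (intro integral_partial_fst) (auto simp: sq_def cbox_Pair_eq has_real_derivative_iff_has_vector_derivative)
  moreover have "integral (sq r) g2 = integral {-r..r} (\<lambda>s. g (s,r) - g (s,-r))"
    unfolding sq_def using r c d
    by (intro integral_partial_snd) (auto simp: sq_def cbox_Pair_eq has_real_derivative_iff_has_vector_derivative)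
  moreover have "f1 integrable_on sq r" "g2 integrable_on sq r"
    using c unfolding sq_def by (auto intro: integrable_continuous)
  ultimately show ?thesis using z r by (simp add: integral_add)
qed

section \<open>Second derivative test and symmetry of mixed partial derivatives\<close>

lemma second_deriv_nonpos_at_max:
  fixes g :: "real \<Rightarrow> real"
  assumes e: "e > 0" and d: "\<And>s. \<bar>s - x\<bar> < e \<Longrightarrow> (g has_real_derivative g' s) (at s)"
    and d2: "(g' has_real_derivative c) (at x)"
    and m: "\<And>s. \<bar>s - x\<bar> < e \<Longrightarrow> g s \<le> g x"
  shows "g' x = 0" "c \<le> 0"
proof -
  show z: "g' x = 0"
    using DERIV_local_max[OF d[of x] e] m e by (auto simp: abs_minus_commute)
  show "c \<le> 0"
  proof (rule ccontr)
    assume "\<not> c \<le> 0"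
    then obtain h where h: "h > 0" "\<And>k. 0 < k \<Longrightarrow> k < h \<Longrightarrow> g' x < g' (x + k)"
      using DERIV_pos_inc_right[OF d2] by auto
    define k where "k = min h e / 2"
    have k: "0 < k" "k < h" "k < e" using h e by (auto simp: k_def)
    have "\<exists>z>x. z < x + k \<and> g (x + k) - g x = (x + k - x) * g' z"
      by (rule MVT2) (use k in \<open>auto intro!: d\<close>)
    then obtain z where "x < z" "z < x + k" "g (x + k) - g x = k * g' z" by auto
    moreover have "g' z > 0" using h(2)[of "z - x"] calculation k z by auto
    ultimately have "g (x+k) > g x" using k by (smt (verit) mult_pos_pos)
    then show False using m[of "x + k"] k by auto
  qed
qed

text \<open>A positive value persists on a small box of positive area, whose integral would then be
  positive. The conclusion is one-sided; equality comes from using it for a function and its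
  negative.\<close>

lemma nonpos_if_box_integrals_zero:
  fixes f :: "real \<times> real \<Rightarrow> real"
  assumes D: "open D" "(s,t) \<in> D" and c: "continuous_on D f"
    and i: "\<And>a b c d. a \<le> b \<Longrightarrow> c \<le> d \<Longrightarrow> cbox (a,c) (b,d) \<subseteq> D \<Longrightarrow> integral (cbox (a,c) (b,d)) f = 0"
  shows "f (s,t) \<le> 0"
proof (rule ccontr)
  assume "\<not> f (s,t) \<le> 0"
  then have p: "f (s,t) > 0" by simp
  have eq: "{x \<in> D. f x > f (s,t) / 2} = D \<inter> f -` {f (s,t) / 2<..}" by auto
  have "open {x \<in> D. f x > f (s,t) / 2}"
    unfolding eq by (rule continuous_open_preimage[OF c D(1) open_greaterThan])
  moreover have "(s,t) \<in> {x \<in> D. f x > f (s,t) / 2}" using p D by simp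
  ultimately obtain a b where ab: "cbox a b \<subseteq> {x \<in> D. f x > f (s,t) / 2}"
    and l: "\<forall>i\<in>Basis. a \<bullet> i < b \<bullet> i"
    by (rule open_contains_cbox)
  obtain a1 a2 b1 b2 where e: "a = (a1,a2)" "b = (b1,b2)" by (metis surj_pair)
  have lt: "a1 < b1" "a2 < b2" using l by (auto simp: e Basis_prod_def)
  have "integral (cbox a b) f = 0" using i[of a1 b1 a2 b2] lt ab by (auto simp: e)
  moreover have "integral (cbox a b) (\<lambda>_. f (s,t) / 2) \<le> integral (cbox a b) f"
    using ab c by (intro integral_le integrable_continuous continuous_on_subset[OF c]) auto
  moreover have "integral (cbox a b) (\<lambda>_. f (s,t) / 2) = (b1 - a1) * (b2 - a2) * (f (s,t) / 2)"
    using lt by (simp add: e content_Pair)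
  moreover have "(b1 - a1) * (b2 - a2) * (f (s,t) / 2) > 0" using lt p by simp
  ultimately show False by linarith
qed

text \<open>Over a box both mixed derivatives integrate to the same alternating sum of the corner
  values of \<open>f\<close>. Continuity then localises the identity, one component at a
  time.\<close>

lemma mixed_partials_eq:
  fixes f :: "real \<times> real \<Rightarrow> 'b::euclidean_space"
  assumes D: "open D"
    and f: "\<And>s t. (s,t) \<in> D \<Longrightarrow> ((\<lambda>s. f (s,t)) has_vector_derivative f1 (s,t)) (at s)"
           "\<And>s t. (s,t) \<in> D \<Longrightarrow> ((\<lambda>t. f (s,t)) has_vector_derivative f2 (s,t)) (at t)"
           "\<And>s t. (s,t) \<in> D \<Longrightarrow> ((\<lambda>t. f1 (s,t)) has_vector_derivative f12 (s,t)) (at t)"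
           "\<And>s t. (s,t) \<in> D \<Longrightarrow> ((\<lambda>s. f2 (s,t)) has_vector_derivative f21 (s,t)) (at s)"
    and c: "continuous_on D f1" "continuous_on D f2" "continuous_on D f12" "continuous_on D f21"
    and p: "(s,t) \<in> D"
  shows "f12 (s,t) = f21 (s,t)"
proof -
  have eq: "integral (cbox (a,c) (b,d)) f12 = integral (cbox (a,c) (b,d)) f21"
    if le: "a \<le> b" "c \<le> d" and sub: "cbox (a,c) (b,d) \<subseteq> D" for a b c d
  proof -
    have m: "(s,t) \<in> D" if "s \<in> {a..b}" "t \<in> {c..d}" for s t using sub that by (auto simp: cbox_Pair_eq)
    have "integral (cbox (a,c) (b,d)) f12 = integral {a..b} (\<lambda>s. f1 (s,d) - f1 (s,c))"
      by (rule integral_partial_snd[OF le(2) continuous_on_subset[OF assms(8) sub]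
            has_vector_derivative_at_within[OF f(3)[OF m]]])
    also have "\<dots> = (f (b,d) - f (b,c)) - (f (a,d) - f (a,c))"
      by (intro integral_unique fundamental_theorem_of_calculus[OF le(1), of "\<lambda>s. f (s,d) - f (s,c)"]
          has_vector_derivative_diff has_vector_derivative_at_within[OF f(1)]) (use m le in auto)
    also have "\<dots> = (f (b,d) - f (a,d)) - (f (b,c) - f (a,c))" by simp
    also have "\<dots> = integral {c..d} (\<lambda>t. f2 (b,t) - f2 (a,t))"
      by (rule sym, intro integral_unique fundamental_theorem_of_calculus[OF le(2), of "\<lambda>t. f (b,t) - f (a,t)"]
          has_vector_derivative_diff has_vector_derivative_at_within[OF f(2)]) (use m le in auto)
    also have "\<dots> = integral (cbox (a,c) (b,d)) f21"
      by (rule sym, rule integral_partial_fst[OF le(1) continuous_on_subset[OF assms(9) sub]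
            has_vector_derivative_at_within[OF f(4)[OF m]]])
    finally show ?thesis .
  qed
  have "(f12 (s,t) - f21 (s,t)) \<bullet> i = 0" for i
  proof -
    have 1: "integral (cbox (a,c) (b,d)) (\<lambda>x. (f12 x - f21 x) \<bullet> j) = 0"
      if le: "a \<le> b" "c \<le> d" and sub: "cbox (a,c) (b,d) \<subseteq> D" for a b c d j
    proof -
      have ii: "f12 integrable_on cbox (a,c) (b,d)" "f21 integrable_on cbox (a,c) (b,d)"
        using assms(8,9) sub by (auto intro!: integrable_continuous intro: continuous_on_subset)
      then have "integral (cbox (a,c) (b,d)) (\<lambda>x. (f12 x - f21 x) \<bullet> j)
          = integral (cbox (a,c) (b,d)) (\<lambda>x. f12 x - f21 x) \<bullet> j"
        by (intro integral_component_eq integrable_diff)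
      then show ?thesis using ii eq[OF le sub] by (simp add: integral_diff)
    qed
    have "(f12 (s,t) - f21 (s,t)) \<bullet> j \<le> 0" for j
      by (rule nonpos_if_box_integrals_zero[OF D p, of "\<lambda>x. (f12 x - f21 x) \<bullet> j"])
        (intro continuous_intros c, rule 1)
    from this[of i] this[of "-i"] show ?thesis by simp
  qed
  from this[of "f12 (s,t) - f21 (s,t)"] show ?thesis by simp
qed

subsection \<open>Cutoff functions\<close>

text \<open>Nothing is required outside \<open>[-r, r]\<close>; derivatives at the end points are one-sided.\<close>

definition cutoff :: "real \<Rightarrow> real \<Rightarrow> real \<Rightarrow> real \<Rightarrow> (real \<Rightarrow> real) \<Rightarrow> (real \<Rightarrow> real) \<Rightarrow> bool" where
  "cutoff r \<rho>1 \<rho>2 L b b' \<longleftrightarrow> continuous_on {-r..r} b' \<and>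
     (\<forall>s\<in>{-r..r}. (b has_real_derivative b' s) (at s within {-r..r}) \<and>
        0 \<le> b s \<and> b s \<le> 1 \<and> \<bar>b' s\<bar> \<le> L \<and> (\<bar>s\<bar> \<le> \<rho>1 \<longrightarrow> b s = 1) \<and> (\<rho>2 \<le> \<bar>s\<bar> \<longrightarrow> b s = 0) \<and>
        (b' s \<noteq> 0 \<longrightarrow> \<rho>1 < \<bar>s\<bar> \<and> \<bar>s\<bar> < \<rho>2))"

text \<open>The cutoff varies only where the density \<open>k\<close> is positive; choosing \<open>k\<close> to vanish at bad values
  of the coordinate avoids any discussion of the measure of the set of bad lines.\<close>

lemma cutoff_from_density:
  fixes k :: "real \<Rightarrow> real"
  assumes r: "0 \<le> \<rho>1" "\<rho>1 < \<rho>2" "\<rho>2 \<le> r"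
    and c: "continuous_on {-r..r} k" and k: "\<And>z. z \<in> {-r..r} \<Longrightarrow> 0 \<le> k z \<and> k z \<le> B"
    and z: "\<And>z. z \<in> {-r..r} \<Longrightarrow> z \<le> \<rho>1 \<or> \<rho>2 \<le> z \<Longrightarrow> k z = 0"
    and J: "0 < J" "J \<le> integral {-r..r} k"
  obtains b b' where "cutoff r \<rho>1 \<rho>2 (B / J) b b'"
    "\<And>s. s \<in> {-r..r} \<Longrightarrow> b' s \<noteq> 0 \<Longrightarrow> k \<bar>s\<bar> \<noteq> 0"
proof -
  define I where "I = integral {-r..r} k"
  define K where "K x = integral {-r..x} k" for x
  have I: "I > 0" "J \<le> I" using J by (auto simp: I_def)
  have int: "k integrable_on {a..b}" if "-r \<le> a" "b \<le> r" for a b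
    using c that by (intro integrable_continuous_real) (auto intro: continuous_on_subset)
  have dK: "(K has_real_derivative k x) (at x within {-r..r})" if "x \<in> {-r..r}" for x
    unfolding K_def[abs_def] using integral_has_real_derivative[OF c that] .
  have dK': "((\<lambda>x. K (- x)) has_real_derivative - k (- x)) (at x within {-r..r})" if "x \<in> {-r..r}" for x
  proof -
    have "((\<lambda>x. K (- x)) has_real_derivative k (- x) * (- 1)) (at x within {-r..r})"
      using DERIV_image_chain[of K "k (- x)" "\<lambda>x. - x" x "{-r..r}" "-1"] dK[of "-x"] that
        DERIV_minus[OF DERIV_ident, of x "{-r..r}"] by (simp add: o_def)
    then show ?thesis by simp
  qed
  have K0: "K x = 0" if "x \<in> {-r..r}" "x \<le> \<rho>1" for x
    unfolding K_def by (rule integral_unique, rule has_integral_is_0) (use that z in auto)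
  have KI: "K x = I" if "x \<in> {-r..r}" "\<rho>2 \<le> x" for x
  proof -
    have "integral {-r..x} k + integral {x..r} k = I"
      unfolding I_def using that by (intro Henstock_Kurzweil_Integration.integral_combine int) auto
    moreover have "integral {x..r} k = 0"
      by (rule integral_unique, rule has_integral_is_0) (use that z in auto)
    ultimately show ?thesis by (simp add: K_def)
  qed
  have K01: "0 \<le> K x" "K x \<le> I" if "x \<in> {-r..r}" for x
  proof -
    have *: "integral {-r..x} k + integral {x..r} k = I"
      unfolding I_def using that by (intro Henstock_Kurzweil_Integration.integral_combine int) auto
    have "0 \<le> integral {x..r} k" "0 \<le> K x"
      unfolding K_def using that k by (auto intro!: integral_nonneg int)
    then show "0 \<le> K x" "K x \<le> I" using * by (auto simp: K_def)
  qed
  \<comment> \<open>\<open>K / I\<close> climbs from 0 to 1 between \<rho>1 and \<rho>2, and at most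
    one of \<open>K s\<close> and \<open>K (- s)\<close> is nonzero. So \<open>b\<close> is even and
    stays between 0 and 1.\<close>
  define b where "b s = 1 - K s / I - K (- s) / I" for s
  define b' where "b' s = (k (- s) - k s) / I" for s
  have one: "k s = 0 \<or> k (-s) = 0" if "s \<in> {-r..r}" for s
    using z[of s] z[of "-s"] that r by (cases "s \<ge> 0") auto
  have cm: "continuous_on {-r..r} (\<lambda>s. k (- s))"
    by (rule continuous_on_compose2[OF c]) (auto intro!: continuous_intros)
  have "cutoff r \<rho>1 \<rho>2 (B / J) b b'"
    unfolding cutoff_def
  proof (intro conjI ballI)
    show "continuous_on {-r..r} b'" unfolding b'_def[abs_def] by (intro continuous_intros c cm) (use I in auto)
    fix s assume s: "s \<in> {-r..r}"
    have s': "-s \<in> {-r..r}" using s by auto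
    show "(b has_real_derivative b' s) (at s within {-r..r})"
      unfolding b_def[abs_def] b'_def using I
      by (auto intro!: derivative_eq_intros dK dK' s simp: field_simps)
    have "K s = 0 \<or> K (-s) = 0" using K0[OF s] K0[OF s'] r by (cases "s \<ge> 0") auto
    then show "0 \<le> b s" "b s \<le> 1" using K01[OF s] K01[OF s'] I by (auto simp: b_def field_simps)
    have "\<bar>k (- s) - k s\<bar> \<le> B" using one[OF s] k[OF s] k[OF s'] by auto
    then show "\<bar>b' s\<bar> \<le> B / J" using I J(1) by (auto simp: b'_def abs_divide intro!: frac_le)
    show "\<bar>s\<bar> \<le> \<rho>1 \<longrightarrow> b s = 1" using K0[OF s] K0[OF s'] by (auto simp: b_def)
    show "\<rho>2 \<le> \<bar>s\<bar> \<longrightarrow> b s = 0" using KI[OF s] KI[OF s'] K0[OF s] K0[OF s'] r I by (auto simp: b_def abs_if split: if_splits)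
    have "k s = 0 \<and> k (- s) = 0" if "\<bar>s\<bar> \<le> \<rho>1 \<or> \<rho>2 \<le> \<bar>s\<bar>"
      using z[OF s] z[OF s'] that r by (cases "s \<ge> 0") auto
    then show "b' s \<noteq> 0 \<longrightarrow> \<rho>1 < \<bar>s\<bar> \<and> \<bar>s\<bar> < \<rho>2"
      by (cases "\<bar>s\<bar> \<le> \<rho>1 \<or> \<rho>2 \<le> \<bar>s\<bar>") (auto simp: b'_def)
  qed
  moreover have "k \<bar>s\<bar> \<noteq> 0" if s: "s \<in> {-r..r}" "b' s \<noteq> 0" for s
  proof (cases "s \<ge> 0")
    case True
    then have "k (-s) = 0" using s z[of "-s"] r by auto
    then show ?thesis using s True by (auto simp: b'_def)
  next
    case False
    then have "k s = 0" using s z[of "s"] r by auto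
    then show ?thesis using s False by (auto simp: b'_def)
  qed
  ultimately show ?thesis by (rule that)
qed

section \<open>A parabolic density and the plain cutoff\<close>

definition bump :: "real \<Rightarrow> real \<Rightarrow> real \<Rightarrow> real" where
  "bump a b z = max 0 ((z - a) * (b - z))"

lemma bump_nonneg: "0 \<le> bump a b z"
  by (simp add: bump_def)

lemma bump_le: "bump a b z \<le> (b - a)\<^sup>2 / 4"
proof -
  have "(b - a)\<^sup>2 / 4 - (z - a) * (b - z) = (z - (a + b) / 2)\<^sup>2" by (simp add: power2_eq_square field_simps)
  then show ?thesis by (smt (verit) bump_def zero_le_power2 divide_nonneg_nonneg)
qed

lemma bump_eq_0: "a \<le> b \<Longrightarrow> z \<le> a \<or> b \<le> z \<Longrightarrow> bump a b z = 0"
  by (auto simp: bump_def mult_le_0_iff)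

lemma continuous_on_bump [continuous_intros]: "continuous_on S (bump a b)"
  unfolding bump_def[abs_def] by (intro continuous_intros)

lemma integral_bump:
  assumes "a \<le> b" "-r \<le> a" "b \<le> r"
  shows "integral {-r..r} (bump a b) = (b - a) ^ 3 / 6"
proof -
  have "((\<lambda>z. (z - a) * (b - z)) has_integral (b - a) ^ 3 / 6) {a..b}"
  proof -
    have "((\<lambda>z. (z - a) * (b - z)) has_integral
       (\<lambda>z. (b - a) * (z - a)\<^sup>2 / 2 - (z - a) ^ 3 / 3) b - (\<lambda>z. (b - a) * (z - a)\<^sup>2 / 2 - (z - a) ^ 3 / 3) a) {a..b}"
      by (rule fundamental_theorem_of_calculus[OF assms(1)], unfold has_real_derivative_iff_has_vector_derivative[symmetric])
         (auto intro!: derivative_eq_intros simp: field_simps power2_eq_square)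
    then show ?thesis by (simp add: power2_eq_square power3_eq_cube field_simps)
  qed
  then have "(bump a b has_integral (b - a) ^ 3 / 6) {a..b}"
    by (rule has_integral_eq[rotated]) (auto simp: bump_def max_def mult_less_0_iff)
  then have "(bump a b has_integral (b - a) ^ 3 / 6) {-r..r}"
    by (rule has_integral_on_superset) (use assms in \<open>auto intro!: bump_eq_0\<close>)
  then show ?thesis by (rule integral_unique)
qed

lemma cutoff_exists:
  assumes "0 \<le> \<rho>1" "\<rho>1 < \<rho>2" "\<rho>2 \<le> r"
  obtains b b' where "cutoff r \<rho>1 \<rho>2 (2 / (\<rho>2 - \<rho>1)) b b'"
proof -
  \<comment> \<open>The height 1/4 is relaxed to 1/3 so that height over integral becomes the round
    slope \<open>2 / (\<rho>2 - \<rho>1)\<close>.\<close>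
  have "(\<rho>2 - \<rho>1)\<^sup>2 / 4 \<le> (\<rho>2 - \<rho>1)\<^sup>2 / 3" by simp
  then have *: "bump \<rho>1 \<rho>2 z \<le> (\<rho>2 - \<rho>1)\<^sup>2 / 3" for z using bump_le[of \<rho>1 \<rho>2 z] by linarith
  have eq: "(\<rho>2 - \<rho>1)\<^sup>2 / 3 / ((\<rho>2 - \<rho>1) ^ 3 / 6) = 2 / (\<rho>2 - \<rho>1)"
    using assms by (simp add: power2_eq_square power3_eq_cube)
  obtain b b' where "cutoff r \<rho>1 \<rho>2 ((\<rho>2 - \<rho>1)\<^sup>2 / 3 / ((\<rho>2 - \<rho>1) ^ 3 / 6)) b b'"
  proof (rule cutoff_from_density[OF assms continuous_on_bump])
    show "0 \<le> bump \<rho>1 \<rho>2 z \<and> bump \<rho>1 \<rho>2 z \<le> (\<rho>2 - \<rho>1)\<^sup>2 / 3" for z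
      using * bump_nonneg by simp
    show "bump \<rho>1 \<rho>2 z = 0" if "z \<le> \<rho>1 \<or> \<rho>2 \<le> z" for z
      using bump_eq_0[of \<rho>1 \<rho>2 z] that assms by simp
    show "0 < (\<rho>2 - \<rho>1) ^ 3 / 6" using assms by simp
    show "(\<rho>2 - \<rho>1) ^ 3 / 6 \<le> integral {-r..r} (bump \<rho>1 \<rho>2)" using assms by (simp add: integral_bump)
  qed
  then show ?thesis unfolding eq by (rule that)
qed

subsection \<open>Integral identities for solutions\<close>

lemma has_real_derivative_inner:
  fixes f g :: "real \<Rightarrow> 'b::real_inner"
  assumes "(f has_vector_derivative f') (at x within S)" "(g has_vector_derivative g') (at x within S)"
  shows "((\<lambda>x. f x \<bullet> g x) has_real_derivative f' \<bullet> g x + f x \<bullet> g') (at x within S)"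
  unfolding has_field_derivative_def
  by (rule has_derivative_eq_rhs[OF has_derivative_inner[OF assms[unfolded has_vector_derivative_def]]])
    (auto simp: fun_eq_iff algebra_simps)

lemma has_real_derivative_norm_sq:
  fixes f :: "real \<Rightarrow> 'b::real_inner"
  assumes "(f has_vector_derivative f') (at x within S)"
  shows "((\<lambda>x. (norm (f x))\<^sup>2) has_real_derivative 2 * (f x \<bullet> f')) (at x within S)"
  using has_real_derivative_inner[OF assms assms] by (simp add: power2_norm_eq_inner inner_commute)

lemma cutoffD:
  assumes "cutoff r \<rho>1 \<rho>2 L b b'" and "\<bar>s\<bar> \<le> r"
  shows "(b has_real_derivative b' s) (at s within {-r..r})" "0 \<le> b s" "b s \<le> 1" "\<bar>b' s\<bar> \<le> L"
    "\<bar>s\<bar> \<le> \<rho>1 \<Longrightarrow> b s = 1" "\<rho>2 \<le> \<bar>s\<bar> \<Longrightarrow> b s = 0" "b' s \<noteq> 0 \<Longrightarrow> \<rho>1 < \<bar>s\<bar>" "b' s \<noteq> 0 \<Longrightarrow> \<bar>s\<bar> < \<rho>2"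
proof -
  have "s \<in> {-r..r}" using assms(2) by (simp add: abs_le_iff)
  note * = assms(1)[unfolded cutoff_def, THEN conjunct2, rule_format, OF this]
  show "(b has_real_derivative b' s) (at s within {-r..r})" "0 \<le> b s" "b s \<le> 1" "\<bar>b' s\<bar> \<le> L"
    "\<bar>s\<bar> \<le> \<rho>1 \<Longrightarrow> b s = 1" "\<rho>2 \<le> \<bar>s\<bar> \<Longrightarrow> b s = 0" "b' s \<noteq> 0 \<Longrightarrow> \<rho>1 < \<bar>s\<bar>" "b' s \<noteq> 0 \<Longrightarrow> \<bar>s\<bar> < \<rho>2"
    using * by blast+
qed

lemma cont_cutoff:
  assumes "cutoff r \<rho>1 \<rho>2 L b b'"
  shows "continuous_on (sq r) (\<lambda>x. b (fst x))" "continuous_on (sq r) (\<lambda>x. b (snd x))"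
    "continuous_on (sq r) (\<lambda>x. b' (fst x))" "continuous_on (sq r) (\<lambda>x. b' (snd x))"
proof -
  have "continuous_on {-r..r} b" "continuous_on {-r..r} b'"
    using assms unfolding cutoff_def by (auto intro!: DERIV_continuous_on)
  then show "continuous_on (sq r) (\<lambda>x. b (fst x))" "continuous_on (sq r) (\<lambda>x. b (snd x))"
    "continuous_on (sq r) (\<lambda>x. b' (fst x))" "continuous_on (sq r) (\<lambda>x. b' (snd x))"
    by (auto elim!: continuous_on_compose2 intro!: continuous_intros simp: sq_def cbox_Pair_eq)
qed

lemma integral_sq_mono:
  fixes f g :: "real \<times> real \<Rightarrow> real"
  assumes "continuous_on (sq r) f" "continuous_on (sq r) g" "\<And>x. x \<in> sq r \<Longrightarrow> f x \<le> g x"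
  shows "integral (sq r) f \<le> integral (sq r) g"
  using assms unfolding sq_def by (intro integral_le integrable_continuous) auto

lemma integrable_sq:
  fixes f :: "real \<times> real \<Rightarrow> real"
  shows "continuous_on (sq r) f \<Longrightarrow> f integrable_on sq r"
  unfolding sq_def by (rule integrable_continuous)

text \<open>The constant \<open>c\<close> collects all comparison constants near the wells, \<open>d\<close> is the radius on which they
  hold, and \<open>N\<close>, \<open>H\<close> bound the first two derivatives of \<open>V\<close> on the ball of radius \<open>M\<close>, in which
  solutions are trapped.\<close>

locale potential =
  fixes V :: "'b::euclidean_space \<Rightarrow> real" and dV :: "'b \<Rightarrow> 'b" and HV :: "'b \<Rightarrow> 'b \<Rightarrow> 'b"
    and Z :: "'b set" and c d M N H :: real
  assumes V_nonneg: "0 \<le> V y"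
    and V_deriv: "(V has_derivative (\<lambda>h. dV y \<bullet> h)) (at y)"
    and dV_deriv: "(dV has_derivative HV y) (at y)"
    and finite_Z: "finite Z"
    and c: "0 < c" "c \<le> 1" and d: "0 < d"
    and well: "\<sigma> \<in> Z \<Longrightarrow> norm (y - \<sigma>) \<le> d \<Longrightarrow> c * (norm (y - \<sigma>))\<^sup>2 \<le> (y - \<sigma>) \<bullet> dV y"
      "\<sigma> \<in> Z \<Longrightarrow> norm (y - \<sigma>) \<le> d \<Longrightarrow> c * (norm (y - \<sigma>))\<^sup>2 \<le> V y"
      "\<sigma> \<in> Z \<Longrightarrow> norm (y - \<sigma>) \<le> d \<Longrightarrow> c * V y \<le> (norm (y - \<sigma>))\<^sup>2"
      "\<sigma> \<in> Z \<Longrightarrow> norm (y - \<sigma>) \<le> d \<Longrightarrow> c * (norm (dV y))\<^sup>2 \<le> V y"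
    and near_well: "0 < a \<Longrightarrow> \<exists>\<delta>>0. \<forall>y. V y < \<delta> \<longrightarrow> (\<exists>\<sigma>\<in>Z. norm (y - \<sigma>) \<le> a)"
    and M: "M < norm y \<Longrightarrow> 0 < y \<bullet> dV y" "\<sigma> \<in> Z \<Longrightarrow> norm (y - \<sigma>) \<le> d \<Longrightarrow> norm y \<le> M" "0 \<le> M"
    and N: "norm y \<le> M \<Longrightarrow> norm (dV y) \<le> N"
    and H: "norm y \<le> M \<Longrightarrow> norm (HV y h) \<le> H * norm h"
begin

lemma continuous_on_V [continuous_intros]: "continuous_on S f \<Longrightarrow> continuous_on S (\<lambda>x. V (f x))"
  by (rule continuous_on_compose2[of UNIV V S f])
    (auto intro!: continuous_at_imp_continuous_on has_derivative_continuous V_deriv)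

lemma continuous_on_dV [continuous_intros]: "continuous_on S f \<Longrightarrow> continuous_on S (\<lambda>x. dV (f x))"
  by (rule continuous_on_compose2[of UNIV dV S f])
    (auto intro!: continuous_at_imp_continuous_on has_derivative_continuous dV_deriv)

lemma has_real_derivative_V:
  assumes "(f has_vector_derivative f') (at x within S)"
  shows "((\<lambda>x. V (f x)) has_real_derivative dV (f x) \<bullet> f') (at x within S)"
  unfolding has_field_derivative_def
  by (rule has_derivative_eq_rhs[OF has_derivative_in_compose[OF assms[unfolded has_vector_derivative_def]
        has_derivative_at_withinI[OF V_deriv]]]) (auto simp: fun_eq_iff algebra_simps)

end

text \<open>Derivatives are recorded along coordinate lines, the form in which Fubini and the tests
  on lines consume them. Both mixed second derivatives carry the single name \<open>u12\<close>, and
  the third derivatives are grouped as in the differentiated equation, which is how Bernstein's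
  method meets them.\<close>

locale planar = potential V dV HV Z c d M N H
  for V :: "'a::euclidean_space \<Rightarrow> real" and dV HV Z c d M N H +
  fixes D :: "(real \<times> real) set"
    and u u1 u2 u11 u12 u22 u111 u122 u112 u222 :: "real \<times> real \<Rightarrow> 'a"
  assumes cont: "continuous_on D u" "continuous_on D u1" "continuous_on D u2"
      "continuous_on D u11" "continuous_on D u12" "continuous_on D u22"
    and du: "(s,t) \<in> D \<Longrightarrow> ((\<lambda>s. u (s,t)) has_vector_derivative u1 (s,t)) (at s)"
      "(s,t) \<in> D \<Longrightarrow> ((\<lambda>t. u (s,t)) has_vector_derivative u2 (s,t)) (at t)"
      "(s,t) \<in> D \<Longrightarrow> ((\<lambda>s. u1 (s,t)) has_vector_derivative u11 (s,t)) (at s)"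
      "(s,t) \<in> D \<Longrightarrow> ((\<lambda>t. u1 (s,t)) has_vector_derivative u12 (s,t)) (at t)"
      "(s,t) \<in> D \<Longrightarrow> ((\<lambda>s. u2 (s,t)) has_vector_derivative u12 (s,t)) (at s)"
      "(s,t) \<in> D \<Longrightarrow> ((\<lambda>t. u2 (s,t)) has_vector_derivative u22 (s,t)) (at t)"
    and ddu: "(s,t) \<in> D \<Longrightarrow> ((\<lambda>s. u11 (s,t)) has_vector_derivative u111 (s,t)) (at s)"
      "(s,t) \<in> D \<Longrightarrow> ((\<lambda>t. u12 (s,t)) has_vector_derivative u122 (s,t)) (at t)"
      "(s,t) \<in> D \<Longrightarrow> ((\<lambda>s. u12 (s,t)) has_vector_derivative u112 (s,t)) (at s)"
      "(s,t) \<in> D \<Longrightarrow> ((\<lambda>t. u22 (s,t)) has_vector_derivative u222 (s,t)) (at t)"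
    and eqn: "x \<in> D \<Longrightarrow> u11 x + u22 x = dV (u x)"
    and deqn: "x \<in> D \<Longrightarrow> u111 x + u122 x = HV (u x) (u1 x)"
      "x \<in> D \<Longrightarrow> u112 x + u222 x = HV (u x) (u2 x)"
begin

text \<open>The squared norm of the gradient; \<open>e\<close> is then the energy density at
  \<epsilon> = 1.\<close>

definition w :: "real \<times> real \<Rightarrow> real" where
  "w x = (norm (u1 x))\<^sup>2 + (norm (u2 x))\<^sup>2"

definition e :: "real \<times> real \<Rightarrow> real" where
  "e x = w x / 2 + V (u x)"

definition E :: "real \<Rightarrow> real" where
  "E r = integral (sq r) e"

lemma w_nonneg: "0 \<le> w x" by (simp add: w_def)

lemma e_nonneg: "0 \<le> e x" using V_nonneg w_nonneg by (simp add: e_def)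

lemma cont_sub:
  assumes "S \<subseteq> D"
  shows "continuous_on S u" "continuous_on S u1" "continuous_on S u2"
      "continuous_on S u11" "continuous_on S u12" "continuous_on S u22"
      "continuous_on S w" "continuous_on S e"
proof -
  show *: "continuous_on S u" "continuous_on S u1" "continuous_on S u2"
      "continuous_on S u11" "continuous_on S u12" "continuous_on S u22"
    using assms cont by (auto intro: continuous_on_subset)
  show "continuous_on S w" "continuous_on S e"
    unfolding w_def[abs_def] e_def[abs_def] by (intro continuous_intros * | simp)+
qed

text \<open>The vector field with components b b g(q) (v \<bullet> u1) and b b g(q) (v \<bullet> u2)
  vanishes on the boundary, so its divergence integrates to zero. For a nonnegative decreasing
  \<open>g\<close> living near a well, the term with \<open>g'\<close> is the only bulk term of the
  wrong sign.\<close>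

lemma test_identity:
  fixes \<sigma> :: 'a
  assumes r: "0 \<le> r" "\<rho>2 \<le> r" and sub: "sq r \<subseteq> D" and b: "cutoff r \<rho>1 \<rho>2 L b b'"
    and g: "\<And>q. (g has_real_derivative g' q) (at q)" "continuous_on UNIV g'"
  defines "v \<equiv> \<lambda>x. u x - \<sigma>" and "q \<equiv> \<lambda>x. (norm (u x - \<sigma>))\<^sup>2"
  shows "integral (sq r) (\<lambda>x. b (fst x) * b (snd x) * (g (q x) * w x + g (q x) * (v x \<bullet> dV (u x))
              + 2 * g' (q x) * ((v x \<bullet> u1 x)\<^sup>2 + (v x \<bullet> u2 x)\<^sup>2))
            + g (q x) * (b' (fst x) * b (snd x) * (v x \<bullet> u1 x) + b (fst x) * b' (snd x) * (v x \<bullet> u2 x))) = 0"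
proof -
  define f1 where "f1 x = b' (fst x) * b (snd x) * (g (q x) * (v x \<bullet> u1 x))
      + b (fst x) * b (snd x) * (g' (q x) * (2 * (v x \<bullet> u1 x)) * (v x \<bullet> u1 x) + g (q x) * (u1 x \<bullet> u1 x + v x \<bullet> u11 x))" for x
  define f2 where "f2 x = b (fst x) * b' (snd x) * (g (q x) * (v x \<bullet> u2 x))
      + b (fst x) * b (snd x) * (g' (q x) * (2 * (v x \<bullet> u2 x)) * (v x \<bullet> u2 x) + g (q x) * (u2 x \<bullet> u2 x + v x \<bullet> u22 x))" for x
  have gc: "continuous_on S (\<lambda>x. g (h x))" "continuous_on S (\<lambda>x. g' (h x))" if "continuous_on S h" for h and S :: "(real\<times>real) set"
    using that continuous_on_compose2[OF g(2)] continuous_on_compose2[of UNIV g S h] DERIV_continuous_on[of UNIV g g'] g(1)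
    by auto
  have qv: "q x = (norm (v x))\<^sup>2" for x by (simp add: q_def v_def)
  have c: "continuous_on (sq r) f1" "continuous_on (sq r) f2"
    unfolding f1_def[abs_def] f2_def[abs_def] v_def q_def
    by (intro continuous_intros gc cont_sub[OF sub] cont_cutoff[OF b])+
  have b0: "b s = 0" if "\<bar>s\<bar> = r" for s using cutoffD(6)[OF b, of s] r that by linarith
  have gd: "((\<lambda>s. g (h s)) has_real_derivative g' (h s) * h') (at s within S)"
    if "(h has_real_derivative h') (at s within S)" for h h' s S
    using DERIV_chain2[OF g(1) that] .
  have bd: "(b has_real_derivative b' s) (at s within {-r..r})" if "\<bar>s\<bar> \<le> r" for s
    by (rule cutoffD(1)[OF b that])
  have "integral (sq r) (\<lambda>x. f1 x + f2 x) = 0"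
  proof (rule divergence_theorem_vanishing[OF r(1) c,
       of "\<lambda>x. b (fst x) * b (snd x) * (g (q x) * (v x \<bullet> u1 x))" "\<lambda>x. b (fst x) * b (snd x) * (g (q x) * (v x \<bullet> u2 x))"])
    fix s t assume st: "(s,t) \<in> sq r"
    then have D: "(s,t) \<in> D" and bs: "\<bar>s\<bar> \<le> r" "\<bar>t\<bar> \<le> r" using sub by (auto simp: mem_sq)
    note dd = du[OF D, THEN has_vector_derivative_at_within]
    have v1: "((\<lambda>s. v (s,t)) has_vector_derivative u1 (s,t)) (at s within {-r..r})"
      and v2: "((\<lambda>t. v (s,t)) has_vector_derivative u2 (s,t)) (at t within {-r..r})"
      unfolding v_def using has_vector_derivative_diff[OF dd(1) has_vector_derivative_const]
        has_vector_derivative_diff[OF dd(2) has_vector_derivative_const] by simp_all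
    have q1: "((\<lambda>s. g (q (s,t))) has_real_derivative g' (q (s,t)) * (2 * (v (s,t) \<bullet> u1 (s,t)))) (at s within {-r..r})"
      unfolding qv by (rule gd[OF has_real_derivative_norm_sq[OF v1]])
    have p1: "((\<lambda>s. v (s,t) \<bullet> u1 (s,t)) has_real_derivative u1 (s,t) \<bullet> u1 (s,t) + v (s,t) \<bullet> u11 (s,t)) (at s within {-r..r})"
      by (rule has_real_derivative_inner[OF v1 dd(3)])
    have "((\<lambda>s. b s * b t * (g (q (s,t)) * (v (s,t) \<bullet> u1 (s,t)))) has_real_derivative f1 (s,t)) (at s within {-r..r})"
      by (rule DERIV_cong[OF DERIV_mult[OF DERIV_cmult_right[OF bd[OF bs(1)]] DERIV_mult[OF q1 p1]]])
        (simp add: f1_def algebra_simps)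
    then show "((\<lambda>s. b (fst (s,t)) * b (snd (s,t)) * (g (q (s,t)) * (v (s,t) \<bullet> u1 (s,t)))) has_real_derivative f1 (s,t)) (at s within {-r..r})"
      by simp
    have q2: "((\<lambda>t. g (q (s,t))) has_real_derivative g' (q (s,t)) * (2 * (v (s,t) \<bullet> u2 (s,t)))) (at t within {-r..r})"
      unfolding qv by (rule gd[OF has_real_derivative_norm_sq[OF v2]])
    have p2: "((\<lambda>t. v (s,t) \<bullet> u2 (s,t)) has_real_derivative u2 (s,t) \<bullet> u2 (s,t) + v (s,t) \<bullet> u22 (s,t)) (at t within {-r..r})"
      by (rule has_real_derivative_inner[OF v2 dd(6)])
    have "((\<lambda>t. b s * b t * (g (q (s,t)) * (v (s,t) \<bullet> u2 (s,t)))) has_real_derivative f2 (s,t)) (at t within {-r..r})"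
      by (rule DERIV_cong[OF DERIV_mult[OF DERIV_cmult[OF bd[OF bs(2)]] DERIV_mult[OF q2 p2]]])
        (simp add: f2_def algebra_simps)
    then show "((\<lambda>t. b (fst (s,t)) * b (snd (s,t)) * (g (q (s,t)) * (v (s,t) \<bullet> u2 (s,t)))) has_real_derivative f2 (s,t)) (at t within {-r..r})"
      by simp
  next
    fix s t :: real assume "\<bar>s\<bar> = r"
    then show "b (fst (s,t)) * b (snd (s,t)) * (g (q (s,t)) * (v (s,t) \<bullet> u1 (s,t))) = 0" by (simp only: b0 fst_conv mult_zero_left)
  next
    fix s t :: real assume "\<bar>t\<bar> = r"
    then show "b (fst (s,t)) * b (snd (s,t)) * (g (q (s,t)) * (v (s,t) \<bullet> u2 (s,t))) = 0" by (simp only: b0 snd_conv mult_zero_left mult_zero_right)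
  qed
  also have "integral (sq r) (\<lambda>x. f1 x + f2 x) = integral (sq r) (\<lambda>x. b (fst x) * b (snd x) * (g (q x) * w x + g (q x) * (v x \<bullet> dV (u x))
              + 2 * g' (q x) * ((v x \<bullet> u1 x)\<^sup>2 + (v x \<bullet> u2 x)\<^sup>2))
            + g (q x) * (b' (fst x) * b (snd x) * (v x \<bullet> u1 x) + b (fst x) * b' (snd x) * (v x \<bullet> u2 x)))"
  proof (rule integral_cong)
    fix x assume "x \<in> sq r"
    then have "x \<in> D" using sub by blast
    then have "dV (u x) = u11 x + u22 x" by (rule eqn[symmetric])
    moreover have w: "w x = u1 x \<bullet> u1 x + u2 x \<bullet> u2 x" by (simp add: w_def power2_norm_eq_inner)
    ultimately show "f1 x + f2 x = b (fst x) * b (snd x) * (g (q x) * w x + g (q x) * (v x \<bullet> dV (u x))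
              + 2 * g' (q x) * ((v x \<bullet> u1 x)\<^sup>2 + (v x \<bullet> u2 x)\<^sup>2))
            + g (q x) * (b' (fst x) * b (snd x) * (v x \<bullet> u1 x) + b (fst x) * b' (snd x) * (v x \<bullet> u2 x))"
      by (simp add: f1_def f2_def w inner_add_right algebra_simps power2_eq_square)
  qed
  finally show ?thesis .
qed

text \<open>Where \<open>g\<close> is nonzero, \<open>u\<close> is within \<open>d\<close> of the
  well and the comparisons \<open>well\<close> apply. V \<le> |v|^2 / c and |v|^2 \<le> (v \<bullet>
  dV) / c give the factor \<open>c\<^sup>2\<close>; |v|^2 \<le> V / c turns the cutoff term L |v|
  |\<nabla>u| into \<open>L / c * e\<close>. The term with \<open>g'\<close> is kept, after
  Cauchy-Schwarz, to be estimated differently in each application.\<close>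

lemma test_inequality:
  fixes \<sigma> :: 'a
  assumes \<sigma>: "\<sigma> \<in> Z"
    and r: "0 \<le> r" "\<rho>2 \<le> r" and sub: "sq r \<subseteq> D" and b: "cutoff r \<rho>1 \<rho>2 L b b'"
    and g: "\<And>q. (g has_real_derivative g' q) (at q)" "continuous_on UNIV g'"
    and g01: "\<And>q. 0 \<le> q \<Longrightarrow> 0 \<le> g q \<and> g q \<le> 1" "\<And>q. d\<^sup>2 \<le> q \<Longrightarrow> g q = 0"
  defines "q \<equiv> \<lambda>x. (norm (u x - \<sigma>))\<^sup>2"
  shows "c\<^sup>2 * integral (sq r) (\<lambda>x. b (fst x) * b (snd x) * g (q x) * e x)
     \<le> integral (sq r) (\<lambda>x. b (fst x) * b (snd x) * (2 * \<bar>g' (q x)\<bar> * q x * w x)) + L / c * E r"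
proof -
  define v where "v x = u x - \<sigma>" for x
  define I where "I x = b (fst x) * b (snd x) * (g (q x) * w x + g (q x) * (v x \<bullet> dV (u x))
              + 2 * g' (q x) * ((v x \<bullet> u1 x)\<^sup>2 + (v x \<bullet> u2 x)\<^sup>2))
            + g (q x) * (b' (fst x) * b (snd x) * (v x \<bullet> u1 x) + b (fst x) * b' (snd x) * (v x \<bullet> u2 x))" for x
  have I0: "integral (sq r) I = 0"
    using test_identity[OF r sub b g, of \<sigma>] unfolding I_def[abs_def] v_def q_def .
  have gc: "continuous_on S (\<lambda>x. g (h x))" "continuous_on S (\<lambda>x. g' (h x))" if "continuous_on S h" for h and S :: "(real\<times>real) set"
    using that continuous_on_compose2[OF g(2)] continuous_on_compose2[of UNIV g S h] DERIV_continuous_on[of UNIV g g'] g(1)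
    by auto
  have cI: "continuous_on (sq r) I"
    unfolding I_def[abs_def] v_def q_def
    by (intro continuous_intros gc cont_sub[OF sub] cont_cutoff[OF b])+
  define A where "A x = b (fst x) * b (snd x) * g (q x) * e x" for x
  define B where "B x = b (fst x) * b (snd x) * (2 * \<bar>g' (q x)\<bar> * q x * w x)" for x
  have cA: "continuous_on (sq r) A" and cB: "continuous_on (sq r) B"
    unfolding A_def[abs_def] B_def[abs_def] q_def
    by (intro continuous_intros gc cont_sub[OF sub] cont_cutoff[OF b])+
  have main: "c\<^sup>2 * A x - B x - L / c * e x \<le> I x" if x: "x \<in> sq r" for x
  proof -
    obtain s t where st: "x = (s,t)" "\<bar>s\<bar> \<le> r" "\<bar>t\<bar> \<le> r" using x by (cases x) (auto simp: mem_sq)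
    note bs = cutoffD[OF b st(2)] and bt = cutoffD[OF b st(3)]
    have L: "0 \<le> L" using bs(4) by linarith
    define P where "P = b s * b t"
    have P: "0 \<le> P" "P \<le> 1" using bs bt by (auto simp: P_def mult_le_one)
    define G where "G = g (q x)"
    have G: "0 \<le> G" "G \<le> 1" using g01(1)[of "q x"] by (auto simp: G_def q_def)
    have qv: "q x = (norm (v x))\<^sup>2" by (simp add: q_def v_def)
    have near: "norm (v x) \<le> d" if "G \<noteq> 0"
    proof (rule ccontr)
      assume "\<not> norm (v x) \<le> d"
      then have "d\<^sup>2 \<le> q x" unfolding qv using d by (intro power_mono) auto
      then show False using g01(2) that by (auto simp: G_def)
    qed
    have cc: "c\<^sup>2 \<le> 1" "c\<^sup>2 \<le> c" using c by (auto simp: power2_eq_square mult_le_one intro: mult_left_le)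
    have 1: "c\<^sup>2 * G * e x \<le> G * w x + G * (v x \<bullet> dV (u x))"
    proof (cases "G = 0")
      case False
      then have n: "norm (u x - \<sigma>) \<le> d" using near by (simp add: v_def)
      have "c * (c * V (u x)) \<le> c * (norm (v x))\<^sup>2"
        using well(3)[OF \<sigma> n] c by (intro mult_left_mono) (auto simp: v_def)
      also have "\<dots> \<le> v x \<bullet> dV (u x)" using well(1)[OF \<sigma> n] by (simp add: v_def)
      finally have "c\<^sup>2 * V (u x) \<le> v x \<bullet> dV (u x)" by (simp add: power2_eq_square)
      moreover have "c\<^sup>2 * (w x / 2) \<le> 1 * w x" using cc w_nonneg[of x] by (intro mult_mono) auto
      ultimately have "c\<^sup>2 * e x \<le> w x + v x \<bullet> dV (u x)" by (simp add: e_def algebra_simps)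
      then have "G * (c\<^sup>2 * e x) \<le> G * (w x + v x \<bullet> dV (u x))" using G by (intro mult_left_mono)
      then show ?thesis by (simp add: algebra_simps)
    qed simp
    have cs: "(v x \<bullet> u1 x)\<^sup>2 + (v x \<bullet> u2 x)\<^sup>2 \<le> q x * w x"
    proof -
      have "(v x \<bullet> y)\<^sup>2 \<le> (norm (v x))\<^sup>2 * (norm y)\<^sup>2" for y
        using Cauchy_Schwarz_ineq[of "v x" y] by (simp add: power2_norm_eq_inner)
      from add_mono[OF this this] show ?thesis unfolding qv w_def by (simp add: distrib_left)
    qed
    have 2: "- (2 * g' (q x) * ((v x \<bullet> u1 x)\<^sup>2 + (v x \<bullet> u2 x)\<^sup>2)) \<le> 2 * \<bar>g' (q x)\<bar> * (q x * w x)"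
    proof -
      have "- (2 * g' (q x)) * ((v x \<bullet> u1 x)\<^sup>2 + (v x \<bullet> u2 x)\<^sup>2) \<le> (2 * \<bar>g' (q x)\<bar>) * ((v x \<bullet> u1 x)\<^sup>2 + (v x \<bullet> u2 x)\<^sup>2)"
        by (intro mult_right_mono) auto
      also have "\<dots> \<le> (2 * \<bar>g' (q x)\<bar>) * (q x * w x)" by (intro mult_left_mono cs) auto
      finally show ?thesis by simp
    qed
    have 3: "- (G * (b' s * b t * (v x \<bullet> u1 x) + b s * b' t * (v x \<bullet> u2 x))) \<le> L / c * e x"
    proof (cases "G = 0")
      case True
      then show ?thesis using L c e_nonneg[of x] by simp
    next
      case False
      then have n: "norm (u x - \<sigma>) \<le> d" using near by (simp add: v_def)
      have i: "\<bar>\<beta>' * \<beta> * (v x \<bullet> y)\<bar> \<le> L * (norm (v x) * norm y)" if "\<bar>\<beta>'\<bar> \<le> L" "0 \<le> \<beta>" "\<beta> \<le> 1" for \<beta>' \<beta> y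
      proof -
        have "\<bar>\<beta>'\<bar> * \<beta> \<le> L * 1" using that by (intro mult_mono) auto
        then have "(\<bar>\<beta>'\<bar> * \<beta>) * \<bar>v x \<bullet> y\<bar> \<le> L * (norm (v x) * norm y)"
          using Cauchy_Schwarz_ineq2[of "v x" y] that L by (intro mult_mono) auto
        then show ?thesis using that by (simp add: abs_mult)
      qed
      have y: "norm (v x) * norm y \<le> (norm (v x))\<^sup>2 / 2 + (norm y)\<^sup>2 / 2" for y :: 'a
        using sum_squares_bound[of "norm (v x)" "norm y"] by simp
      have "\<bar>b' s * b t * (v x \<bullet> u1 x) + b s * b' t * (v x \<bullet> u2 x)\<bar> \<le> L * (norm (v x) * norm (u1 x)) + L * (norm (v x) * norm (u2 x))"
        using i[OF bs(4) bt(2,3), of "u1 x"] i[OF bt(4) bs(2,3), of "u2 x"] by (simp add: mult.commute[of "b s"])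
      also have "\<dots> = L * (norm (v x) * norm (u1 x) + norm (v x) * norm (u2 x))" by (simp add: distrib_left)
      also have "\<dots> \<le> L * ((norm (v x))\<^sup>2 + w x / 2)"
        using add_mono[OF y[of "u1 x"] y[of "u2 x"]] unfolding w_def
        by (intro mult_left_mono[OF _ L]) (simp add: add_divide_distrib)
      also have "\<dots> \<le> L * (e x / c)"
      proof (rule mult_left_mono[OF _ L])
        have "c * ((norm (v x))\<^sup>2 + w x / 2) \<le> V (u x) + w x / 2"
          using well(2)[OF \<sigma> n] c w_nonneg[of x] mult_left_le_one_le[of "w x / 2" c] by (simp add: v_def distrib_left)
        then show "(norm (v x))\<^sup>2 + w x / 2 \<le> e x / c" using c by (simp add: e_def field_simps)
      qed
      finally have *: "\<bar>b' s * b t * (v x \<bullet> u1 x) + b s * b' t * (v x \<bullet> u2 x)\<bar> \<le> L / c * e x" by simp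
      have "- (G * z) \<le> \<bar>z\<bar>" for z
        using G mult_left_le_one_le[of "\<bar>z\<bar>" G] abs_ge_minus_self[of "G * z"] by (simp add: abs_mult)
      from order_trans[OF this *] show ?thesis .
    qed
    have "P * (c\<^sup>2 * G * e x - 2 * \<bar>g' (q x)\<bar> * (q x * w x))
       \<le> P * (G * w x + G * (v x \<bullet> dV (u x)) + 2 * g' (q x) * ((v x \<bullet> u1 x)\<^sup>2 + (v x \<bullet> u2 x)\<^sup>2))"
      by (intro mult_left_mono[OF _ P(1)]) (use 1 2 in linarith)
    with 3 show ?thesis
      unfolding A_def B_def I_def st(1) fst_conv snd_conv
      unfolding P_def[symmetric] st(1)[symmetric] G_def[symmetric]
      by (simp add: algebra_simps)
  qed
  have ce: "continuous_on (sq r) e" using cont_sub[OF sub] by simp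
  have "integral (sq r) (\<lambda>x. c\<^sup>2 * A x - B x - L / c * e x) \<le> integral (sq r) I"
    by (intro integral_sq_mono continuous_intros cA cB ce cI main)
  also have "integral (sq r) (\<lambda>x. c\<^sup>2 * A x - B x - L / c * e x) = c\<^sup>2 * integral (sq r) A - integral (sq r) B - L / c * E r"
  proof -
    have *: "(\<lambda>x. c\<^sup>2 * A x) integrable_on sq r" "B integrable_on sq r" "(\<lambda>x. L / c * e x) integrable_on sq r"
      by (intro integrable_sq continuous_intros cA cB ce)+
    then show ?thesis by (subst integral_diff integrable_diff | simp add: integrable_diff E_def)+
  qed
  finally show ?thesis using I0 unfolding A_def[abs_def] B_def[abs_def] by linarith
qed

text \<open>The stress tensor \<open>T\<close> is divergence free and, in two dimensions, has trace \<open>2 V(u)\<close>; it is paired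
  with the vector field \<open>x b(x\<^sub>1) b(x\<^sub>2)\<close>.\<close>

lemma pohozaev_inequality:
  assumes r: "0 \<le> r" "\<rho>2 \<le> r" and sub: "sq r \<subseteq> D" and b: "cutoff r \<rho>1 \<rho>2 L b b'"
  shows "integral (sq r) (\<lambda>x. 2 * (b (fst x) * b (snd x) * V (u x)))
     \<le> integral (sq r) (\<lambda>x. 2 * r * (\<bar>b' (fst x)\<bar> * b (snd x) + b (fst x) * \<bar>b' (snd x)\<bar>) * e x)"
proof -
  define T11 where "T11 x = ((norm (u2 x))\<^sup>2 - (norm (u1 x))\<^sup>2) / 2 + V (u x)" for x
  define T22 where "T22 x = ((norm (u1 x))\<^sup>2 - (norm (u2 x))\<^sup>2) / 2 + V (u x)" for x
  define T12 where "T12 x = - (u1 x \<bullet> u2 x)" for x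
  define T11' where "T11' x = u2 x \<bullet> u12 x - u1 x \<bullet> u11 x + dV (u x) \<bullet> u1 x" for x
  define T12_2 where "T12_2 x = - (u12 x \<bullet> u2 x + u1 x \<bullet> u22 x)" for x
  define T12_1 where "T12_1 x = - (u11 x \<bullet> u2 x + u1 x \<bullet> u12 x)" for x
  define T22' where "T22' x = u1 x \<bullet> u12 x - u2 x \<bullet> u22 x + dV (u x) \<bullet> u2 x" for x
  define F where "F x = b (fst x) * b (snd x) * (fst x * T11 x + snd x * T12 x)" for x
  define G where "G x = b (fst x) * b (snd x) * (fst x * T12 x + snd x * T22 x)" for x
  define F1 where "F1 x = b' (fst x) * b (snd x) * (fst x * T11 x + snd x * T12 x)
     + b (fst x) * b (snd x) * (T11 x + fst x * T11' x + snd x * T12_1 x)" for x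
  define G2 where "G2 x = b (fst x) * b' (snd x) * (fst x * T12 x + snd x * T22 x)
     + b (fst x) * b (snd x) * (fst x * T12_2 x + T22 x + snd x * T22' x)" for x
  note defs = F1_def[abs_def] G2_def[abs_def] T11_def T22_def T12_def T11'_def T12_1_def T12_2_def T22'_def
  have c: "continuous_on (sq r) F1" "continuous_on (sq r) G2"
    unfolding defs by (intro continuous_intros cont_sub[OF sub] cont_cutoff[OF b] | simp)+
  have b0: "b s = 0" if "\<bar>s\<bar> = r" for s using cutoffD(6)[OF b, of s] r that by linarith
  have I0: "integral (sq r) (\<lambda>x. F1 x + G2 x) = 0"
  proof (rule divergence_theorem_vanishing[OF r(1) c, of F G])
    fix s t assume st: "(s,t) \<in> sq r"
    then have D: "(s,t) \<in> D" and bs: "\<bar>s\<bar> \<le> r" "\<bar>t\<bar> \<le> r" using sub by (auto simp: mem_sq)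
    note dd = du[OF D, THEN has_vector_derivative_at_within]
    have t11: "((\<lambda>s. T11 (s,t)) has_real_derivative T11' (s,t)) (at s within {-r..r})"
      unfolding T11_def
      by (rule DERIV_cong[OF DERIV_add[OF DERIV_cdivide[OF DERIV_diff[OF has_real_derivative_norm_sq[OF dd(5)]
          has_real_derivative_norm_sq[OF dd(3)]]] has_real_derivative_V[OF dd(1)]]])
        (simp add: T11'_def)
    have t22: "((\<lambda>t. T22 (s,t)) has_real_derivative T22' (s,t)) (at t within {-r..r})"
      unfolding T22_def
      by (rule DERIV_cong[OF DERIV_add[OF DERIV_cdivide[OF DERIV_diff[OF has_real_derivative_norm_sq[OF dd(4)]
          has_real_derivative_norm_sq[OF dd(6)]]] has_real_derivative_V[OF dd(2)]]])
        (simp add: T22'_def)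
    have t12: "((\<lambda>s. T12 (s,t)) has_real_derivative T12_1 (s,t)) (at s within {-r..r})"
      unfolding T12_def T12_1_def by (rule DERIV_minus[OF has_real_derivative_inner[OF dd(3) dd(5)]])
    have t21: "((\<lambda>t. T12 (s,t)) has_real_derivative T12_2 (s,t)) (at t within {-r..r})"
      unfolding T12_def T12_2_def by (rule DERIV_minus[OF has_real_derivative_inner[OF dd(4) dd(6)]])
    show "((\<lambda>s. F (s,t)) has_real_derivative F1 (s,t)) (at s within {-r..r})"
      unfolding F_def fst_conv snd_conv
      by (rule DERIV_cong[OF DERIV_mult[OF DERIV_cmult_right[OF cutoffD(1)[OF b bs(1)]]
           DERIV_add[OF DERIV_mult[OF DERIV_ident t11] DERIV_cmult[OF t12]]]])
        (simp add: F1_def algebra_simps)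
    show "((\<lambda>t. G (s,t)) has_real_derivative G2 (s,t)) (at t within {-r..r})"
      unfolding G_def fst_conv snd_conv
      by (rule DERIV_cong[OF DERIV_mult[OF DERIV_cmult[OF cutoffD(1)[OF b bs(2)]]
           DERIV_add[OF DERIV_cmult[OF t21] DERIV_mult[OF DERIV_ident t22]]]])
        (simp add: G2_def algebra_simps)
  next
    fix s t :: real assume "\<bar>s\<bar> = r"
    then show "F (s,t) = 0" unfolding F_def by (simp only: b0 fst_conv mult_zero_left)
  next
    fix s t :: real assume "\<bar>t\<bar> = r"
    then show "G (s,t) = 0" unfolding G_def by (simp only: b0 snd_conv mult_zero_left mult_zero_right)
  qed
  define A where "A x = 2 * (b (fst x) * b (snd x) * V (u x))" for x
  define B where "B x = 2 * r * (\<bar>b' (fst x)\<bar> * b (snd x) + b (fst x) * \<bar>b' (snd x)\<bar>) * e x" for x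
  have cAB: "continuous_on (sq r) A" "continuous_on (sq r) B"
    unfolding A_def[abs_def] B_def[abs_def] by (intro continuous_intros cont_sub[OF sub] cont_cutoff[OF b])+
  have "A x - B x \<le> F1 x + G2 x" if x: "x \<in> sq r" for x
  proof -
    obtain s t where st: "x = (s,t)" "\<bar>s\<bar> \<le> r" "\<bar>t\<bar> \<le> r" using x by (cases x) (auto simp: mem_sq)
    note bs = cutoffD[OF b st(2)] and bt = cutoffD[OF b st(3)]
    have "x \<in> D" using x sub by blast
    then have dV: "dV (u x) = u11 x + u22 x" by (rule eqn[symmetric])
    \<comment> \<open>The equation enters here: the two sums are dV - u11 - u22 paired with
      \<open>u1\<close> and with \<open>u2\<close>.\<close>
    have div: "T11' x + T12_2 x = 0" "T12_1 x + T22' x = 0"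
      unfolding T11'_def T12_2_def T12_1_def T22'_def dV
      by (auto simp: inner_add_left inner_add_right inner_commute)
    have tr: "T11 x + T22 x = 2 * V (u x)" by (simp add: T11_def T22_def field_simps)
    have T: "\<bar>T11 x\<bar> \<le> e x" "\<bar>T22 x\<bar> \<le> e x" "\<bar>T12 x\<bar> \<le> e x"
    proof -
      have "(norm (u1 x))\<^sup>2 \<ge> 0" "(norm (u2 x))\<^sup>2 \<ge> 0" "V (u x) \<ge> 0" using V_nonneg by auto
      then show "\<bar>T11 x\<bar> \<le> e x" "\<bar>T22 x\<bar> \<le> e x"
        unfolding T11_def T22_def e_def w_def abs_le_iff by (auto simp: field_simps)
      have "\<bar>u1 x \<bullet> u2 x\<bar> \<le> norm (u1 x) * norm (u2 x)" by (rule Cauchy_Schwarz_ineq2)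
      also have "\<dots> \<le> w x / 2" using sum_squares_bound[of "norm (u1 x)" "norm (u2 x)"] by (simp add: w_def)
      finally show "\<bar>T12 x\<bar> \<le> e x" using V_nonneg[of "u x"] by (simp add: T12_def e_def)
    qed
    \<comment> \<open>Both components of the position vector are at most \<open>r\<close>. The
      resulting factor of the size of the square is later compensated by a cutoff slope of order
      1/m, with r = 4 m.\<close>
    have st_bd: "\<bar>s * X + t * Y\<bar> \<le> 2 * r * e x" if "\<bar>X\<bar> \<le> e x" "\<bar>Y\<bar> \<le> e x" for X Y
    proof -
      have "\<bar>s * X\<bar> \<le> r * e x" "\<bar>t * Y\<bar> \<le> r * e x"
        unfolding abs_mult using st that r by (auto intro!: mult_mono)
      then show ?thesis by linarith
    qed
    have bd: "- (\<beta>' * \<beta> * Y) \<le> \<bar>\<beta>'\<bar> * \<beta> * (2 * r * e x)" if "0 \<le> \<beta>" "\<bar>Y\<bar> \<le> 2 * r * e x" for \<beta> \<beta>' Y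
    proof -
      have "- (\<beta>' * \<beta> * Y) \<le> \<bar>\<beta>' * \<beta> * Y\<bar>" by simp
      also have "\<dots> = \<bar>\<beta>'\<bar> * \<beta> * \<bar>Y\<bar>" using that by (simp add: abs_mult)
      also have "\<dots> \<le> \<bar>\<beta>'\<bar> * \<beta> * (2 * r * e x)" using that by (intro mult_left_mono) auto
      finally show ?thesis .
    qed
    have "F1 x + G2 x = b' s * b t * (s * T11 x + t * T12 x) + b' t * b s * (s * T12 x + t * T22 x)
       + b s * b t * (T11 x + T22 x + s * (T11' x + T12_2 x) + t * (T12_1 x + T22' x))"
      by (simp add: F1_def G2_def st(1) algebra_simps)
    also have "\<dots> = b' s * b t * (s * T11 x + t * T12 x) + b' t * b s * (s * T12 x + t * T22 x) + A x"
      unfolding div tr by (simp add: A_def st(1))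
    finally have "A x - (F1 x + G2 x) = - (b' s * b t * (s * T11 x + t * T12 x)) + - (b' t * b s * (s * T12 x + t * T22 x))"
      by simp
    also have "\<dots> \<le> \<bar>b' s\<bar> * b t * (2 * r * e x) + \<bar>b' t\<bar> * b s * (2 * r * e x)"
      by (intro add_mono bd st_bd T bs bt)
    also have "\<dots> = B x" by (simp add: B_def st(1) algebra_simps)
    finally show ?thesis by linarith
  qed
  then have "integral (sq r) (\<lambda>x. A x - B x) \<le> integral (sq r) (\<lambda>x. F1 x + G2 x)"
    by (intro integral_sq_mono continuous_intros c cAB)
  also have "integral (sq r) (\<lambda>x. A x - B x) = integral (sq r) A - integral (sq r) B"
    by (intro integral_diff integrable_sq cAB)
  finally show ?thesis using I0 unfolding A_def[abs_def] B_def[abs_def] by linarith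
qed

end

subsection \<open>Pointwise bounds\<close>

text \<open>The left side is the second derivative of p^2 W + k Q at \<open>s\<close>. First
  derivatives are taken near the point and second ones at the point alone, matching
  \<open>ddu\<close>, which provides third derivatives of the solution without continuity.\<close>

lemma second_deriv_test_weighted_sum:
  fixes p W Q :: "real \<Rightarrow> real"
  assumes p: "\<And>x. \<bar>x - s\<bar> < \<epsilon> \<Longrightarrow> (p has_real_derivative p' x) (at x)" "(p' has_real_derivative p'') (at s)"
    and W: "\<And>x. \<bar>x - s\<bar> < \<epsilon> \<Longrightarrow> (W has_real_derivative W' x) (at x)" "(W' has_real_derivative W'') (at s)"
    and Q: "\<And>x. \<bar>x - s\<bar> < \<epsilon> \<Longrightarrow> (Q has_real_derivative Q' x) (at x)" "(Q' has_real_derivative Q'') (at s)"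
    and \<epsilon>: "\<epsilon> > 0" and max: "\<And>x. \<bar>x - s\<bar> < \<epsilon> \<Longrightarrow> (p x)\<^sup>2 * W x + k * Q x \<le> (p s)\<^sup>2 * W s + k * Q s"
  shows "2 * (p' s)\<^sup>2 * W s + 2 * p s * p'' * W s + 4 * p s * p' s * W' s + (p s)\<^sup>2 * W'' + k * Q'' \<le> 0"
proof (rule second_deriv_nonpos_at_max(2)[OF \<epsilon>, of s "\<lambda>x. (p x)\<^sup>2 * W x + k * Q x"
    "\<lambda>x. 2 * p x * p' x * W x + (p x)\<^sup>2 * W' x + k * Q' x"])
  fix x assume x: "\<bar>x - s\<bar> < \<epsilon>"
  show "((\<lambda>x. (p x)\<^sup>2 * W x + k * Q x) has_real_derivative (2 * p x * p' x * W x + (p x)\<^sup>2 * W' x + k * Q' x)) (at x)"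
    using p(1)[OF x] W(1)[OF x] Q(1)[OF x]
    by (auto intro!: derivative_eq_intros simp: algebra_simps power2_eq_square)
next
  show "((\<lambda>x. 2 * p x * p' x * W x + (p x)\<^sup>2 * W' x + k * Q' x) has_real_derivative
     2 * (p' s)\<^sup>2 * W s + 2 * p s * p'' * W s + 4 * p s * p' s * W' s + (p s)\<^sup>2 * W'' + k * Q'') (at s)"
    using p(1)[of s] p(2) W(1)[of s] W(2) Q(1)[of s] Q(2) \<epsilon>
    by (auto intro!: derivative_eq_intros simp: algebra_simps power2_eq_square)
qed (rule max)

lemma (in potential) N_H_nonneg: "0 \<le> N" "0 \<le> H"
proof -
  show "0 \<le> N" using N[of 0] M(3) order_trans[OF norm_ge_zero] by auto
  obtain i :: 'b where "i \<in> Basis" using nonempty_Basis by blast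
  then show "0 \<le> H" using H[of 0 i] M(3) order_trans[OF norm_ge_zero, of "HV 0 i" H] by simp
qed

text \<open>The maximum of Bernstein's function is at most \<Lambda> (\<beta>^4 M N + M^2), with
  \<Lambda> the first factor, and its value at the centre is at least \<beta>^4 |\<nabla>u|^2.
  Dividing gives this bound for the squared gradient.\<close>

definition (in potential) G :: "real \<Rightarrow> real" where
  "G \<beta> = (H * \<beta>^4 + 36 * \<beta>\<^sup>2 + 1) * (M * N + M\<^sup>2 / \<beta>^4)"

context planar
begin

text \<open>At an interior maximum of |u|^2 its Laplacian, 2 |\<nabla>u|^2 + 2 u \<bullet> dV(u), is
  at most 0. Hence u \<bullet> dV(u) \<le> 0, which coercivity \<open>M(1)\<close> permits only in
  the ball of radius \<open>M\<close>.\<close>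

lemma maximum_principle:
  assumes sub: "sq r \<subseteq> D"
    and bd: "\<And>s t. (s,t) \<in> sq r \<Longrightarrow> \<bar>s\<bar> = r \<or> \<bar>t\<bar> = r \<Longrightarrow> norm (u (s,t)) \<le> M"
    and x: "x \<in> sq r"
  shows "norm (u x) \<le> M"
proof -
  have "compact (sq r)" "sq r \<noteq> {}" using x by (auto simp: sq_def)
  moreover have "continuous_on (sq r) (\<lambda>x. norm (u x))" by (intro continuous_intros cont_sub[OF sub])
  ultimately obtain z where z: "z \<in> sq r" "\<And>y. y \<in> sq r \<Longrightarrow> norm (u y) \<le> norm (u z)"
    using continuous_attains_sup by metis
  obtain s0 t0 where zst: "z = (s0,t0)" by (cases z)
  have "norm (u z) \<le> M"
  proof (cases "\<bar>s0\<bar> = r \<or> \<bar>t0\<bar> = r")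
    case True
    then show ?thesis using bd[of s0 t0] z(1) zst by simp
  next
    case False
    define \<epsilon> where "\<epsilon> = min (r - \<bar>s0\<bar>) (r - \<bar>t0\<bar>)"
    have st0: "\<bar>s0\<bar> \<le> r" "\<bar>t0\<bar> \<le> r" using z(1) by (auto simp: zst mem_sq)
    have \<epsilon>: "\<epsilon> > 0" using False st0 by (auto simp: \<epsilon>_def)
    have m1: "(s,t0) \<in> sq r" if "\<bar>s - s0\<bar> < \<epsilon>" for s using that st0 unfolding mem_sq \<epsilon>_def by linarith
    have m2: "(s0,t) \<in> sq r" if "\<bar>t - t0\<bar> < \<epsilon>" for t using that st0 unfolding mem_sq \<epsilon>_def by linarith
    have zD: "(s0,t0) \<in> D" using z(1) sub zst by blast
    have "2 * (norm (u1 z))\<^sup>2 + 2 * (u z \<bullet> u11 z) \<le> 0"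
    proof (rule second_deriv_nonpos_at_max(2)[OF \<epsilon>, of s0 "\<lambda>s. (norm (u (s,t0)))\<^sup>2" "\<lambda>s. 2 * (u (s,t0) \<bullet> u1 (s,t0))"])
      fix s assume "\<bar>s - s0\<bar> < \<epsilon>"
      then show "((\<lambda>s. (norm (u (s,t0)))\<^sup>2) has_real_derivative 2 * (u (s,t0) \<bullet> u1 (s,t0))) (at s)"
        using m1 sub by (intro has_real_derivative_norm_sq du) blast
    next
      show "((\<lambda>s. 2 * (u (s,t0) \<bullet> u1 (s,t0))) has_real_derivative 2 * (norm (u1 z))\<^sup>2 + 2 * (u z \<bullet> u11 z)) (at s0)"
        by (rule DERIV_cong[OF DERIV_cmult[OF has_real_derivative_inner[OF du(1)[OF zD] du(3)[OF zD]]]])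
          (simp add: zst power2_norm_eq_inner)
    qed (use z(2) m1 in \<open>auto simp: zst\<close>)
    moreover have "2 * (norm (u2 z))\<^sup>2 + 2 * (u z \<bullet> u22 z) \<le> 0"
    proof (rule second_deriv_nonpos_at_max(2)[OF \<epsilon>, of t0 "\<lambda>t. (norm (u (s0,t)))\<^sup>2" "\<lambda>t. 2 * (u (s0,t) \<bullet> u2 (s0,t))"])
      fix t assume "\<bar>t - t0\<bar> < \<epsilon>"
      then show "((\<lambda>t. (norm (u (s0,t)))\<^sup>2) has_real_derivative 2 * (u (s0,t) \<bullet> u2 (s0,t))) (at t)"
        using m2 sub by (intro has_real_derivative_norm_sq du) blast
    next
      show "((\<lambda>t. 2 * (u (s0,t) \<bullet> u2 (s0,t))) has_real_derivative 2 * (norm (u2 z))\<^sup>2 + 2 * (u z \<bullet> u22 z)) (at t0)"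
        by (rule DERIV_cong[OF DERIV_cmult[OF has_real_derivative_inner[OF du(2)[OF zD] du(6)[OF zD]]]])
          (simp add: zst power2_norm_eq_inner)
    qed (use z(2) m2 in \<open>auto simp: zst\<close>)
    ultimately have "u z \<bullet> (u11 z + u22 z) \<le> 0"
      unfolding inner_add_right using zero_le_power2[of "norm (u1 z)"] zero_le_power2[of "norm (u2 z)"] by linarith
    then have "u z \<bullet> dV (u z) \<le> 0" using eqn[OF zD] zst by simp
    then show ?thesis using M(1)[of "u z"] by (meson leD leI)
  qed
  then show ?thesis using z(2)[OF x] by linarith
qed

text \<open>The hypotheses are the second derivative tests in the two coordinate directions at an interior maximum
  of \<open>\<phi>\<^sup>2 |\<nabla>u|\<^sup>2 + \<Lambda> |u|\<^sup>2\<close> with \<open>\<phi>(y) = \<beta>\<^sup>2 - |y - z|\<^sup>2\<close>.\<close>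

lemma bernstein_pointwise:
  fixes \<phi> \<phi>1 \<phi>2 \<beta> \<Lambda> :: real
  assumes x: "x \<in> D" and u: "norm (u x) \<le> M"
    and \<phi>: "0 \<le> \<phi>" "\<phi> \<le> \<beta>\<^sup>2" "\<phi>1\<^sup>2 + \<phi>2\<^sup>2 \<le> 4 * \<beta>\<^sup>2"
    and 1: "2 * \<phi>1\<^sup>2 * w x + 2 * \<phi> * (-2) * w x + 4 * \<phi> * \<phi>1 * (2 * (u1 x \<bullet> u11 x) + 2 * (u2 x \<bullet> u12 x))
       + \<phi>\<^sup>2 * (2 * (u11 x \<bullet> u11 x + u1 x \<bullet> u111 x) + 2 * (u12 x \<bullet> u12 x + u2 x \<bullet> u112 x))
       + \<Lambda> * (2 * (u1 x \<bullet> u1 x + u x \<bullet> u11 x)) \<le> 0"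
    and 2: "2 * \<phi>2\<^sup>2 * w x + 2 * \<phi> * (-2) * w x + 4 * \<phi> * \<phi>2 * (2 * (u1 x \<bullet> u12 x) + 2 * (u2 x \<bullet> u22 x))
       + \<phi>\<^sup>2 * (2 * (u12 x \<bullet> u12 x + u1 x \<bullet> u122 x) + 2 * (u22 x \<bullet> u22 x + u2 x \<bullet> u222 x))
       + \<Lambda> * (2 * (u2 x \<bullet> u2 x + u x \<bullet> u22 x)) \<le> 0"
    and \<Lambda>: "\<Lambda> = H * \<beta>^4 + 36 * \<beta>\<^sup>2 + 1"
  shows "w x \<le> \<Lambda> * (M * N)"
proof -
  have w: "w x = u1 x \<bullet> u1 x + u2 x \<bullet> u2 x" by (simp add: w_def power2_norm_eq_inner)
  note H0 = N_H_nonneg(2)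
  have \<Lambda>0: "0 \<le> \<Lambda>" unfolding \<Lambda> using H0 by simp
  \<comment> \<open>The weights spend half of the available second derivative terms and leave a
    multiple of |\<nabla>u|^2, to be paid for by \<Lambda>.\<close>
  have young: "- (8 * \<phi> * \<psi> * (y \<bullet> z)) \<le> \<phi>\<^sup>2 * (z \<bullet> z) + 16 * \<psi>\<^sup>2 * (y \<bullet> y)" for y z :: 'a and \<psi>
  proof -
    have "0 \<le> (\<phi> *\<^sub>R z + (4 * \<psi>) *\<^sub>R y) \<bullet> (\<phi> *\<^sub>R z + (4 * \<psi>) *\<^sub>R y)" by simp
    also have "\<dots> = \<phi>\<^sup>2 * (z \<bullet> z) + 16 * \<psi>\<^sup>2 * (y \<bullet> y) + 8 * \<phi> * \<psi> * (y \<bullet> z)"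
      by (simp add: inner_add_left inner_add_right inner_commute power2_eq_square algebra_simps)
    finally show ?thesis by linarith
  qed
  have hess: "- (H * (y \<bullet> y)) \<le> y \<bullet> HV (u x) y" for y
  proof -
    have "\<bar>y \<bullet> HV (u x) y\<bar> \<le> norm y * norm (HV (u x) y)" by (rule Cauchy_Schwarz_ineq2)
    also have "\<dots> \<le> norm y * (H * norm y)" by (intro mult_left_mono H u) auto
    also have "\<dots> = H * (y \<bullet> y)" by (simp add: power2_norm_eq_inner[symmetric] power2_eq_square)
    finally show ?thesis by linarith
  qed
  have h: "- (H * w x) \<le> u1 x \<bullet> u111 x + u1 x \<bullet> u122 x + (u2 x \<bullet> u112 x + u2 x \<bullet> u222 x)"
    using hess[of "u1 x"] hess[of "u2 x"] unfolding inner_add_right[symmetric] deqn[OF x] w by (simp add: distrib_left)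
  have "\<bar>u x \<bullet> dV (u x)\<bar> \<le> norm (u x) * norm (dV (u x))" by (rule Cauchy_Schwarz_ineq2)
  also have "\<dots> \<le> M * N" using u N[OF u] M(3) by (intro mult_mono) auto
  finally have uV: "- (M * N) \<le> u x \<bullet> u11 x + u x \<bullet> u22 x" unfolding inner_add_right[symmetric] eqn[OF x] by linarith
  have sqn: "0 \<le> \<phi>\<^sup>2 * (y \<bullet> y)" for y :: 'a by simp
  have a1: "\<phi>\<^sup>2 * (- (H * w x)) \<le> \<phi>\<^sup>2 * (u1 x \<bullet> u111 x + u1 x \<bullet> u122 x + (u2 x \<bullet> u112 x + u2 x \<bullet> u222 x))"
    by (intro mult_left_mono h) simp
  have a2: "\<Lambda> * (- (M * N)) \<le> \<Lambda> * (u x \<bullet> u11 x + u x \<bullet> u22 x)" by (intro mult_left_mono uV \<Lambda>0)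
  have a3: "\<phi> * w x \<le> \<beta>\<^sup>2 * w x" using \<phi> w_nonneg by (intro mult_right_mono) auto
  have "\<phi>\<^sup>2 \<le> (\<beta>\<^sup>2)\<^sup>2" using \<phi> by (intro power_mono) auto
  then have "\<phi>\<^sup>2 * (H * w x) \<le> \<beta>^4 * (H * w x)" using H0 w_nonneg by (intro mult_right_mono) auto
  then have a4: "\<phi>\<^sup>2 * (H * w x) \<le> (H * \<beta>^4) * w x" by (simp add: algebra_simps)
  have "(\<phi>1\<^sup>2 + \<phi>2\<^sup>2) * w x \<le> (4 * \<beta>\<^sup>2) * w x" using \<phi> w_nonneg by (intro mult_right_mono) auto
  then have a5: "\<phi>1\<^sup>2 * w x + \<phi>2\<^sup>2 * w x \<le> 4 * (\<beta>\<^sup>2 * w x)" by (simp add: distrib_right)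
  have a6: "\<phi>1\<^sup>2 * w x = \<phi>1\<^sup>2 * (u1 x \<bullet> u1 x) + \<phi>1\<^sup>2 * (u2 x \<bullet> u2 x)" "\<phi>2\<^sup>2 * w x = \<phi>2\<^sup>2 * (u1 x \<bullet> u1 x) + \<phi>2\<^sup>2 * (u2 x \<bullet> u2 x)"
    by (simp_all add: w distrib_left)
  have a7: "0 \<le> \<phi>1\<^sup>2 * w x" "0 \<le> \<phi>2\<^sup>2 * w x" using w_nonneg by auto
  have a8: "\<Lambda> * w x = \<Lambda> * (u1 x \<bullet> u1 x) + \<Lambda> * (u2 x \<bullet> u2 x)" by (simp add: w distrib_left)
  have a9: "\<Lambda> * w x = (H * \<beta>^4) * w x + 36 * (\<beta>\<^sup>2 * w x) + w x" unfolding \<Lambda> by (simp add: algebra_simps)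
  have y1: "- (8 * \<phi> * \<phi>1 * (u1 x \<bullet> u11 x)) \<le> \<phi>\<^sup>2 * (u11 x \<bullet> u11 x) + 16 * (\<phi>1\<^sup>2 * (u1 x \<bullet> u1 x))"
    and y2: "- (8 * \<phi> * \<phi>1 * (u2 x \<bullet> u12 x)) \<le> \<phi>\<^sup>2 * (u12 x \<bullet> u12 x) + 16 * (\<phi>1\<^sup>2 * (u2 x \<bullet> u2 x))"
    and y3: "- (8 * \<phi> * \<phi>2 * (u1 x \<bullet> u12 x)) \<le> \<phi>\<^sup>2 * (u12 x \<bullet> u12 x) + 16 * (\<phi>2\<^sup>2 * (u1 x \<bullet> u1 x))"
    and y4: "- (8 * \<phi> * \<phi>2 * (u2 x \<bullet> u22 x)) \<le> \<phi>\<^sup>2 * (u22 x \<bullet> u22 x) + 16 * (\<phi>2\<^sup>2 * (u2 x \<bullet> u2 x))"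
    using young by (simp_all add: mult.assoc)
  have e1': "2 * (\<phi>1\<^sup>2 * w x) - 4 * (\<phi> * w x) + 8 * \<phi> * \<phi>1 * (u1 x \<bullet> u11 x) + 8 * \<phi> * \<phi>1 * (u2 x \<bullet> u12 x)
      + 2 * (\<phi>\<^sup>2 * (u11 x \<bullet> u11 x)) + 2 * (\<phi>\<^sup>2 * (u1 x \<bullet> u111 x)) + 2 * (\<phi>\<^sup>2 * (u12 x \<bullet> u12 x)) + 2 * (\<phi>\<^sup>2 * (u2 x \<bullet> u112 x))
      + 2 * (\<Lambda> * (u1 x \<bullet> u1 x)) + 2 * (\<Lambda> * (u x \<bullet> u11 x)) \<le> 0"
    using 1 by (simp add: algebra_simps)
  have e2': "2 * (\<phi>2\<^sup>2 * w x) - 4 * (\<phi> * w x) + 8 * \<phi> * \<phi>2 * (u1 x \<bullet> u12 x) + 8 * \<phi> * \<phi>2 * (u2 x \<bullet> u22 x)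
      + 2 * (\<phi>\<^sup>2 * (u12 x \<bullet> u12 x)) + 2 * (\<phi>\<^sup>2 * (u1 x \<bullet> u122 x)) + 2 * (\<phi>\<^sup>2 * (u22 x \<bullet> u22 x)) + 2 * (\<phi>\<^sup>2 * (u2 x \<bullet> u222 x))
      + 2 * (\<Lambda> * (u2 x \<bullet> u2 x)) + 2 * (\<Lambda> * (u x \<bullet> u22 x)) \<le> 0"
    using 2 by (simp add: algebra_simps)
  have a1': "- (\<phi>\<^sup>2 * (H * w x)) \<le> \<phi>\<^sup>2 * (u1 x \<bullet> u111 x) + \<phi>\<^sup>2 * (u1 x \<bullet> u122 x) + \<phi>\<^sup>2 * (u2 x \<bullet> u112 x) + \<phi>\<^sup>2 * (u2 x \<bullet> u222 x)"
    using a1 by (simp add: distrib_left)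
  have a2': "- (\<Lambda> * (M * N)) \<le> \<Lambda> * (u x \<bullet> u11 x) + \<Lambda> * (u x \<bullet> u22 x)"
    using a2 by (simp add: distrib_left)
  \<comment> \<open>Here 72 = 64 + 8: Young's inequality costs 16 (\<phi>1^2 + \<phi>2^2) \<le> 64
    \<beta>^2, and each of the two tests contains - 4 \<phi> w. In \<Lambda> the summand
    \<open>36 * \<beta>\<^sup>2\<close> cancels this, \<open>H * \<beta>^4\<close> cancels the term
    from the derivative of dV, and the 1 leaves \<open>w x\<close>.\<close>
  have "2 * (\<Lambda> * w x) - 2 * (\<Lambda> * (M * N)) \<le> 2 * (H * \<beta>^4 * w x) + 72 * (\<beta>\<^sup>2 * w x)"
    using e1' e2' a1' a2' a3 a4 a5 a6 a7 a8 y1 y2 y3 y4 sqn[of "u11 x"] sqn[of "u12 x"] sqn[of "u22 x"]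
    by linarith
  then show ?thesis using a9 by linarith
qed

lemma gradient_bound:
  assumes \<beta>: "0 < \<beta>" and sub: "cball z \<beta> \<subseteq> D" and bd: "\<And>y. y \<in> cball z \<beta> \<Longrightarrow> norm (u y) \<le> M"
  shows "w z \<le> G \<beta>"
proof -
  obtain s0 t0 where z: "z = (s0,t0)" by (cases z)
  define \<Lambda> where "\<Lambda> = H * \<beta>^4 + 36 * \<beta>\<^sup>2 + 1"
  define \<phi> where "\<phi> x = \<beta>\<^sup>2 - (fst x - s0)\<^sup>2 - (snd x - t0)\<^sup>2" for x :: "real \<times> real"
  define P where "P x = (\<phi> x)\<^sup>2 * w x + \<Lambda> * (norm (u x))\<^sup>2" for x
  have \<Lambda>: "0 \<le> \<Lambda>" using N_H_nonneg by (simp add: \<Lambda>_def)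
  have d2: "(dist z (s,t))\<^sup>2 = (s - s0)\<^sup>2 + (t - t0)\<^sup>2" for s t
    by (simp add: z dist_Pair_Pair dist_real_def power2_commute)
  have mem: "(s,t) \<in> cball z \<beta> \<longleftrightarrow> (s - s0)\<^sup>2 + (t - t0)\<^sup>2 \<le> \<beta>\<^sup>2" for s t
    unfolding d2[symmetric] using \<beta> by (simp add: power2_le_iff_abs_le)
  have cP: "continuous_on (cball z \<beta>) P"
    unfolding P_def[abs_def] \<phi>_def[abs_def] by (intro continuous_intros cont_sub[OF sub])
  have "cball z \<beta> \<noteq> {}" using \<beta> by simp
  then obtain y where y: "y \<in> cball z \<beta>" "\<And>x. x \<in> cball z \<beta> \<Longrightarrow> P x \<le> P y"
    using continuous_attains_sup[OF compact_cball _ cP] by blast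
  obtain s1 t1 where yst: "y = (s1,t1)" by (cases y)
  have yM: "(norm (u y))\<^sup>2 \<le> M\<^sup>2" using bd[OF y(1)] M(3) by (intro power_mono) auto
  have \<phi>y: "0 \<le> \<phi> y" "\<phi> y \<le> \<beta>\<^sup>2"
    using y(1) unfolding yst mem \<phi>_def fst_conv snd_conv
    using zero_le_power2[of "s1 - s0"] zero_le_power2[of "t1 - t0"] by linarith+
  \<comment> \<open>If the weight vanishes at the maximum point, only \<Lambda> |u|^2 is left;
    otherwise the point is interior and the second derivative tests apply.\<close>
  have "P y \<le> \<beta>^4 * (\<Lambda> * (M * N)) + \<Lambda> * M\<^sup>2"
  proof (cases "\<phi> y = 0")
    case True
    have "\<Lambda> * (norm (u y))\<^sup>2 \<le> \<Lambda> * M\<^sup>2" using yM \<Lambda> by (rule mult_left_mono)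
    moreover have "0 \<le> \<beta>^4 * (\<Lambda> * (M * N))" using \<Lambda> M(3) N_H_nonneg \<beta> by simp
    ultimately show ?thesis using True by (simp add: P_def)
  next
    case False
    then have "(s1 - s0)\<^sup>2 + (t1 - t0)\<^sup>2 < \<beta>\<^sup>2" using \<phi>y(1) by (simp add: \<phi>_def yst)
    then have "dist z y < \<beta>" unfolding d2[symmetric] yst using \<beta> by (simp add: power_less_imp_less_base)
    then have "y \<in> ball z \<beta>" by simp
    then obtain \<epsilon> where \<epsilon>: "\<epsilon> > 0" "ball y \<epsilon> \<subseteq> ball z \<beta>" using open_contains_ball open_ball by metis
    have m1: "(s,t1) \<in> cball z \<beta>" if "\<bar>s - s1\<bar> < \<epsilon>" for s
    proof -
      have "(s,t1) \<in> ball y \<epsilon>" using that by (simp add: yst dist_Pair_Pair dist_real_def abs_minus_commute)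
      then show ?thesis using \<epsilon>(2) ball_subset_cball by blast
    qed
    have m2: "(s1,t) \<in> cball z \<beta>" if "\<bar>t - t1\<bar> < \<epsilon>" for t
    proof -
      have "(s1,t) \<in> ball y \<epsilon>" using that by (simp add: yst dist_Pair_Pair dist_real_def abs_minus_commute)
      then show ?thesis using \<epsilon>(2) ball_subset_cball by blast
    qed
    have n1: "(s,t1) \<in> D" if "\<bar>s - s1\<bar> < \<epsilon>" for s using m1[OF that] sub by blast
    have n2: "(s1,t) \<in> D" if "\<bar>t - t1\<bar> < \<epsilon>" for t using m2[OF that] sub by blast
    have yD: "(s1,t1) \<in> D" using n1[of s1] \<epsilon> by simp
    have wy: "w y \<le> \<Lambda> * (M * N)"
    proof (rule bernstein_pointwise[OF _ bd[OF y(1)] \<phi>y, of "- 2 * (s1 - s0)" "- 2 * (t1 - t0)"])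
      show "y \<in> D" using yD yst by simp
      show "\<Lambda> = H * \<beta>^4 + 36 * \<beta>\<^sup>2 + 1" by (rule \<Lambda>_def)
      show "(- 2 * (s1 - s0))\<^sup>2 + (- 2 * (t1 - t0))\<^sup>2 \<le> 4 * \<beta>\<^sup>2"
        using \<phi>y(1) by (simp add: \<phi>_def yst power2_eq_square algebra_simps)
      let ?W1 = "\<lambda>s. 2 * (u1 (s,t1) \<bullet> u11 (s,t1)) + 2 * (u2 (s,t1) \<bullet> u12 (s,t1))"
      let ?W2 = "\<lambda>t. 2 * (u1 (s1,t) \<bullet> u12 (s1,t)) + 2 * (u2 (s1,t) \<bullet> u22 (s1,t))"
      show "2 * (- 2 * (s1 - s0))\<^sup>2 * w y + 2 * \<phi> y * (-2) * w y + 4 * \<phi> y * (- 2 * (s1 - s0)) * (2 * (u1 y \<bullet> u11 y) + 2 * (u2 y \<bullet> u12 y))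
       + (\<phi> y)\<^sup>2 * (2 * (u11 y \<bullet> u11 y + u1 y \<bullet> u111 y) + 2 * (u12 y \<bullet> u12 y + u2 y \<bullet> u112 y))
       + \<Lambda> * (2 * (u1 y \<bullet> u1 y + u y \<bullet> u11 y)) \<le> 0"
        unfolding yst
      proof (rule second_deriv_test_weighted_sum[of s1 \<epsilon> "\<lambda>s. \<phi> (s,t1)" "\<lambda>s. - 2 * (s - s0)" "-2"
            "\<lambda>s. w (s,t1)" ?W1 _ "\<lambda>s. (norm (u (s,t1)))\<^sup>2" "\<lambda>s. 2 * (u (s,t1) \<bullet> u1 (s,t1))"])
        fix x assume x: "\<bar>x - s1\<bar> < \<epsilon>"
        show "((\<lambda>s. \<phi> (s,t1)) has_real_derivative - 2 * (x - s0)) (at x)"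
          unfolding \<phi>_def by (auto intro!: derivative_eq_intros)
        show "((\<lambda>s. w (s,t1)) has_real_derivative ?W1 x) (at x)"
          unfolding w_def using n1[OF x] by (intro DERIV_add has_real_derivative_norm_sq du)
        show "((\<lambda>s. (norm (u (s,t1)))\<^sup>2) has_real_derivative 2 * (u (x,t1) \<bullet> u1 (x,t1))) (at x)"
          using n1[OF x] by (intro has_real_derivative_norm_sq du)
        show "(\<phi> (x,t1))\<^sup>2 * w (x,t1) + \<Lambda> * (norm (u (x,t1)))\<^sup>2 \<le> (\<phi> (s1,t1))\<^sup>2 * w (s1,t1) + \<Lambda> * (norm (u (s1,t1)))\<^sup>2"
          using y(2)[OF m1[OF x]] by (simp add: P_def yst)
      next
        show "((\<lambda>s. - 2 * (s - s0)) has_real_derivative - 2) (at s1)" by (auto intro!: derivative_eq_intros)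
        show "(?W1 has_real_derivative 2 * (u11 (s1,t1) \<bullet> u11 (s1,t1) + u1 (s1,t1) \<bullet> u111 (s1,t1))
             + 2 * (u12 (s1,t1) \<bullet> u12 (s1,t1) + u2 (s1,t1) \<bullet> u112 (s1,t1))) (at s1)"
          by (intro DERIV_add DERIV_cmult has_real_derivative_inner du ddu yD)
        show "((\<lambda>s. 2 * (u (s,t1) \<bullet> u1 (s,t1))) has_real_derivative
           2 * (u1 (s1,t1) \<bullet> u1 (s1,t1) + u (s1,t1) \<bullet> u11 (s1,t1))) (at s1)"
          by (intro DERIV_cmult has_real_derivative_inner du yD)
      qed (rule \<epsilon>)
      show "2 * (- 2 * (t1 - t0))\<^sup>2 * w y + 2 * \<phi> y * (-2) * w y + 4 * \<phi> y * (- 2 * (t1 - t0)) * (2 * (u1 y \<bullet> u12 y) + 2 * (u2 y \<bullet> u22 y))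
       + (\<phi> y)\<^sup>2 * (2 * (u12 y \<bullet> u12 y + u1 y \<bullet> u122 y) + 2 * (u22 y \<bullet> u22 y + u2 y \<bullet> u222 y))
       + \<Lambda> * (2 * (u2 y \<bullet> u2 y + u y \<bullet> u22 y)) \<le> 0"
        unfolding yst
      proof (rule second_deriv_test_weighted_sum[of t1 \<epsilon> "\<lambda>t. \<phi> (s1,t)" "\<lambda>t. - 2 * (t - t0)" "-2"
            "\<lambda>t. w (s1,t)" ?W2 _ "\<lambda>t. (norm (u (s1,t)))\<^sup>2" "\<lambda>t. 2 * (u (s1,t) \<bullet> u2 (s1,t))"])
        fix x assume x: "\<bar>x - t1\<bar> < \<epsilon>"
        show "((\<lambda>t. \<phi> (s1,t)) has_real_derivative - 2 * (x - t0)) (at x)"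
          unfolding \<phi>_def by (auto intro!: derivative_eq_intros)
        show "((\<lambda>t. w (s1,t)) has_real_derivative ?W2 x) (at x)"
          unfolding w_def using n2[OF x] by (intro DERIV_add has_real_derivative_norm_sq du)
        show "((\<lambda>t. (norm (u (s1,t)))\<^sup>2) has_real_derivative 2 * (u (s1,x) \<bullet> u2 (s1,x))) (at x)"
          using n2[OF x] by (intro has_real_derivative_norm_sq du)
        show "(\<phi> (s1,x))\<^sup>2 * w (s1,x) + \<Lambda> * (norm (u (s1,x)))\<^sup>2 \<le> (\<phi> (s1,t1))\<^sup>2 * w (s1,t1) + \<Lambda> * (norm (u (s1,t1)))\<^sup>2"
          using y(2)[OF m2[OF x]] by (simp add: P_def yst)
      next
        show "((\<lambda>t. - 2 * (t - t0)) has_real_derivative - 2) (at t1)" by (auto intro!: derivative_eq_intros)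
        show "(?W2 has_real_derivative 2 * (u12 (s1,t1) \<bullet> u12 (s1,t1) + u1 (s1,t1) \<bullet> u122 (s1,t1))
             + 2 * (u22 (s1,t1) \<bullet> u22 (s1,t1) + u2 (s1,t1) \<bullet> u222 (s1,t1))) (at t1)"
          by (intro DERIV_add DERIV_cmult has_real_derivative_inner du ddu yD)
        show "((\<lambda>t. 2 * (u (s1,t) \<bullet> u2 (s1,t))) has_real_derivative
           2 * (u2 (s1,t1) \<bullet> u2 (s1,t1) + u (s1,t1) \<bullet> u22 (s1,t1))) (at t1)"
          by (intro DERIV_cmult has_real_derivative_inner du yD)
      qed (rule \<epsilon>)
    qed
    have "(\<phi> y)\<^sup>2 \<le> (\<beta>\<^sup>2)\<^sup>2" using \<phi>y by (intro power_mono) auto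
    then have "(\<phi> y)\<^sup>2 * w y \<le> \<beta>^4 * (\<Lambda> * (M * N))" using wy w_nonneg by (intro mult_mono) auto
    moreover have "\<Lambda> * (norm (u y))\<^sup>2 \<le> \<Lambda> * M\<^sup>2" using yM \<Lambda> by (rule mult_left_mono)
    ultimately show ?thesis by (simp add: P_def)
  qed
  moreover have "P z \<le> P y" using \<beta> by (intro y(2)) simp
  moreover have "\<beta>^4 * w z \<le> P z" using \<Lambda> by (simp add: P_def \<phi>_def z)
  ultimately have "\<beta>^4 * w z \<le> \<beta>^4 * (\<Lambda> * (M * N)) + \<Lambda> * M\<^sup>2" by linarith
  then have "w z \<le> (\<beta>^4 * (\<Lambda> * (M * N)) + \<Lambda> * M\<^sup>2) / \<beta>^4" using \<beta> by (simp add: field_simps)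
  also have "\<dots> = G \<beta>" using \<beta> by (simp add: G_def \<Lambda>_def field_simps)
  finally show ?thesis .
qed

end

subsection \<open>Good lines\<close>

text \<open>Squaring the positive part removes its kink. This serves both the truncation of V along
  curves and the logarithmic cutoff.\<close>

lemma has_real_derivative_max_0_sq:
  "((\<lambda>x::real. (max 0 x)\<^sup>2) has_real_derivative 2 * max 0 x) (at x)"
proof -
  consider "x > 0" | "x < 0" | "x = 0" by linarith
  then show ?thesis
  proof cases
    case 1
    have "((\<lambda>x::real. x\<^sup>2) has_real_derivative 2 * max 0 x) (at x)"
      using 1 by (auto intro!: derivative_eq_intros)
    then show ?thesis
      by (rule has_field_derivative_transform_within_open[of _ _ _ "{0<..}"]) (use 1 in auto)
  next
    case 2
    have "((\<lambda>x::real. 0) has_real_derivative 2 * max 0 x) (at x)" using 2 by auto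
    then show ?thesis
      by (rule has_field_derivative_transform_within_open[of _ _ _ "{..<0}"]) (use 2 in auto)
  next
    case 3
    have "((\<lambda>h::real. (max 0 h)\<^sup>2 / h) \<longlongrightarrow> 0) (at 0)"
    proof (rule Lim_null_comparison)
      show "\<forall>\<^sub>F h in at 0. norm ((max 0 h)\<^sup>2 / h) \<le> \<bar>h\<bar>"
        by (rule always_eventually) (auto simp: max_def power2_eq_square)
      show "((\<lambda>h::real. \<bar>h\<bar>) \<longlongrightarrow> 0) (at 0)" by (auto intro!: tendsto_eq_intros)
    qed
    then show ?thesis using 3 by (simp add: DERIV_def)
  qed
qed

context potential
begin

text \<open>The truncation \<open>(max 0 (\<delta> - V))\<^sup>2\<close> vanishes off the wells, where \<open>\<nabla>V\<close> is not controlled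
  by \<open>V\<close>; its oscillation along the curve is bounded by the energy of the curve.\<close>

lemma potential_small_on_curve:
  fixes \<gamma> \<gamma>' :: "real \<Rightarrow> 'b"
  assumes ab: "a < b" and \<delta>: "0 < \<delta>" "\<And>y. V y < \<delta> \<Longrightarrow> \<exists>\<sigma>\<in>Z. norm (y - \<sigma>) \<le> d"
    and d: "\<And>t. t \<in> {a..b} \<Longrightarrow> (\<gamma> has_vector_derivative \<gamma>' t) (at t within {a..b})"
    and c': "continuous_on {a..b} \<gamma>'"
    and int: "integral {a..b} (\<lambda>t. (norm (\<gamma>' t))\<^sup>2 / 2 + V (\<gamma> t)) < \<kappa>"
    and \<kappa>: "\<kappa> \<le> c * \<delta> / 8" "\<kappa> \<le> \<delta> * (b - a) / 2"
    and t: "t \<in> {a..b}"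
  shows "V (\<gamma> t) < \<delta>"
proof -
  define en where "en t = (norm (\<gamma>' t))\<^sup>2 / 2 + V (\<gamma> t)" for t
  define f where "f t = (max 0 (\<delta> - V (\<gamma> t)))\<^sup>2" for t
  define f' where "f' t = 2 * max 0 (\<delta> - V (\<gamma> t)) * - (dV (\<gamma> t) \<bullet> \<gamma>' t)" for t
  have cg: "continuous_on {a..b} \<gamma>" by (rule continuous_on_vector_derivative[OF d])
  have ce: "continuous_on {a..b} en" unfolding en_def[abs_def] by (intro continuous_intros cg c') simp
  have cf': "continuous_on {a..b} f'" unfolding f'_def[abs_def] by (intro continuous_intros cg c')
  have e0: "0 \<le> en t" for t using V_nonneg by (simp add: en_def)
  have df: "(f has_real_derivative f' t) (at t within {a..b})" if "t \<in> {a..b}" for t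
  proof -
    have "((\<lambda>t. \<delta> - V (\<gamma> t)) has_real_derivative - (dV (\<gamma> t) \<bullet> \<gamma>' t)) (at t within {a..b})"
      using DERIV_diff[OF DERIV_const has_real_derivative_V[OF d[OF that]]] by simp
    from DERIV_chain2[OF has_real_derivative_max_0_sq this]
    show ?thesis unfolding f_def[abs_def] f'_def .
  qed
  have f'e: "\<bar>f' t\<bar> \<le> 2 * \<delta> / c * en t" for t
  proof (cases "V (\<gamma> t) < \<delta>")
    case True
    then obtain \<sigma> where "\<sigma> \<in> Z" "norm (\<gamma> t - \<sigma>) \<le> d" using \<delta>(2) by blast
    then have "c * (norm (dV (\<gamma> t)))\<^sup>2 \<le> V (\<gamma> t)" by (rule well(4))
    moreover have "\<bar>dV (\<gamma> t) \<bullet> \<gamma>' t\<bar> \<le> (norm (dV (\<gamma> t)))\<^sup>2 / 2 + (norm (\<gamma>' t))\<^sup>2 / 2"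
      using Cauchy_Schwarz_ineq2[of "dV (\<gamma> t)" "\<gamma>' t"] sum_squares_bound[of "norm (dV (\<gamma> t))" "norm (\<gamma>' t)"] by simp
    then have "c * \<bar>dV (\<gamma> t) \<bullet> \<gamma>' t\<bar> \<le> c * ((norm (dV (\<gamma> t)))\<^sup>2 / 2 + (norm (\<gamma>' t))\<^sup>2 / 2)"
      using c by (intro mult_left_mono) auto
    moreover have "c * (norm (\<gamma>' t))\<^sup>2 \<le> 1 * (norm (\<gamma>' t))\<^sup>2" using c by (intro mult_right_mono) auto
    ultimately have "c * \<bar>dV (\<gamma> t) \<bullet> \<gamma>' t\<bar> \<le> en t" using V_nonneg[of "\<gamma> t"] by (simp add: en_def distrib_left)
    then have 1: "\<bar>dV (\<gamma> t) \<bullet> \<gamma>' t\<bar> \<le> en t / c" using c by (simp add: field_simps)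
    have "\<bar>f' t\<bar> = 2 * (\<delta> - V (\<gamma> t)) * \<bar>dV (\<gamma> t) \<bullet> \<gamma>' t\<bar>" using True by (simp add: f'_def abs_mult)
    also have "\<dots> \<le> (2 * \<delta>) * (en t / c)" using 1 \<delta>(1) V_nonneg[of "\<gamma> t"] True by (intro mult_mono) auto
    finally show ?thesis by simp
  next
    case False
    then have "f' t = 0" by (simp add: f'_def)
    then show ?thesis using e0[of t] \<delta>(1) c by simp
  qed
  \<comment> \<open>Integrating \<open>f'e\<close> bounds the oscillation by 2 \<delta> / c times
    the energy, and \<kappa> \<le> c \<delta> / 8 turns this into \<delta>^2 / 4.\<close>
  have osc: "\<bar>f q - f p\<bar> < \<delta>\<^sup>2 / 4" if "a \<le> p" "p \<le> q" "q \<le> b" for p q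
  proof -
    have sub: "{p..q} \<subseteq> {a..b}" using that by auto
    have h: "(f' has_integral f q - f p) {p..q}"
    proof (rule fundamental_theorem_of_calculus[OF that(2)])
      fix x assume "x \<in> {p..q}"
      then show "(f has_vector_derivative f' x) (at x within {p..q})"
        using has_vector_derivative_within_subset[OF df[unfolded has_real_derivative_iff_has_vector_derivative] sub] sub
        by blast
    qed
    have i: "(\<lambda>t. 2 * \<delta> / c * en t) integrable_on {p..q}"
      by (rule integrable_continuous_real[OF continuous_on_mult[OF continuous_on_const continuous_on_subset[OF ce sub]]])
    have "norm (integral {p..q} f') \<le> integral {p..q} (\<lambda>t. 2 * \<delta> / c * en t)"
      by (rule integral_norm_bound_integral[OF has_integral_integrable[OF h] i]) (simp only: real_norm_def f'e)
    then have "\<bar>f q - f p\<bar> \<le> integral {p..q} (\<lambda>t. 2 * \<delta> / c * en t)"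
      by (simp only: integral_unique[OF h] real_norm_def)
    also have "\<dots> \<le> integral {a..b} (\<lambda>t. 2 * \<delta> / c * en t)"
      using e0 \<delta>(1) c sub
      by (intro integral_subset_le integrable_continuous_real continuous_intros continuous_on_subset[OF ce]) auto
    also have "\<dots> = 2 * \<delta> / c * integral {a..b} en" by simp
    also have "\<dots> < 2 * \<delta> / c * \<kappa>" using int \<delta>(1) c unfolding en_def[abs_def] by (intro mult_strict_left_mono) auto
    also have "\<dots> \<le> 2 * \<delta> / c * (c * \<delta> / 8)" using \<kappa>(1) \<delta>(1) c by (intro mult_left_mono) auto
    also have "\<dots> = \<delta>\<^sup>2 / 4" using c by (simp add: power2_eq_square)
    finally show ?thesis .
  qed
  \<comment> \<open>The second bound on \<kappa> prevents V from exceeding \<delta> / 2 along the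
    whole curve. At the point found, \<open>f\<close> is at least \<delta>^2 / 4, which exceeds its
    oscillation, so \<open>f\<close> is positive throughout.\<close>
  have "\<exists>p\<in>{a..b}. V (\<gamma> p) \<le> \<delta> / 2"
  proof (rule ccontr)
    assume "\<not> ?thesis"
    then have n: "\<delta> / 2 < V (\<gamma> p)" if "p \<in> {a..b}" for p using that not_le by blast
    have *: "\<delta> / 2 \<le> en p" if "p \<in> {a..b}" for p
      using n[OF that] zero_le_power2[of "norm (\<gamma>' p)"] unfolding en_def by linarith
    have "integral {a..b} (\<lambda>_. \<delta> / 2) \<le> integral {a..b} en"
      using * by (intro integral_le integrable_continuous_real ce) auto
    then show False using int \<kappa>(2) ab unfolding en_def[abs_def] by (simp add: mult.commute)
  qed
  then obtain p where p: "p \<in> {a..b}" "V (\<gamma> p) \<le> \<delta> / 2" by blast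
  have "(\<delta> / 2)\<^sup>2 \<le> f p" unfolding f_def using p(2) \<delta>(1) by (intro power_mono) auto
  then have "\<delta>\<^sup>2 / 4 \<le> f p" by (simp add: power_divide)
  moreover have "\<bar>f t - f p\<bar> < \<delta>\<^sup>2 / 4"
    using osc[of p t] osc[of t p] p(1) t by (cases "p \<le> t") (auto simp: abs_minus_commute)
  ultimately have "f t > 0" by linarith
  then show ?thesis by (simp add: f_def max_def split: if_splits)
qed

end

section \<open>Averaging the energy over lines\<close>

context planar
begin

text \<open>The four lines are summed so that a single good \<open>z\<close> provides the whole
  boundary of a square, and so that even cutoffs see good lines on both sides. The lines run across
  the entire square of half side \<open>r\<close>, beyond the corners of the frame.\<close>

definition frame_energy :: "real \<Rightarrow> real \<Rightarrow> real" where
  "frame_energy r z = integral {-r..r} (\<lambda>t. e (z,t) + e (-z,t) + e (t,z) + e (t,-z))"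

lemma line_continuous:
  assumes sub: "sq r \<subseteq> D" and f: "continuous_on D f" and z: "\<bar>z\<bar> \<le> r"
  shows "continuous_on {-r..r} (\<lambda>t. f (z,t))" "continuous_on {-r..r} (\<lambda>t. f (t,z))"
  by (rule continuous_on_compose2[OF f]; use sub z in \<open>auto intro!: continuous_intros simp: mem_sq subset_iff\<close>)+

lemma frame_energy_bound:
  assumes sub: "sq r \<subseteq> D" and z: "\<bar>z\<bar> \<le> r" and y: "\<bar>y\<bar> = \<bar>z\<bar>"
  shows "integral {-r..r} (\<lambda>t. e (y,t)) \<le> frame_energy r z" "integral {-r..r} (\<lambda>t. e (t,y)) \<le> frame_energy r z"
proof -
  have ce: "continuous_on D e" using cont_sub[of D] by simp
  note c = line_continuous[OF sub ce]
  have z': "\<bar>- z\<bar> \<le> r" "\<bar>y\<bar> \<le> r" using z y by auto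
  have "y = z \<or> y = - z" using y by auto
  then show "integral {-r..r} (\<lambda>t. e (y,t)) \<le> frame_energy r z" "integral {-r..r} (\<lambda>t. e (t,y)) \<le> frame_energy r z"
    unfolding frame_energy_def
    by (auto intro!: integral_le integrable_continuous_real continuous_on_add c z z' simp: add_nonneg_nonneg e_nonneg)
qed

text \<open>The energy of the curve traced by \<open>u\<close> along a line involves the tangential
  derivative only, so it is at most the integral of \<open>e\<close> over that line.\<close>

lemma potential_small_on_frame:
  assumes r: "0 < r" and sub: "sq r \<subseteq> D" and \<delta>: "0 < \<delta>" "\<And>y. V y < \<delta> \<Longrightarrow> \<exists>\<sigma>\<in>Z. norm (y - \<sigma>) \<le> d"
    and \<kappa>: "\<kappa> \<le> c * \<delta> / 8" "\<kappa> \<le> \<delta> * r"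
    and z: "\<bar>z\<bar> \<le> r" "frame_energy r z < \<kappa>" and t: "\<bar>t\<bar> \<le> r" and y: "\<bar>y\<bar> = \<bar>z\<bar>"
  shows "V (u (y,t)) < \<delta>" "V (u (t,y)) < \<delta>"
proof -
  have yr: "\<bar>y\<bar> \<le> r" using z y by simp
  have D: "(y,t) \<in> D" "(t,y) \<in> D" if "t \<in> {-r..r}" for t
    using that yr sub by (auto simp: subset_iff mem_sq abs_le_iff)
  have ce: "continuous_on D e" using cont_sub[of D] by simp
  show "V (u (y,t)) < \<delta>"
  proof (rule potential_small_on_curve[OF _ \<delta>, of "-r" r "\<lambda>t. u (y,t)" "\<lambda>t. u2 (y,t)" \<kappa>])
    have "integral {-r..r} (\<lambda>t. (norm (u2 (y,t)))\<^sup>2 / 2 + V (u (y,t))) \<le> integral {-r..r} (\<lambda>t. e (y,t))"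
      by (intro integral_le integrable_continuous_real continuous_intros line_continuous[OF sub _ yr] cont ce)
        (auto simp: e_def w_def)
    also have "\<dots> < \<kappa>" using frame_energy_bound(1)[OF sub z(1) y] z(2) by simp
    finally show "integral {-r..r} (\<lambda>t. (norm (u2 (y,t)))\<^sup>2 / 2 + V (u (y,t))) < \<kappa>" .
  qed (use r \<kappa> t D in \<open>auto intro!: has_vector_derivative_at_within du line_continuous[OF sub _ yr] cont\<close>)
  show "V (u (t,y)) < \<delta>"
  proof (rule potential_small_on_curve[OF _ \<delta>, of "-r" r "\<lambda>t. u (t,y)" "\<lambda>t. u1 (t,y)" \<kappa>])
    have "integral {-r..r} (\<lambda>t. (norm (u1 (t,y)))\<^sup>2 / 2 + V (u (t,y))) \<le> integral {-r..r} (\<lambda>t. e (t,y))"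
      by (intro integral_le integrable_continuous_real continuous_intros line_continuous[OF sub _ yr] cont ce)
        (auto simp: e_def w_def)
    also have "\<dots> < \<kappa>" using frame_energy_bound(2)[OF sub z(1) y] z(2) by simp
    finally show "integral {-r..r} (\<lambda>t. (norm (u1 (t,y)))\<^sup>2 / 2 + V (u (t,y))) < \<kappa>" .
  qed (use r \<kappa> t D in \<open>auto intro!: has_vector_derivative_at_within du line_continuous[OF sub _ yr] cont\<close>)
qed

lemma continuous_on_frame_energy:
  assumes sub: "sq r \<subseteq> D"
  shows "continuous_on {-r..r} (frame_energy r)"
proof -
  have ce: "continuous_on (sq r) e" using cont_sub[OF sub] by simp
  have "continuous_on ({-r..r} \<times> cbox (-r) r) (\<lambda>(z,t). e (z,t) + e (-z,t) + e (t,z) + e (t,-z))"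
    unfolding case_prod_beta
    by (intro continuous_intros continuous_on_compose2[OF ce]) (auto simp: mem_sq)
  then show ?thesis unfolding frame_energy_def[abs_def] using integral_continuous_on_param[of "{-r..r}" "-r" r] by simp
qed

text \<open>Each of the four families of lines sweeps the square once and contributes
  \<open>E r\<close> by Fubini.\<close>

lemma integral_frame_energy:
  assumes sub: "sq r \<subseteq> D" and r: "0 \<le> r"
  shows "integral {-r..r} (frame_energy r) = 4 * E r"
proof -
  have ce: "continuous_on (sq r) e" and ceD: "continuous_on D e" using cont_sub[OF sub] cont_sub[of D] by auto
  note lc = line_continuous[OF sub ceD]
  define A B where "A z = integral {-r..r} (\<lambda>t. e (z,t))" and "B z = integral {-r..r} (\<lambda>t. e (t,z))" for z
  have cA: "continuous_on {-r..r} A"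
  proof -
    have "continuous_on ({-r..r} \<times> cbox (-r) r) (\<lambda>(z,t). e (z,t))"
      unfolding case_prod_beta by (intro continuous_intros continuous_on_compose2[OF ce]) (auto simp: mem_sq)
    from integral_continuous_on_param[OF this] show ?thesis unfolding A_def[abs_def] by simp
  qed
  have cB: "continuous_on {-r..r} B"
  proof -
    have "continuous_on ({-r..r} \<times> cbox (-r) r) (\<lambda>(z,t). e (t,z))"
      unfolding case_prod_beta by (intro continuous_intros continuous_on_compose2[OF ce]) (auto simp: mem_sq)
    then show ?thesis unfolding B_def[abs_def] using integral_continuous_on_param[of "{-r..r}" "-r" r] by simp
  qed
  have cm: "continuous_on {-r..r} (\<lambda>z. A (-z))" "continuous_on {-r..r} (\<lambda>z. B (-z))"
    by (rule continuous_on_compose2[OF cA] continuous_on_compose2[OF cB]; auto intro!: continuous_intros)+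
  have fr: "frame_energy r z = A z + A (-z) + B z + B (-z)" if "z \<in> {-r..r}" for z
  proof -
    have z: "\<bar>z\<bar> \<le> r" "\<bar>-z\<bar> \<le> r" using that by auto
    show ?thesis unfolding frame_energy_def A_def B_def
      by (subst integral_add; (intro integrable_continuous_real continuous_intros lc z)?)+ simp
  qed
  have refl: "integral {-r..r} (\<lambda>z. A (-z)) = integral {-r..r} A" "integral {-r..r} (\<lambda>z. B (-z)) = integral {-r..r} B"
    using Henstock_Kurzweil_Integration.integral_reflect_real[where a="-r" and b=r and f=A]
      Henstock_Kurzweil_Integration.integral_reflect_real[where a="-r" and b=r and f=B] by (simp_all only: minus_minus)
  have "integral {-r..r} (frame_energy r) = integral {-r..r} (\<lambda>z. A z + A (-z) + B z + B (-z))"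
    by (intro integral_cong fr)
  also have "\<dots> = integral {-r..r} A + integral {-r..r} (\<lambda>z. A (-z)) + integral {-r..r} B + integral {-r..r} (\<lambda>z. B (-z))"
    by (subst integral_add; (intro integrable_continuous_real continuous_intros cA cB cm)?)+ simp
  also have "\<dots> = 2 * integral {-r..r} A + 2 * integral {-r..r} B"
    using refl by simp
  also have "integral {-r..r} A = E r"
    unfolding A_def[abs_def] E_def sq_def using ce by (simp add: integral_cbox_fst_snd sq_def)
  also have "integral {-r..r} B = E r"
    unfolding B_def[abs_def] E_def sq_def using ce by (simp add: integral_cbox_snd_fst sq_def)
  finally show ?thesis by simp
qed

text \<open>The density is a bump times the positive part of \<kappa> - \<open>frame_energy\<close>,
  so it vanishes on bad lines. The bump has integral m^3 / 6 and height m^2 / 4, so the density has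
  integral at least \<kappa> m^3 / 6 - (m^2 / 4) 4 E, which the hypothesis on E makes at least
  \<kappa> m^3 / 12. Its height \<kappa> m^2 / 4 divided by this is the slope 3 / m.\<close>

lemma good_cutoff:
  assumes m: "0 < m" and sub: "sq (4*m) \<subseteq> D" and \<kappa>: "0 < \<kappa>" and E: "E (4*m) \<le> \<kappa> / 12 * m"
  obtains b b' where "cutoff (4*m) (2*m) (3*m) (3 / m) b b'"
    "\<And>s. \<bar>s\<bar> \<le> 4*m \<Longrightarrow> b' s \<noteq> 0 \<Longrightarrow> frame_energy (4*m) \<bar>s\<bar> < \<kappa>"
proof -
  define r where "r = 4 * m"
  define k where "k z = bump (2*m) (3*m) z * max 0 (\<kappa> - frame_energy r z)" for z
  note sub' = sub[folded r_def]
  have cF: "continuous_on {-r..r} (frame_energy r)" by (rule continuous_on_frame_energy[OF sub'])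
  have ck: "continuous_on {-r..r} k" unfolding k_def[abs_def] by (intro continuous_intros cF)
  have F0: "0 \<le> frame_energy r z" if "z \<in> {-r..r}" for z
  proof -
    have "\<bar>z\<bar> \<le> r" "\<bar>-z\<bar> \<le> r" using that by auto
    note lc = line_continuous[OF sub' _ this(1)] line_continuous[OF sub' _ this(2)]
    have "continuous_on D e" using cont_sub[of D] by simp
    then show ?thesis unfolding frame_energy_def
      by (intro integral_nonneg integrable_continuous_real continuous_intros lc) (auto simp: e_nonneg add_nonneg_nonneg)
  qed
  have bump: "0 \<le> bump (2*m) (3*m) z" "bump (2*m) (3*m) z \<le> m\<^sup>2 / 4" for z
    using bump_nonneg bump_le[of "2*m" "3*m" z] by (auto simp: field_simps)
  have low: "\<kappa> * bump (2*m) (3*m) z - m\<^sup>2 / 4 * frame_energy r z \<le> k z" if z: "z \<in> {-r..r}" for z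
  proof -
    have "bump (2*m) (3*m) z * (\<kappa> - frame_energy r z) \<le> k z"
      unfolding k_def by (intro mult_left_mono bump) simp
    moreover have "bump (2*m) (3*m) z * frame_energy r z \<le> m\<^sup>2 / 4 * frame_energy r z"
      by (intro mult_right_mono bump F0 z)
    ultimately show ?thesis by (simp add: algebra_simps)
  qed
  have int: "\<kappa> * m ^ 3 / 12 \<le> integral {-r..r} k"
  proof -
    have i: "bump (2*m) (3*m) integrable_on {-r..r}" "frame_energy r integrable_on {-r..r}" "k integrable_on {-r..r}"
      by (intro integrable_continuous_real continuous_intros cF ck)+
    have "m\<^sup>2 * E r \<le> m\<^sup>2 * (\<kappa> / 12 * m)" using E by (intro mult_left_mono) (auto simp: r_def)
    then have "\<kappa> * m ^ 3 / 12 \<le> \<kappa> * (m ^ 3 / 6) - m\<^sup>2 / 4 * (4 * E r)" by (simp add: power2_eq_square power3_eq_cube algebra_simps)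
    also have "\<dots> = \<kappa> * integral {-r..r} (bump (2*m) (3*m)) - m\<^sup>2 / 4 * integral {-r..r} (frame_energy r)"
      using m by (subst integral_bump) (auto simp: r_def integral_frame_energy[OF sub])
    also have "\<dots> = integral {-r..r} (\<lambda>z. \<kappa> * bump (2*m) (3*m) z - m\<^sup>2 / 4 * frame_energy r z)"
      using i by (subst integral_diff) (auto intro: integrable_on_mult_right)
    also have "\<dots> \<le> integral {-r..r} k"
      using i low by (intro integral_le integrable_diff integrable_on_mult_right) auto
    finally show ?thesis .
  qed
  have B: "m\<^sup>2 / 4 * \<kappa> / (\<kappa> * m ^ 3 / 12) = 3 / m" using m \<kappa> by (simp add: power2_eq_square power3_eq_cube)
  obtain b b' where b: "cutoff r (2*m) (3*m) (m\<^sup>2 / 4 * \<kappa> / (\<kappa> * m ^ 3 / 12)) b b'"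
    "\<And>s. s \<in> {-r..r} \<Longrightarrow> b' s \<noteq> 0 \<Longrightarrow> k \<bar>s\<bar> \<noteq> 0"
  proof (rule cutoff_from_density[of "2*m" "3*m" r k "m\<^sup>2 / 4 * \<kappa>" "\<kappa> * m ^ 3 / 12", OF _ _ _ ck _ _ _ int])
    show "0 \<le> k z \<and> k z \<le> m\<^sup>2 / 4 * \<kappa>" if "z \<in> {-r..r}" for z
      unfolding k_def using F0[OF that] \<kappa> by (intro conjI mult_nonneg_nonneg mult_mono bump) auto
    show "k z = 0" if "z \<le> 2 * m \<or> 3 * m \<le> z" for z
      unfolding k_def using bump_eq_0[of "2*m" "3*m" z] that m by auto
  qed (use m \<kappa> in \<open>auto simp: r_def\<close>)
  show ?thesis
  proof (rule that[OF b(1)[unfolded B, unfolded r_def]])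
    fix s assume s: "\<bar>s\<bar> \<le> 4*m" "b' s \<noteq> 0"
    then have "k \<bar>s\<bar> \<noteq> 0" using b(2) by (auto simp: r_def abs_le_iff)
    then show "frame_energy (4*m) \<bar>s\<bar> < \<kappa>" by (simp add: k_def r_def max_def split: if_splits)
  qed
qed

text \<open>The cutoff falls from 1 at 2 m to 0 at 3 m, so its derivative is nonzero somewhere in
  between.\<close>

lemma good_frame:
  assumes m: "0 < m" and sub: "sq (4*m) \<subseteq> D" and \<kappa>: "0 < \<kappa>" and E: "E (4*m) \<le> \<kappa> / 12 * m"
  obtains z where "2 * m \<le> z" "z \<le> 3 * m" "frame_energy (4*m) z < \<kappa>"
proof -
  obtain b b' where b: "cutoff (4*m) (2*m) (3*m) (3 / m) b b'"
    "\<And>s. \<bar>s\<bar> \<le> 4*m \<Longrightarrow> b' s \<noteq> 0 \<Longrightarrow> frame_energy (4*m) \<bar>s\<bar> < \<kappa>"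
    using good_cutoff[OF assms] by blast
  have "\<exists>s\<in>{2*m..3*m}. b' s \<noteq> 0"
  proof (rule ccontr)
    assume *: "\<not> ?thesis"
    have h: "(b' has_integral b (3*m) - b (2*m)) {2*m..3*m}"
    proof (rule fundamental_theorem_of_calculus[of "2*m" "3*m" b b'])
      fix x assume x: "x \<in> {2*m..3*m}"
      then have "(b has_real_derivative b' x) (at x within {- (4*m)..4*m})"
        using m by (intro cutoffD(1)[OF b(1)]) auto
      then show "(b has_vector_derivative b' x) (at x within {2*m..3*m})"
        unfolding has_real_derivative_iff_has_vector_derivative
        by (rule has_vector_derivative_within_subset) (use m in auto)
    qed (use m in simp)
    have "(b' has_integral 0) {2*m..3*m}" by (rule has_integral_is_0) (use * in blast)
    from has_integral_unique[OF h this] have "b (3*m) = b (2*m)" by simp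
    moreover have "b (2*m) = 1" "b (3*m) = 0"
      by (rule cutoffD(5)[OF b(1)] cutoffD(6)[OF b(1)]; use m in simp)+
    ultimately show False by simp
  qed
  then obtain s where s: "2*m \<le> s" "s \<le> 3*m" "b' s \<noteq> 0" by auto
  have "frame_energy (4*m) \<bar>s\<bar> < \<kappa>" by (rule b(2)) (use s m in auto)
  then show ?thesis using s(1,2) m by (intro that[of s]) auto
qed

end

subsection \<open>Logarithmic cutoffs near the wells\<close>

text \<open>The square \<open>(q / a)\<^sup>2\<close> inside the logarithm makes the cutoff differentiable on the whole line, also
  for the irrelevant negative \<open>q\<close>.\<close>

definition logcut :: "real \<Rightarrow> real \<Rightarrow> real \<Rightarrow> real" where
  "logcut \<tau> a q = (max 0 (1 - \<tau> * ln (1 + (q / a)\<^sup>2)))\<^sup>2"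

definition logcut' :: "real \<Rightarrow> real \<Rightarrow> real \<Rightarrow> real" where
  "logcut' \<tau> a q = 2 * max 0 (1 - \<tau> * ln (1 + (q / a)\<^sup>2)) * - (\<tau> * (2 * (q / a\<^sup>2) / (1 + (q / a)\<^sup>2)))"

lemma one_plus_sq_pos: "0 < 1 + x\<^sup>2" for x :: real
  using zero_le_power2[of x] by linarith

lemma has_real_derivative_logcut:
  assumes "0 < a"
  shows "(logcut \<tau> a has_real_derivative logcut' \<tau> a q) (at q)"
proof -
  have "((\<lambda>q. 1 - \<tau> * ln (1 + (q / a)\<^sup>2)) has_real_derivative - (\<tau> * (2 * (q / a\<^sup>2) / (1 + (q / a)\<^sup>2)))) (at q)"
    using one_plus_sq_pos[of "q / a"] assms
    by (auto intro!: derivative_eq_intros simp: power2_eq_square mult.commute mult.left_commute)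
  from DERIV_chain2[OF has_real_derivative_max_0_sq this] show ?thesis
    unfolding logcut_def[abs_def] logcut'_def .
qed

lemma continuous_on_logcut': "continuous_on UNIV (logcut' \<tau> a)"
  unfolding logcut'_def[abs_def] divide_inverse[of _ a] divide_inverse[of _ "a\<^sup>2"]
  by (intro continuous_intros) (use one_plus_sq_pos in \<open>auto simp: less_imp_neq[symmetric]\<close>)

lemma logcut_bounds:
  assumes "0 \<le> \<tau>"
  shows "0 \<le> logcut \<tau> a q" "logcut \<tau> a q \<le> 1"
proof -
  show "0 \<le> logcut \<tau> a q" by (simp add: logcut_def)
  have "0 \<le> \<tau> * ln (1 + (q / a)\<^sup>2)" using assms by simp
  then have "max 0 (1 - \<tau> * ln (1 + (q / a)\<^sup>2)) \<le> 1" by simp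
  then show "logcut \<tau> a q \<le> 1" unfolding logcut_def using power_mono[of _ 1 2] by fastforce
qed

text \<open>From \<open>b\<close> on, (q / a)^2 is at least exp(1 / \<tau>), so the logarithm has
  reached 1 / \<tau>.\<close>

lemma logcut_eq_0:
  assumes "0 < \<tau>" "0 < b" "a = b * exp (- 1 / (2 * \<tau>))" "b \<le> q"
  shows "logcut \<tau> a q = 0" "logcut' \<tau> a q = 0"
proof -
  have a: "0 < a" using assms by simp
  have "exp (1 / (2 * \<tau>)) * a = b * (exp (1 / (2 * \<tau>)) * exp (- 1 / (2 * \<tau>)))"
    unfolding assms(3) by (rule mult.left_commute)
  also have "exp (1 / (2 * \<tau>)) * exp (- 1 / (2 * \<tau>)) = 1" unfolding exp_add[symmetric] by simp
  finally have "exp (1 / (2 * \<tau>)) = b / a" using a by (simp add: eq_divide_eq)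
  also have "\<dots> \<le> q / a" using divide_right_mono[OF assms(4), of a] a by simp
  finally have "(exp (1 / (2 * \<tau>)))\<^sup>2 \<le> (q / a)\<^sup>2" by (intro power_mono) auto
  moreover have "(exp (1 / (2 * \<tau>)))\<^sup>2 = exp (1 / \<tau>)"
    unfolding power2_eq_square exp_add[symmetric] using assms(1) by (simp add: field_simps)
  ultimately have "exp (1 / \<tau>) \<le> 1 + (q / a)\<^sup>2" by simp
  then have "1 / \<tau> \<le> ln (1 + (q / a)\<^sup>2)" using one_plus_sq_pos by (simp add: ln_ge_iff)
  then have "1 - \<tau> * ln (1 + (q / a)\<^sup>2) \<le> 0" using assms(1) by (simp add: field_simps)
  then show "logcut \<tau> a q = 0" "logcut' \<tau> a q = 0" by (simp_all add: logcut_def logcut'_def)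
qed

lemma logcut_ge:
  assumes "0 \<le> \<tau>" "\<tau> \<le> 1/2" "0 < a" "0 \<le> q" "q \<le> a"
  shows "1 / 4 \<le> logcut \<tau> a q"
proof -
  have "(q / a)\<^sup>2 \<le> 1" using assms by (simp add: power_le_one)
  then have "ln (1 + (q / a)\<^sup>2) \<le> 1" using ln_add_one_self_le_self[of "(q/a)\<^sup>2"] by simp
  then have "\<tau> * ln (1 + (q / a)\<^sup>2) \<le> 1/2 * 1" using assms by (intro mult_mono) auto
  then have "(1/2)\<^sup>2 \<le> (max 0 (1 - \<tau> * ln (1 + (q / a)\<^sup>2)))\<^sup>2" by (intro power_mono) auto
  then show ?thesis by (simp add: logcut_def power_divide)
qed

text \<open>With X = q / a the logarithm contributes X^2 / (1 + X^2). Replacing this by 1, X^2 or X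
  / 2 gives the three bounds below: small with \<tau> everywhere, quadratically small near the well,
  and linear in q, hence comparable to V.\<close>

lemma logcut'_bound:
  assumes "0 \<le> \<tau>" "0 < a" "0 \<le> q"
  shows "\<bar>logcut' \<tau> a q\<bar> * q \<le> 4 * \<tau> * ((q / a)\<^sup>2 / (1 + (q / a)\<^sup>2))"
proof -
  define X where "X = max 0 (1 - \<tau> * ln (1 + (q / a)\<^sup>2))"
  have "0 \<le> \<tau> * ln (1 + (q / a)\<^sup>2)" using assms by simp
  then have X: "0 \<le> X" "X \<le> 1" by (auto simp: X_def)
  have "\<bar>logcut' \<tau> a q\<bar> * q = X * (4 * \<tau> * ((q / a)\<^sup>2 / (1 + (q / a)\<^sup>2)))"
    unfolding logcut'_def X_def[symmetric] using assms X one_plus_sq_pos[of "q / a"]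
    by (simp add: abs_mult abs_divide power2_eq_square)
  also have "\<dots> \<le> 1 * (4 * \<tau> * ((q / a)\<^sup>2 / (1 + (q / a)\<^sup>2)))"
    using X assms by (intro mult_right_mono) auto
  finally show ?thesis by simp
qed

lemma logcut'_bound_1:
  assumes "0 \<le> \<tau>" "0 < a" "0 \<le> q"
  shows "\<bar>logcut' \<tau> a q\<bar> * q \<le> 4 * \<tau>"
proof -
  have "(q / a)\<^sup>2 / (1 + (q / a)\<^sup>2) \<le> 1" using one_plus_sq_pos[of "q/a"] by simp
  then have "4 * \<tau> * ((q / a)\<^sup>2 / (1 + (q / a)\<^sup>2)) \<le> 4 * \<tau> * 1" using assms by (intro mult_left_mono) auto
  then show ?thesis using logcut'_bound[OF assms] by linarith
qed

lemma logcut'_bound_sq: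
  assumes "0 \<le> \<tau>" "0 < a" "0 \<le> q"
  shows "\<bar>logcut' \<tau> a q\<bar> * q \<le> 4 * \<tau> * (q / a)\<^sup>2"
proof -
  have "(q / a)\<^sup>2 / (1 + (q / a)\<^sup>2) \<le> (q / a)\<^sup>2 / 1" by (intro divide_left_mono) (use one_plus_sq_pos[of "q/a"] in auto)
  then have "4 * \<tau> * ((q / a)\<^sup>2 / (1 + (q / a)\<^sup>2)) \<le> 4 * \<tau> * (q / a)\<^sup>2" using assms by (intro mult_left_mono) auto
  then show ?thesis using logcut'_bound[OF assms] by linarith
qed

lemma logcut'_bound_linear:
  assumes "0 \<le> \<tau>" "0 < a" "0 \<le> q"
  shows "\<bar>logcut' \<tau> a q\<bar> * q \<le> 2 * \<tau> * (q / a)"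
proof -
  have X: "X\<^sup>2 / (1 + X\<^sup>2) \<le> X / 2" if "0 \<le> X" for X :: real
  proof -
    have "X * (2 * X) \<le> X * (1 + X\<^sup>2)" using sum_squares_bound[of 1 X] that by (intro mult_left_mono) auto
    then show ?thesis using one_plus_sq_pos[of X] by (simp add: pos_divide_le_eq power2_eq_square algebra_simps)
  qed
  have "(q / a)\<^sup>2 / (1 + (q / a)\<^sup>2) \<le> (q / a) / 2" by (rule X) (use assms in simp)
  then have "4 * \<tau> * ((q / a)\<^sup>2 / (1 + (q / a)\<^sup>2)) \<le> 4 * \<tau> * ((q / a) / 2)" using assms by (intro mult_left_mono) auto
  then show ?thesis using logcut'_bound[OF assms] by simp
qed

context potential
begin

text \<open>Chosen so that \<open>logcut \<tau>\<close> vanishes beyond \<open>d\<^sup>2\<close>.\<close>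

definition well_scale :: "real \<Rightarrow> real" where
  "well_scale \<tau> = d\<^sup>2 * exp (- 1 / (2 * \<tau>))"

lemma well_scale: "0 < well_scale \<tau>" "0 < \<tau> \<Longrightarrow> well_scale \<tau> \<le> d\<^sup>2"
  using d by (auto simp: well_scale_def mult_left_le)

text \<open>The squared distance appears because it is the argument of \<open>logcut\<close>; below
  such a level some cutoff is at least 1/4 once \<tau> \<le> 1/2.\<close>

definition well_level :: "real \<Rightarrow> real \<Rightarrow> bool" where
  "well_level \<tau> \<delta> \<longleftrightarrow> 0 < \<delta> \<and> (\<forall>y. V y < \<delta> \<longrightarrow> (\<exists>\<sigma>\<in>Z. (norm (y - \<sigma>))\<^sup>2 \<le> well_scale \<tau>))"

lemma well_level_exists: "\<exists>\<delta>. well_level \<tau> \<delta>"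
proof -
  obtain \<delta> where \<delta>: "\<delta> > 0" "\<And>y. V y < \<delta> \<Longrightarrow> \<exists>\<sigma>\<in>Z. norm (y - \<sigma>) \<le> sqrt (well_scale \<tau>)"
    using near_well[of "sqrt (well_scale \<tau>)"] well_scale by auto
  have "(norm (y - \<sigma>))\<^sup>2 \<le> well_scale \<tau>" if "norm (y - \<sigma>) \<le> sqrt (well_scale \<tau>)" for y \<sigma>
    using power_mono[OF that norm_ge_zero, of 2] less_imp_le[OF well_scale(1)] by (simp only: real_sqrt_pow2)
  then show ?thesis using \<delta> unfolding well_level_def by blast
qed

lemma well_level_near:
  assumes "well_level \<tau> \<delta>" "0 < \<tau>" "V y < \<delta>"
  shows "\<exists>\<sigma>\<in>Z. norm (y - \<sigma>) \<le> d"
proof -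
  obtain \<sigma> where "\<sigma> \<in> Z" "(norm (y - \<sigma>))\<^sup>2 \<le> well_scale \<tau>" using assms unfolding well_level_def by blast
  then have "(norm (y - \<sigma>))\<^sup>2 \<le> d\<^sup>2" using well_scale(2)[OF assms(2)] by linarith
  from power2_le_imp_le[OF this] have "norm (y - \<sigma>) \<le> d" using d by simp
  then show ?thesis using \<open>\<sigma> \<in> Z\<close> by blast
qed

end

section \<open>The test for all wells together\<close>

context planar
begin

text \<open>A plain sum instead of a partition of unity: each summand can be tested on its own, at
  the cost of a factor \<open>card Z\<close>.\<close>

definition \<theta> :: "real \<Rightarrow> real \<times> real \<Rightarrow> real" where
  "\<theta> \<tau> x = (\<Sum>\<sigma>\<in>Z. logcut \<tau> (well_scale \<tau>) ((norm (u x - \<sigma>))\<^sup>2))"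

lemma \<theta>_nonneg: "0 \<le> \<theta> \<tau> x"
  unfolding \<theta>_def logcut_def by (intro sum_nonneg) simp

lemma \<theta>_ge:
  assumes "well_level \<tau> \<delta>" "0 < \<tau>" "\<tau> \<le> 1/2" "V (u x) < \<delta>"
  shows "1 \<le> 4 * \<theta> \<tau> x"
proof -
  obtain \<sigma> where \<sigma>: "\<sigma> \<in> Z" "(norm (u x - \<sigma>))\<^sup>2 \<le> well_scale \<tau>" using assms unfolding well_level_def by blast
  have "1/4 \<le> logcut \<tau> (well_scale \<tau>) ((norm (u x - \<sigma>))\<^sup>2)"
    by (rule logcut_ge) (use assms \<sigma> well_scale in auto)
  also have "\<dots> \<le> \<theta> \<tau> x"
    unfolding \<theta>_def by (rule member_le_sum) (use \<sigma> finite_Z in \<open>auto simp: logcut_def\<close>)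
  finally show ?thesis by simp
qed

lemma continuous_on_logcut_u:
  assumes "S \<subseteq> D" "0 < a"
  shows "continuous_on S (\<lambda>x. logcut \<tau> a ((norm (u x - \<sigma>))\<^sup>2))"
proof -
  have "continuous_on UNIV (logcut \<tau> a)"
    using has_real_derivative_logcut[OF assms(2)] by (auto intro!: DERIV_continuous_on)
  then show ?thesis
    by (rule continuous_on_compose2) (auto intro!: continuous_intros cont_sub[OF assms(1)])
qed

lemma continuous_on_\<theta>: "S \<subseteq> D \<Longrightarrow> continuous_on S (\<theta> \<tau>)"
  unfolding \<theta>_def[abs_def] by (intro continuous_intros continuous_on_logcut_u well_scale)

text \<open>The majorant \<open>F\<close> is left open because the error from \<open>logcut'\<close>
  is estimated in three ways: by \<tau> times the energy, by the potential alone, and by a small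
  multiple of the localised energy itself.\<close>

lemma single_well_energy:
  assumes r: "0 \<le> r" "\<rho>2 \<le> r" and sub: "sq r \<subseteq> D" and b: "cutoff r \<rho>1 \<rho>2 L b b'"
    and \<tau>: "0 < \<tau>" and \<sigma>: "\<sigma> \<in> Z"
    and F: "continuous_on (sq r) F"
      "\<And>x. x \<in> sq r \<Longrightarrow> b (fst x) * b (snd x) * (2 * (\<bar>logcut' \<tau> (well_scale \<tau>) ((norm (u x - \<sigma>))\<^sup>2)\<bar> * (norm (u x - \<sigma>))\<^sup>2) * w x) \<le> F x"
  shows "c\<^sup>2 * integral (sq r) (\<lambda>x. b (fst x) * b (snd x) * logcut \<tau> (well_scale \<tau>) ((norm (u x - \<sigma>))\<^sup>2) * e x)
    \<le> integral (sq r) F + L / c * E r"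
proof -
  let ?g = "logcut \<tau> (well_scale \<tau>)" and ?g' = "logcut' \<tau> (well_scale \<tau>)"
  have gc: "continuous_on (sq r) (\<lambda>x. ?g' ((norm (u x - \<sigma>))\<^sup>2))"
    by (rule continuous_on_compose2[OF continuous_on_logcut']) (auto intro!: continuous_intros cont_sub[OF sub])
  have "c\<^sup>2 * integral (sq r) (\<lambda>x. b (fst x) * b (snd x) * ?g ((norm (u x - \<sigma>))\<^sup>2) * e x)
    \<le> integral (sq r) (\<lambda>x. b (fst x) * b (snd x) * (2 * \<bar>?g' ((norm (u x - \<sigma>))\<^sup>2)\<bar> * (norm (u x - \<sigma>))\<^sup>2 * w x)) + L / c * E r"
  proof (rule test_inequality[OF \<sigma> r sub b has_real_derivative_logcut[OF well_scale(1)] continuous_on_logcut'])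
    show "0 \<le> ?g q \<and> ?g q \<le> 1" for q using logcut_bounds \<tau> by simp
    show "?g q = 0" if "d\<^sup>2 \<le> q" for q
      by (rule logcut_eq_0(1)[OF \<tau> _ _ that]) (use d in \<open>auto simp: well_scale_def\<close>)
  qed
  also have "integral (sq r) (\<lambda>x. b (fst x) * b (snd x) * (2 * \<bar>?g' ((norm (u x - \<sigma>))\<^sup>2)\<bar> * (norm (u x - \<sigma>))\<^sup>2 * w x)) \<le> integral (sq r) F"
    using F(2) by (intro integral_sq_mono F(1) continuous_intros gc cont_sub[OF sub] cont_cutoff[OF b]) (simp add: mult.assoc)
  finally show ?thesis by simp
qed

lemma wells_energy:
  assumes r: "0 \<le> r" "\<rho>2 \<le> r" and sub: "sq r \<subseteq> D" and b: "cutoff r \<rho>1 \<rho>2 L b b'"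
    and \<tau>: "0 < \<tau>" and F: "continuous_on (sq r) F"
      "\<And>x \<sigma>. x \<in> sq r \<Longrightarrow> \<sigma> \<in> Z \<Longrightarrow> b (fst x) * b (snd x) * (2 * (\<bar>logcut' \<tau> (well_scale \<tau>) ((norm (u x - \<sigma>))\<^sup>2)\<bar> * (norm (u x - \<sigma>))\<^sup>2) * w x) \<le> F x"
  shows "c\<^sup>2 * integral (sq r) (\<lambda>x. b (fst x) * b (snd x) * \<theta> \<tau> x * e x) \<le> card Z * (integral (sq r) F + L / c * E r)"
proof -
  define h where "h \<sigma> x = b (fst x) * b (snd x) * logcut \<tau> (well_scale \<tau>) ((norm (u x - \<sigma>))\<^sup>2) * e x" for \<sigma> x
  have ch: "continuous_on (sq r) (h \<sigma>)" for \<sigma>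
    unfolding h_def[abs_def] by (intro continuous_intros continuous_on_logcut_u sub well_scale cont_sub[OF sub] cont_cutoff[OF b])
  have "integral (sq r) (\<lambda>x. b (fst x) * b (snd x) * \<theta> \<tau> x * e x) = integral (sq r) (\<lambda>x. \<Sum>\<sigma>\<in>Z. h \<sigma> x)"
    by (simp add: \<theta>_def h_def sum_distrib_left sum_distrib_right mult.assoc)
  also have "\<dots> = (\<Sum>\<sigma>\<in>Z. integral (sq r) (h \<sigma>))"
    using finite_Z by (intro integral_sum integrable_sq ch)
  finally have "c\<^sup>2 * integral (sq r) (\<lambda>x. b (fst x) * b (snd x) * \<theta> \<tau> x * e x) = (\<Sum>\<sigma>\<in>Z. c\<^sup>2 * integral (sq r) (h \<sigma>))"
    by (simp add: sum_distrib_left)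
  also have "\<dots> \<le> (\<Sum>\<sigma>\<in>Z. integral (sq r) F + L / c * E r)"
    unfolding h_def by (intro sum_mono single_well_energy[OF r sub b \<tau> _ F(1) F(2)])
  finally show ?thesis by simp
qed

lemma E_nonneg: "sq r \<subseteq> D \<Longrightarrow> 0 \<le> E r"
  unfolding E_def using cont_sub(8) by (intro integral_nonneg integrable_sq) (auto simp: e_nonneg)

lemma E_mono:
  assumes "r \<le> r'" "sq r' \<subseteq> D"
  shows "E r \<le> E r'"
  unfolding E_def using assms sq_mono[OF assms(1)] cont_sub(8)
  by (intro integral_subset_le integrable_sq) (auto simp: e_nonneg)

end

subsection \<open>Decay of the energy\<close>

text \<open>The coefficient of the potential energy in \<open>energy_by_potential\<close>. Only the
  scale for \<tau> = 1/2 and the level \<delta>0 occur, so it is fixed before the small \<tau> is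
  chosen.\<close>

definition (in potential) decay_const1 :: "real \<Rightarrow> real" where
  "decay_const1 \<delta>0 = 4 / c\<^sup>2 * card Z * (2 * G (1/64) / (well_scale (1/2) * c)) + (G (1/64) / (2 * \<delta>0) + 1)"

definition (in potential) decay_const2 :: real where
  "decay_const2 = 16 / c^3 * card Z"

text \<open>The value c \<delta> / 32 meets both smallness conditions of
  \<open>potential_small_on_frame\<close> on every square with m \<ge> 1/32. With the 12 of
  \<open>good_cutoff\<close> it produces the threshold c \<delta> / 384.\<close>

lemma (in potential) line_threshold:
  assumes m: "1/32 \<le> m" and \<delta>: "0 < \<delta>"
  shows "0 < c * \<delta> / 32" "c * \<delta> / 32 \<le> c * \<delta> / 8" "c * \<delta> / 32 \<le> \<delta> * (4 * m)"
proof -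
  have "c * \<delta> / 32 \<le> 1 * \<delta> / 32" using c \<delta> by (intro divide_right_mono mult_right_mono) auto
  also have "\<dots> \<le> \<delta> * (4 * m)" using m \<delta> by (simp add: field_simps)
  finally show "c * \<delta> / 32 \<le> \<delta> * (4 * m)" .
qed (use c \<delta> in auto)

context planar
begin

lemma good_boundary:
  assumes m: "1/32 \<le> m" and sub: "sq (4*m) \<subseteq> D" and \<tau>: "0 < \<tau>" "well_level \<tau> \<delta>"
    and E: "E (4*m) \<le> c * \<delta> / 384 * m"
  obtains b b' where "cutoff (4*m) (2*m) (3*m) (3 / m) b b'"
    "\<And>s y t. \<bar>s\<bar> \<le> 4*m \<Longrightarrow> b' s \<noteq> 0 \<Longrightarrow> \<bar>y\<bar> = \<bar>s\<bar> \<Longrightarrow> \<bar>t\<bar> \<le> 4*m \<Longrightarrow> V (u (y,t)) < \<delta> \<and> V (u (t,y)) < \<delta>"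
proof -
  define \<kappa> where "\<kappa> = c * \<delta> / 32"
  have \<delta>: "0 < \<delta>" using \<tau> by (simp add: well_level_def)
  note \<kappa> = line_threshold(1,2)[OF m \<delta>, folded \<kappa>_def] and \<kappa>2 = line_threshold(3)[OF m \<delta>, folded \<kappa>_def]
  have m0: "0 < m" "0 < 4 * m" using m by auto
  have E': "E (4*m) \<le> \<kappa> / 12 * m" using E by (simp add: \<kappa>_def)
  obtain b b' where b: "cutoff (4*m) (2*m) (3*m) (3 / m) b b'"
    "\<And>s. \<bar>s\<bar> \<le> 4*m \<Longrightarrow> b' s \<noteq> 0 \<Longrightarrow> frame_energy (4*m) \<bar>s\<bar> < \<kappa>"
    using good_cutoff[OF m0(1) sub \<kappa>(1) E'] by blast
  have "V (u (y,t)) < \<delta> \<and> V (u (t,y)) < \<delta>" if s: "\<bar>s\<bar> \<le> 4*m" "b' s \<noteq> 0" "\<bar>y\<bar> = \<bar>s\<bar>" "\<bar>t\<bar> \<le> 4*m" for s y t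
    using potential_small_on_frame[OF m0(2) sub \<delta> well_level_near[OF \<tau>(2,1)] \<kappa>(2) \<kappa>2, of "\<bar>s\<bar>" t y] b(2)[OF s(1,2)] s
    by simp
  then show ?thesis using b(1) by (intro that) auto
qed

text \<open>On the boundary of a good square, with half side between 2 m and 3 m, \<open>u\<close>
  is within \<open>d\<close> of a well and hence in the ball of radius \<open>M\<close>. The maximum
  principle carries this inside.\<close>

lemma interior_sup_bound:
  assumes m: "1/32 \<le> m" and sub: "sq (4*m) \<subseteq> D" and \<tau>: "0 < \<tau>" "well_level \<tau> \<delta>"
    and E: "E (4*m) \<le> c * \<delta> / 384 * m" and x: "x \<in> sq (2*m)"
  shows "norm (u x) \<le> M"
proof -
  define \<kappa> where "\<kappa> = c * \<delta> / 32"
  have \<delta>: "0 < \<delta>" using \<tau> by (simp add: well_level_def)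
  note \<kappa> = line_threshold(1,2)[OF m \<delta>, folded \<kappa>_def] and \<kappa>2 = line_threshold(3)[OF m \<delta>, folded \<kappa>_def]
  have m0: "0 < m" "0 < 4 * m" using m by auto
  have E': "E (4*m) \<le> \<kappa> / 12 * m" using E by (simp add: \<kappa>_def)
  obtain z where z: "2 * m \<le> z" "z \<le> 3 * m" "frame_energy (4*m) z < \<kappa>"
    using good_frame[OF m0(1) sub \<kappa>(1) E'] by blast
  have z4: "\<bar>z\<bar> \<le> 4 * m" "\<bar>z\<bar> = z" using z m0 by auto
  have sz: "sq z \<subseteq> D" using sub sq_mono[of z "4*m"] z m0 by auto
  show ?thesis
  proof (rule maximum_principle[OF sz])
    show "x \<in> sq z" using x sq_mono[of "2*m" z] z by blast
    fix s t assume st: "(s,t) \<in> sq z" "\<bar>s\<bar> = z \<or> \<bar>t\<bar> = z"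
    then have st4: "\<bar>s\<bar> \<le> 4*m" "\<bar>t\<bar> \<le> 4*m" using z m0 by (auto simp: mem_sq)
    have "V (u (s,t)) < \<delta>"
      using st(2)
    proof
      assume "\<bar>s\<bar> = z"
      then show ?thesis using z4
        by (intro potential_small_on_frame(1)[OF m0(2) sub \<delta> well_level_near[OF \<tau>(2,1)] \<kappa>(2) \<kappa>2 z4(1) z(3) st4(2)]) auto
    next
      assume "\<bar>t\<bar> = z"
      then show ?thesis using z4
        by (intro potential_small_on_frame(2)[OF m0(2) sub \<delta> well_level_near[OF \<tau>(2,1)] \<kappa>(2) \<kappa>2 z4(1) z(3) st4(1)]) auto
    qed
    then obtain \<sigma> where "\<sigma> \<in> Z" "norm (u (s,t) - \<sigma>) \<le> d" using well_level_near[OF \<tau>(2,1)] by blast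
    then show "norm (u (s,t)) \<le> M" by (rule M(2))
  qed
qed

text \<open>The gap between \<open>sq (3*m/2)\<close> and \<open>sq (2*m)\<close> is m / 2 \<ge>
  1/64, so Bernstein's estimate can use one radius at all scales.\<close>

lemma interior_gradient_bound:
  assumes m: "1/32 \<le> m" and sub: "sq (4*m) \<subseteq> D" and \<tau>: "0 < \<tau>" "well_level \<tau> \<delta>"
    and E: "E (4*m) \<le> c * \<delta> / 384 * m" and x: "x \<in> sq (3*m/2)"
  shows "w x \<le> G (1/64)"
proof (rule gradient_bound)
  have s: "cball x (1/64) \<subseteq> sq (2*m)"
  proof
    fix y assume "y \<in> cball x (1/64)"
    then have "dist x y \<le> 1/64" by simp
    then have "dist (fst x) (fst y) \<le> 1/64" "dist (snd x) (snd y) \<le> 1/64"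
      using dist_fst_le[of x y] dist_snd_le[of x y] by linarith+
    moreover have "\<bar>fst x\<bar> \<le> 3*m/2" "\<bar>snd x\<bar> \<le> 3*m/2" using x by (cases x; simp add: mem_sq)+
    ultimately have "\<bar>fst y\<bar> \<le> 2*m" "\<bar>snd y\<bar> \<le> 2*m" using m unfolding dist_real_def by linarith+
    then show "y \<in> sq (2*m)" by (cases y) (simp add: mem_sq)
  qed
  then show "cball x (1/64) \<subseteq> D" using sub sq_mono[of "2*m" "4*m"] m by auto
  show "norm (u y) \<le> M" if "y \<in> cball x (1/64)" for y
    by (rule interior_sup_bound[OF m sub \<tau> E]) (use s that in blast)
qed simp

text \<open>The right side of the Pohozaev inequality lives where the cutoff varies, that is on good
  lines, where V < \<delta> and thus 1 \<le> 4 \<theta>. It is dominated by the energy near the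
  wells, which the test makes small.\<close>

lemma potential_energy_bound:
  assumes m: "1/32 \<le> m" and sub: "sq (4*m) \<subseteq> D" and \<tau>: "0 < \<tau>" "well_level \<tau> \<delta>" "\<tau> \<le> 1/2"
    and E: "E (4*m) \<le> c * \<delta> / 384 * m"
  obtains b b' where "cutoff (4*m) (2*m) (3*m) (3 / m) b b'"
    "integral (sq (4*m)) (\<lambda>x. b (fst x) * b (snd x) * V (u x))
       \<le> 96 * (card Z * (16 * \<tau> + 2 / (m * c))) / c\<^sup>2 * E (4*m)"
proof -
  have m0: "0 < m" "0 \<le> 4 * m" "3 * m \<le> 4 * m" using m by auto
  obtain b b' where b: "cutoff (4*m) (2*m) (3*m) (3 / m) b b'"
    and bV: "\<And>s y t. \<bar>s\<bar> \<le> 4*m \<Longrightarrow> b' s \<noteq> 0 \<Longrightarrow> \<bar>y\<bar> = \<bar>s\<bar> \<Longrightarrow> \<bar>t\<bar> \<le> 4*m \<Longrightarrow> V (u (y,t)) < \<delta> \<and> V (u (t,y)) < \<delta>"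
    using good_boundary[OF m sub \<tau>(1,2) E] by blast
  \<comment> \<open>The test uses a second cutoff, equal to 1 on \<open>sq (3*m)\<close>, outside
    which the first one vanishes.\<close>
  obtain B B' where "cutoff (4*m) (3*m) (4*m) (2 / (4*m - 3*m)) B B'"
    using cutoff_exists[of "3*m" "4*m" "4*m"] m0 by auto
  then have B: "cutoff (4*m) (3*m) (4*m) (2 / m) B B'" by (simp add: algebra_simps)
  have "c\<^sup>2 * integral (sq (4*m)) (\<lambda>x. B (fst x) * B (snd x) * \<theta> \<tau> x * e x)
      \<le> card Z * (integral (sq (4*m)) (\<lambda>x. 16 * \<tau> * e x) + (2 / m) / c * E (4*m))"
  proof (rule wells_energy[OF m0(2) order_refl sub B \<tau>(1)])
    show "continuous_on (sq (4*m)) (\<lambda>x. 16 * \<tau> * e x)" by (intro continuous_intros cont_sub[OF sub])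
    fix x \<sigma> assume x: "x \<in> sq (4*m)"
    obtain s t where st: "x = (s,t)" "\<bar>s\<bar> \<le> 4*m" "\<bar>t\<bar> \<le> 4*m" using x by (cases x) (auto simp: mem_sq)
    let ?Q = "\<bar>logcut' \<tau> (well_scale \<tau>) ((norm (u x - \<sigma>))\<^sup>2)\<bar> * (norm (u x - \<sigma>))\<^sup>2"
    have Q: "?Q \<le> 4 * \<tau>" by (rule logcut'_bound_1) (use \<tau> well_scale in auto)
    have BB: "0 \<le> B s * B t" "B s * B t \<le> 1" using cutoffD[OF B st(2)] cutoffD[OF B st(3)] by (auto intro: mult_le_one)
    have "2 * ?Q \<le> 2 * (4 * \<tau>)" by (rule mult_left_mono[OF Q]) simp
    moreover have "w x \<le> 2 * e x" using V_nonneg by (simp add: e_def)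
    ultimately have "2 * ?Q * w x \<le> 2 * (4 * \<tau>) * (2 * e x)"
      using w_nonneg \<tau> by (intro mult_mono[of "2 * ?Q"]) auto
    then have Qw: "2 * ?Q * w x \<le> 16 * \<tau> * e x" by simp
    have "B s * B t * (2 * ?Q * w x) \<le> 1 * (16 * \<tau> * e x)"
      by (rule mult_mono[OF BB(2) Qw]) (use w_nonneg in auto)
    then show "B (fst x) * B (snd x) * (2 * ?Q * w x) \<le> 16 * \<tau> * e x" by (simp add: st(1))
  qed
  also have "\<dots> = card Z * (16 * \<tau> + 2 / (m * c)) * E (4*m)" using m0 c by (simp add: E_def field_simps)
  finally have "integral (sq (4*m)) (\<lambda>x. B (fst x) * B (snd x) * \<theta> \<tau> x * e x)
      \<le> card Z * (16 * \<tau> + 2 / (m * c)) * E (4*m) / c\<^sup>2"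
    using c by (simp add: field_simps)
  moreover have "integral (sq (4*m)) (\<lambda>x. 2 * (b (fst x) * b (snd x) * V (u x)))
     \<le> integral (sq (4*m)) (\<lambda>x. 2 * (4*m) * (\<bar>b' (fst x)\<bar> * b (snd x) + b (fst x) * \<bar>b' (snd x)\<bar>) * e x)"
    by (rule pohozaev_inequality[OF m0(2,3) sub b])
  moreover have "\<dots> \<le> integral (sq (4*m)) (\<lambda>x. 192 * (B (fst x) * B (snd x) * \<theta> \<tau> x * e x))"
  proof (intro integral_sq_mono continuous_intros cont_sub[OF sub] cont_cutoff[OF b] cont_cutoff[OF B] continuous_on_\<theta>[OF sub])
    fix x assume x: "x \<in> sq (4*m)"
    obtain s t where st: "x = (s,t)" "\<bar>s\<bar> \<le> 4*m" "\<bar>t\<bar> \<le> 4*m" using x by (cases x) (auto simp: mem_sq)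
    note bs = cutoffD[OF b st(2)] and bt = cutoffD[OF b st(3)]
    note Bs = cutoffD[OF B st(2)] and Bt = cutoffD[OF B st(3)]
    define k where "k = \<bar>b' s\<bar> * b t + b s * \<bar>b' t\<bar>"
    have "\<bar>b' s\<bar> * b t \<le> 3 / m * 1" "b s * \<bar>b' t\<bar> \<le> 1 * (3 / m)"
      using bs bt m0 by (intro mult_mono; simp)+
    then have k: "k \<le> 6 / m" by (simp add: k_def)
    have "2 * (4*m) * k * e x \<le> 192 * (B s * B t * \<theta> \<tau> x * e x)"
    proof (cases "k = 0")
      case True
      then show ?thesis using Bs Bt \<theta>_nonneg e_nonneg by simp
    next
      case False
      then have "b' s \<noteq> 0 \<and> b t \<noteq> 0 \<or> b' t \<noteq> 0 \<and> b s \<noteq> 0" unfolding k_def by auto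
      then consider "b' s \<noteq> 0" "b t \<noteq> 0" | "b' t \<noteq> 0" "b s \<noteq> 0" by blast
      then have "V (u x) < \<delta> \<and> \<bar>s\<bar> \<le> 3*m \<and> \<bar>t\<bar> \<le> 3*m"
      proof cases
        case 1
        then show ?thesis using bV[of s s t] bs(8) bt(6) st by force
      next
        case 2
        then show ?thesis using bV[of t t s] bt(8) bs(6) st by force
      qed
      then have "B s = 1" "B t = 1" and \<theta>: "1 \<le> 4 * \<theta> \<tau> x"
        using Bs(5) Bt(5) \<theta>_ge[OF \<tau>(2,1,3)] by auto
      \<comment> \<open>A slope 3 / m in each of two directions against the factor 2 (4 m) gives 48,
        a number free of m; the bound 1 \<le> 4 \<theta> makes it 192 \<theta>.\<close>
      have "2 * (4*m) * k \<le> 2 * (4*m) * (6 / m)" using k m0 by (intro mult_left_mono) auto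
      also have "\<dots> = 48 * 1" using m0 by simp
      also have "\<dots> \<le> 48 * (4 * \<theta> \<tau> x)" using \<theta> by simp
      finally have "2 * (4*m) * k * e x \<le> 48 * (4 * \<theta> \<tau> x) * e x" using e_nonneg by (intro mult_right_mono) auto
      then show ?thesis using \<open>B s = 1\<close> \<open>B t = 1\<close> by simp
    qed
    then show "2 * (4*m) * (\<bar>b' (fst x)\<bar> * b (snd x) + b (fst x) * \<bar>b' (snd x)\<bar>) * e x \<le> 192 * (B (fst x) * B (snd x) * \<theta> \<tau> x * e x)"
      by (simp add: st(1) k_def)
  qed
  ultimately have "2 * integral (sq (4*m)) (\<lambda>x. b (fst x) * b (snd x) * V (u x))
      \<le> 192 * (card Z * (16 * \<tau> + 2 / (m * c)) * E (4*m) / c\<^sup>2)"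
    unfolding integral_mult_right by linarith
  moreover have "96 * (card Z * (16 * \<tau> + 2 / (m * c))) / c\<^sup>2 * E (4*m)
      = 96 * (card Z * (16 * \<tau> + 2 / (m * c)) * E (4*m) / c\<^sup>2)" by simp
  ultimately show ?thesis by (intro that[OF b]) linarith
qed

text \<open>Where V \<ge> \<delta>0, the bounded gradient is dominated by a multiple of V. Where V <
  \<delta>0, the test with \<tau> = 1/2 applies, and its error is again a multiple of V: q |g'(q)|
  \<le> q / a and q \<le> V / c, while |\<nabla>u|^2 is bounded.\<close>

lemma energy_by_potential:
  assumes m: "1/32 \<le> m" and sub: "sq (4*m) \<subseteq> D" and b: "cutoff (4*m) (2*m) (3*m) L b b'"
    and w: "\<And>x. x \<in> sq (3*m/2) \<Longrightarrow> w x \<le> G (1/64)" and \<delta>0: "well_level (1/2) \<delta>0"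
  shows "E m \<le> decay_const1 \<delta>0 * integral (sq (4*m)) (\<lambda>x. b (fst x) * b (snd x) * V (u x)) + decay_const2 / m * E (4*m)"
proof -
  define \<Gamma> where "\<Gamma> = G (1/64)"
  define a where "a = well_scale (1/2)"
  have a: "0 < a" using well_scale by (simp add: a_def)
  have \<delta>: "0 < \<delta>0" using \<delta>0 by (simp add: well_level_def)
  have m0: "0 < m" "0 \<le> 4 * m" "3 * m / 2 \<le> 4 * m" using m by auto
  have \<Gamma>: "0 \<le> \<Gamma>" using w[of "(0,0)"] w_nonneg[of "(0,0)"] m0 by (simp add: \<Gamma>_def mem_sq)
  obtain B B' where "cutoff (4*m) m (3*m/2) (2 / (3*m/2 - m)) B B'"
    using cutoff_exists[of m "3*m/2" "4*m"] m0 by auto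
  moreover have "2 / (3*m/2 - m) = 4 / m" using m0 by (simp add: field_simps)
  ultimately have B: "cutoff (4*m) m (3*m/2) (4 / m) B B'" by simp
  \<comment> \<open>The potential keeps the wider cutoff \<open>b\<close>, which comes with the
    Pohozaev bound; it equals 1 wherever \<open>B\<close> is nonzero.\<close>
  define P where "P x = b (fst x) * b (snd x) * V (u x)" for x
  define K where "K = 2 * \<Gamma> / (a * c)"
  have cP: "continuous_on (sq (4*m)) P"
    unfolding P_def[abs_def] by (intro continuous_intros cont_sub[OF sub] cont_cutoff[OF b])
  have K: "0 \<le> K" using \<Gamma> a c by (simp add: K_def)
  have supp: "B s * B t = 0 \<or> (s,t) \<in> sq (3*m/2) \<and> P (s,t) = V (u (s,t))"
    and BB: "0 \<le> B s * B t" "B s * B t \<le> 1" and P0: "0 \<le> P (s,t)" if st: "\<bar>s\<bar> \<le> 4*m" "\<bar>t\<bar> \<le> 4*m" for s t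
  proof -
    note Bs = cutoffD[OF B st(1)] and Bt = cutoffD[OF B st(2)]
    note bs = cutoffD[OF b st(1)] and bt = cutoffD[OF b st(2)]
    show "0 \<le> B s * B t" "B s * B t \<le> 1" using Bs Bt by (auto intro: mult_le_one)
    show "0 \<le> P (s,t)" using bs bt V_nonneg by (simp add: P_def)
    show "B s * B t = 0 \<or> (s,t) \<in> sq (3*m/2) \<and> P (s,t) = V (u (s,t))"
    proof (cases "3*m/2 \<le> \<bar>s\<bar> \<or> 3*m/2 \<le> \<bar>t\<bar>")
      case True
      then show ?thesis using Bs(6) Bt(6) by auto
    next
      case False
      then have "\<bar>s\<bar> \<le> 2*m" "\<bar>t\<bar> \<le> 2*m" using m0 by auto
      then have "b s = 1" "b t = 1" using bs(5) bt(5) by auto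
      then show ?thesis using False by (auto simp: P_def mem_sq)
    qed
  qed
  have "c\<^sup>2 * integral (sq (4*m)) (\<lambda>x. B (fst x) * B (snd x) * \<theta> (1/2) x * e x)
      \<le> card Z * (integral (sq (4*m)) (\<lambda>x. K * P x) + (4 / m) / c * E (4*m))"
  proof (rule wells_energy[OF m0(2,3) sub B])
    show "continuous_on (sq (4*m)) (\<lambda>x. K * P x)" by (intro continuous_intros cP)
    fix x \<sigma> assume x: "x \<in> sq (4*m)" and \<sigma>: "\<sigma> \<in> Z"
    obtain s t where st: "x = (s,t)" "\<bar>s\<bar> \<le> 4*m" "\<bar>t\<bar> \<le> 4*m" using x by (cases x) (auto simp: mem_sq)
    define q where "q = (norm (u x - \<sigma>))\<^sup>2"
    have q0: "0 \<le> q" by (simp add: q_def)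
    have "B s * B t * (2 * (\<bar>logcut' (1/2) a q\<bar> * q) * w x) \<le> K * P x"
    proof (cases "B s * B t = 0 \<or> d\<^sup>2 \<le> q")
      case True
      then have "B s * B t = 0 \<or> logcut' (1/2) a q = 0"
        using logcut_eq_0(2)[of "1/2" "d\<^sup>2" a q] d by (auto simp: a_def well_scale_def)
      then have z: "B s * B t * (2 * (\<bar>logcut' (1/2) a q\<bar> * q) * w x) = 0" by auto
      show ?thesis using mult_nonneg_nonneg[OF K P0[OF st(2,3)]] unfolding z st(1)[symmetric] .
    next
      case False
      then have s: "x \<in> sq (3*m/2)" "P x = V (u x)" using supp[OF st(2,3)] by (auto simp: st(1))
      have "(norm (u x - \<sigma>))\<^sup>2 \<le> d\<^sup>2" using False by (simp add: q_def)
      from power2_le_imp_le[OF this] have "norm (u x - \<sigma>) \<le> d" using d by simp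
      then have "c * q \<le> V (u x)" unfolding q_def using well(2)[OF \<sigma>] by blast
      then have "q \<le> V (u x) / c" using c by (simp add: field_simps)
      then have "2 * (1/2) * (q / a) \<le> V (u x) / c / a" using divide_right_mono[of q "V (u x) / c" a] a by simp
      then have "\<bar>logcut' (1/2) a q\<bar> * q \<le> V (u x) / c / a"
        using logcut'_bound_linear[of "1/2" a q] a q0 by linarith
      then have "2 * (\<bar>logcut' (1/2) a q\<bar> * q) * w x \<le> 2 * (V (u x) / c / a) * \<Gamma>"
        using w[OF s(1)] q0 w_nonneg V_nonneg c a by (intro mult_mono) (auto simp: \<Gamma>_def)
      from mult_mono[OF BB(2)[OF st(2,3)] this]
      have "B s * B t * (2 * (\<bar>logcut' (1/2) a q\<bar> * q) * w x) \<le> 1 * (2 * (V (u x) / c / a) * \<Gamma>)"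
        using q0 w_nonneg by simp
      then show ?thesis by (simp add: s(2) K_def mult_ac)
    qed
    then show "B (fst x) * B (snd x) * (2 * (\<bar>logcut' (1/2) (well_scale (1/2)) ((norm (u x - \<sigma>))\<^sup>2)\<bar> * (norm (u x - \<sigma>))\<^sup>2) * w x) \<le> K * P x"
      by (simp add: q_def a_def st(1))
  qed simp
  then have 1: "integral (sq (4*m)) (\<lambda>x. B (fst x) * B (snd x) * \<theta> (1/2) x * e x)
      \<le> (card Z * (K * integral (sq (4*m)) P + (4 / m) / c * E (4*m))) / c\<^sup>2"
    using c by (simp add: field_simps)
  define k where "k = \<Gamma> / (2 * \<delta>0) + 1"
  have k: "1 \<le> k" using \<Gamma> \<delta> by (simp add: k_def)
  have ce: "continuous_on (sq (4*m)) e" using cont_sub[OF sub] by simp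
  note ct = continuous_on_\<theta>[OF sub]
  have "E m \<le> integral (sq (4*m)) (\<lambda>x. B (fst x) * B (snd x) * e x)"
  proof -
    have "E m = integral (sq m) (\<lambda>x. B (fst x) * B (snd x) * e x)"
      unfolding E_def
    proof (rule integral_cong)
      fix x assume "x \<in> sq m"
      then have "\<bar>fst x\<bar> \<le> m" "\<bar>snd x\<bar> \<le> m" by (cases x; simp add: mem_sq)+
      then have "B (fst x) = 1" "B (snd x) = 1" using cutoffD(5)[OF B] m0 by auto
      then show "e x = B (fst x) * B (snd x) * e x" by simp
    qed
    also have "\<dots> \<le> integral (sq (4*m)) (\<lambda>x. B (fst x) * B (snd x) * e x)"
    proof -
      have sm: "sq m \<subseteq> sq (4*m)" using m0 by (intro sq_mono) auto
      have cc: "continuous_on (sq (4*m)) (\<lambda>x. B (fst x) * B (snd x) * e x)"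
        by (intro continuous_intros ce cont_cutoff[OF B])
      have "0 \<le> B (fst x) * B (snd x) * e x" if "x \<in> sq (4*m)" for x
        using that BB[of "fst x" "snd x"] e_nonneg[of x] by (cases x) (auto simp: mem_sq)
      then show ?thesis
        by (intro integral_subset_le sm integrable_sq cc continuous_on_subset[OF cc sm] ballI)
    qed
    finally show ?thesis .
  qed
  also have "\<dots> \<le> integral (sq (4*m)) (\<lambda>x. 4 * (B (fst x) * B (snd x) * \<theta> (1/2) x * e x) + k * P x)"
  proof (intro integral_sq_mono continuous_intros ce ct cP cont_cutoff[OF B])
    fix x assume x: "x \<in> sq (4*m)"
    obtain s t where st: "x = (s,t)" "\<bar>s\<bar> \<le> 4*m" "\<bar>t\<bar> \<le> 4*m" using x by (cases x) (auto simp: mem_sq)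
    have kP: "0 \<le> k * P x" using k P0[OF st(2,3)] st(1) by simp
    have "B s * B t * e x \<le> 4 * (B s * B t * \<theta> (1/2) x * e x) + k * P x"
    proof (cases "V (u x) < \<delta>0")
      case True
      then have "1 \<le> 4 * \<theta> (1/2) x" by (intro \<theta>_ge[OF \<delta>0]) auto
      then have "B s * B t * e x * 1 \<le> B s * B t * e x * (4 * \<theta> (1/2) x)"
        using BB[OF st(2,3)] e_nonneg by (intro mult_left_mono) auto
      then show ?thesis using kP by (simp add: mult_ac)
    next
      case False
      have "B s * B t * e x \<le> k * P x"
      proof (cases "B s * B t = 0")
        case True
        then show ?thesis using kP by auto
      next
        case nz: False
        then have s: "x \<in> sq (3*m/2)" "P x = V (u x)" using supp[OF st(2,3)] by (auto simp: st(1))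
        have "\<Gamma> / (2 * \<delta>0) * \<delta>0 \<le> \<Gamma> / (2 * \<delta>0) * V (u x)" using False \<Gamma> \<delta> by (intro mult_left_mono) auto
        then have "\<Gamma> / 2 \<le> \<Gamma> / (2 * \<delta>0) * V (u x)" using \<delta> by simp
        then have "e x \<le> k * P x" using w[OF s(1)] unfolding s(2) k_def distrib_right e_def \<Gamma>_def by linarith
        moreover have "B s * B t * e x \<le> 1 * e x" using BB[OF st(2,3)] e_nonneg by (intro mult_right_mono) auto
        ultimately show ?thesis by linarith
      qed
      moreover have "0 \<le> B s * B t * \<theta> (1/2) x * e x" using BB[OF st(2,3)] \<theta>_nonneg e_nonneg by simp
      ultimately show ?thesis by linarith
    qed
    then show "B (fst x) * B (snd x) * e x \<le> 4 * (B (fst x) * B (snd x) * \<theta> (1/2) x * e x) + k * P x"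
      by (simp add: st(1))
  qed
  also have "\<dots> = 4 * integral (sq (4*m)) (\<lambda>x. B (fst x) * B (snd x) * \<theta> (1/2) x * e x) + k * integral (sq (4*m)) P"
  proof -
    have "(\<lambda>x. 4 * (B (fst x) * B (snd x) * \<theta> (1/2) x * e x)) integrable_on sq (4*m)" "(\<lambda>x. k * P x) integrable_on sq (4*m)"
      by (intro integrable_sq continuous_intros ce ct cP cont_cutoff[OF B])+
    then show ?thesis by (simp add: integral_add del: integral_mult_right) (simp only: integral_mult_right)
  qed
  also have "\<dots> \<le> 4 * ((card Z * (K * integral (sq (4*m)) P + (4 / m) / c * E (4*m))) / c\<^sup>2) + k * integral (sq (4*m)) P"
    using 1 by simp
  also have "\<dots> = decay_const1 \<delta>0 * integral (sq (4*m)) P + decay_const2 / m * E (4*m)"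
    using c m0 a by (simp add: decay_const1_def decay_const2_def K_def k_def \<Gamma>_def a_def power2_eq_square power3_eq_cube field_simps)
  finally show ?thesis by (simp add: P_def[abs_def])
qed

lemma energy_decay:
  assumes m: "1/32 \<le> m" and sub: "sq (4*m) \<subseteq> D" and \<tau>: "0 < \<tau>" "well_level \<tau> \<delta>" "\<tau> \<le> 1/2"
    and E: "E (4*m) \<le> c * \<delta> / 384 * m" and \<delta>0: "well_level (1/2) \<delta>0"
  shows "E m \<le> (decay_const1 \<delta>0 * (96 * (card Z * (16 * \<tau> + 2 / (m * c))) / c\<^sup>2) + decay_const2 / m) * E (4*m)"
proof -
  obtain b b' where b: "cutoff (4*m) (2*m) (3*m) (3 / m) b b'"
    "integral (sq (4*m)) (\<lambda>x. b (fst x) * b (snd x) * V (u x))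
       \<le> 96 * (card Z * (16 * \<tau> + 2 / (m * c))) / c\<^sup>2 * E (4*m)"
    using potential_energy_bound[OF m sub \<tau> E] by blast
  have wG: "w x \<le> G (1/64)" if "x \<in> sq (3*m/2)" for x
    by (rule interior_gradient_bound[OF m sub \<tau>(1,2) E that])
  have "0 \<le> G (1/64)" using wG[of "(0,0)"] w_nonneg[of "(0,0)"] m by (simp add: mem_sq)
  then have "0 \<le> decay_const1 \<delta>0" using c well_scale[of "1/2"] \<delta>0 by (simp add: decay_const1_def well_level_def)
  from mult_left_mono[OF b(2) this] energy_by_potential[OF m sub b(1) wG \<delta>0]
  show ?thesis by (simp add: algebra_simps)
qed

end

section \<open>Choice of parameters and iteration over scales\<close>

context potential
begin

text \<open>The order matters: \<delta>0 fixes \<open>decay_const1\<close>, then \<tau> makes the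
  term linear in \<tau> at most 1/8, and finally m1 makes the terms of order 1/m at most
  1/8.\<close>

lemma decay_parameters:
  obtains \<tau> \<delta> \<delta>0 m1 where "0 < \<tau>" "\<tau> \<le> 1/2" "well_level \<tau> \<delta>" "well_level (1/2) \<delta>0" "1 \<le> m1"
    "\<And>m. m1 \<le> m \<Longrightarrow> decay_const1 \<delta>0 * (96 * (card Z * (16 * \<tau> + 2 / (m * c))) / c\<^sup>2) + decay_const2 / m \<le> 1/4"
proof -
  obtain \<delta>0 where \<delta>0: "well_level (1/2) \<delta>0" using well_level_exists by blast
  define A where "A = decay_const1 \<delta>0 * (96 * card Z * 16 / c\<^sup>2)"
  define B where "B = decay_const1 \<delta>0 * (96 * card Z * 2 / c ^ 3) + decay_const2"
  define \<tau> where "\<tau> = min (1/2) (1 / (8 * (\<bar>A\<bar> + 1)))"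
  define m1 where "m1 = max 1 (8 * (\<bar>B\<bar> + 1))"
  obtain \<delta> where \<delta>: "well_level \<tau> \<delta>" using well_level_exists by blast
  have \<tau>: "0 < \<tau>" "\<tau> \<le> 1/2" by (auto simp: \<tau>_def)
  have "A * \<tau> \<le> (\<bar>A\<bar> + 1) * (1 / (8 * (\<bar>A\<bar> + 1)))"
    using \<tau> by (intro mult_mono) (auto simp: \<tau>_def)
  also have "\<dots> = 1/8" by (simp add: field_simps)
  finally have A: "A * \<tau> \<le> 1/8" .
  have "decay_const1 \<delta>0 * (96 * (card Z * (16 * \<tau> + 2 / (m * c))) / c\<^sup>2) + decay_const2 / m \<le> 1/4" if m: "m1 \<le> m" for m
  proof -
    have m0: "0 < m" using m by (simp add: m1_def)
    have "B \<le> \<bar>B\<bar> + 1" by simp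
    also have "\<dots> \<le> m / 8" using m by (simp add: m1_def)
    finally have "B / m \<le> 1/8" using m0 by (simp add: field_simps)
    moreover have "decay_const1 \<delta>0 * (96 * (card Z * (16 * \<tau> + 2 / (m * c))) / c\<^sup>2) + decay_const2 / m = A * \<tau> + B / m"
      using m0 c by (simp add: A_def B_def power2_eq_square power3_eq_cube field_simps)
    ultimately show ?thesis using A by simp
  qed
  then show ?thesis using \<tau> \<delta> \<delta>0 by (intro that[of \<tau> \<delta> \<delta>0 m1]) (auto simp: m1_def)
qed

end

context planar
begin

lemma energy_iteration:
  assumes m1: "1 \<le> m1" and \<eta>: "0 \<le> \<eta>"
    and decay: "\<And>m. m1 \<le> m \<Longrightarrow> sq (4*m) \<subseteq> D \<Longrightarrow> E (4*m) \<le> \<eta> * m \<Longrightarrow> E m \<le> 1/4 * E (4*m)"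
    and m: "1/32 \<le> m" and sub: "sq (4*m) \<subseteq> D" and E: "E (4*m) \<le> \<eta> * m"
  shows "E (1/8) \<le> \<eta> * m1"
proof -
  have "E (1/8) \<le> \<eta> * m1" if "m \<le> m1 * 4 ^ n" for n
    using that m sub E
  proof (induction n arbitrary: m)
    case 0
    have "E (1/8) \<le> E (4*m)" using 0 by (intro E_mono) auto
    also have "\<dots> \<le> \<eta> * m1" using 0 mult_left_mono[of m m1 \<eta>] \<eta> by simp
    finally show ?case .
  next
    case (Suc n)
    show ?case
    proof (cases "m1 \<le> m")
      case True
      have s: "sq m \<subseteq> sq (4*m)" using Suc.prems by (intro sq_mono) auto
      have "E m \<le> 1/4 * E (4*m)" by (rule decay[OF True Suc.prems(3,4)])
      then have "E (4 * (m/4)) \<le> \<eta> * (m/4)" using Suc.prems by simp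
      then show ?thesis using Suc.prems True m1 s by (intro Suc.IH[of "m/4"]) auto
    next
      case False
      have "E (1/8) \<le> E (4*m)" using Suc.prems by (intro E_mono) auto
      also have "\<dots> \<le> \<eta> * m1" using Suc.prems False mult_left_mono[of m m1 \<eta>] \<eta> by simp
      finally show ?thesis .
    qed
  qed
  moreover obtain n where "m < 4 ^ n" using real_arch_pow[of 4 m] by auto
  moreover have "4 ^ n \<le> m1 * 4 ^ n" using m1 by simp
  ultimately show ?thesis by (meson less_imp_le order_trans)
qed

text \<open>At unit scale V(u) is Lipschitz along coordinate lines with constant N sqrt(G), so on a
  square of half side \<rho> it stays above its central value minus the second summand. Comparison
  with the energy over the area 4 \<rho>^2 gives the first. The pointwise bounds are those for m =
  1/32, valid on \<open>sq (3/64)\<close>; hence the limit on \<rho>.\<close>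

lemma potential_at_center:
  assumes sub: "sq (1/8) \<subseteq> D" and \<delta>: "well_level (1/2) \<delta>" and E: "E (1/8) \<le> c * \<delta> / 384 / 32"
    and \<rho>: "0 < \<rho>" "\<rho> \<le> 3/64"
  shows "V (u (0,0)) \<le> E (1/8) / (4 * \<rho>\<^sup>2) + 2 * N * sqrt (G (1/64)) * \<rho>"
proof -
  define K where "K = N * sqrt (G (1/64))"
  have sub': "sq (4 * (1/32)) \<subseteq> D" and E': "E (4 * (1/32)) \<le> c * \<delta> / 384 * (1/32)" using sub E by auto
  have uM: "norm (u x) \<le> M" if "x \<in> sq (3/64)" for x
    using interior_sup_bound[OF _ sub' _ \<delta> E', of x] that sq_mono[of "3/64" "1/16"] by auto
  have wG: "w x \<le> G (1/64)" if "x \<in> sq (3/64)" for x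
    using interior_gradient_bound[OF _ sub' _ \<delta> E', of x] that by auto
  have D: "x \<in> D" if "x \<in> sq (3/64)" for x using that sub sq_mono[of "3/64" "1/8"] by auto
  have bd: "\<bar>dV (u x) \<bullet> u1 x\<bar> \<le> K" "\<bar>dV (u x) \<bullet> u2 x\<bar> \<le> K" if x: "x \<in> sq (3/64)" for x
  proof -
    have "norm (u1 x) \<le> sqrt (G (1/64))" "norm (u2 x) \<le> sqrt (G (1/64))"
      using wG[OF x] by (auto intro!: real_le_rsqrt simp: w_def intro: order_trans[rotated])
    then have "norm (dV (u x)) * norm (u1 x) \<le> K" "norm (dV (u x)) * norm (u2 x) \<le> K"
      unfolding K_def using N[OF uM[OF x]] N_H_nonneg by (auto intro!: mult_mono)
    then show "\<bar>dV (u x) \<bullet> u1 x\<bar> \<le> K" "\<bar>dV (u x) \<bullet> u2 x\<bar> \<le> K"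
      using Cauchy_Schwarz_ineq2 order_trans by blast+
  qed
  have lip: "V (u (0,0)) - 2 * K * \<rho> \<le> V (u (s,t))" if st: "\<bar>s\<bar> \<le> \<rho>" "\<bar>t\<bar> \<le> \<rho>" for s t
  proof -
    have in1: "(z,0) \<in> sq (3/64)" if "z \<in> {-\<rho>..\<rho>}" for z using that \<rho> by (auto simp: mem_sq)
    have in2: "(s,z) \<in> sq (3/64)" if "z \<in> {-\<rho>..\<rho>}" for z using that \<rho> st by (auto simp: mem_sq)
    have K0: "0 \<le> K" using bd(1)[OF in1[of 0]] \<rho> by auto
    have "norm (V (u (0,0)) - V (u (s,0))) \<le> K * norm (0 - s)"
      by (rule field_differentiable_bound[of "{-\<rho>..\<rho>}" "\<lambda>z. V (u (z,0))" "\<lambda>z. dV (u (z,0)) \<bullet> u1 (z,0)"])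
        (use in1 bd(1) st \<rho> in \<open>auto intro!: has_real_derivative_V has_vector_derivative_at_within du D\<close>)
    moreover have "norm (V (u (s,0)) - V (u (s,t))) \<le> K * norm (0 - t)"
      by (rule field_differentiable_bound[of "{-\<rho>..\<rho>}" "\<lambda>z. V (u (s,z))" "\<lambda>z. dV (u (s,z)) \<bullet> u2 (s,z)"])
        (use in2 bd(2) st \<rho> in \<open>auto intro!: has_real_derivative_V has_vector_derivative_at_within du D\<close>)
    moreover have "K * norm (0 - s) \<le> K * \<rho>" "K * norm (0 - t) \<le> K * \<rho>" using st K0 by (auto intro: mult_left_mono)
    ultimately show ?thesis by simp
  qed
  have s\<rho>: "sq \<rho> \<subseteq> D" using sub sq_mono[of \<rho> "1/8"] \<rho> by auto
  have "integral (sq \<rho>) (\<lambda>_. V (u (0,0)) - 2 * K * \<rho>) \<le> integral (sq \<rho>) e"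
  proof (intro integral_sq_mono continuous_intros cont_sub[OF s\<rho>])
    fix x assume "x \<in> sq \<rho>"
    then have "V (u (0,0)) - 2 * K * \<rho> \<le> V (u x)" using lip by (cases x) (auto simp: mem_sq)
    then show "V (u (0,0)) - 2 * K * \<rho> \<le> e x" using w_nonneg[of x] by (simp add: e_def)
  qed
  also have "\<dots> \<le> E (1/8)" unfolding E_def[symmetric] using \<rho> sub by (intro E_mono) auto
  also have "integral (sq \<rho>) (\<lambda>_. V (u (0,0)) - 2 * K * \<rho>) = (4 * \<rho>\<^sup>2) * (V (u (0,0)) - 2 * K * \<rho>)"
    using \<rho> by (simp add: sq_def content_Pair power2_eq_square)
  finally have "V (u (0,0)) - 2 * K * \<rho> \<le> E (1/8) / (4 * \<rho>\<^sup>2)" using \<rho> by (simp add: field_simps)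
  then show ?thesis by (simp add: K_def mult.assoc)
qed

text \<open>So close to the well the error of the test is at most c^2 / 8 times the localised
  energy, half of the c^2 / 4 which \<open>logcut_ge\<close> provides on the left, and is absorbed.
  What remains is c^2 / 8 against L / c with slope L = 4 / r, whence 32 / (c^3 r).\<close>

lemma energy_decay_near_well:
  assumes r: "0 < r" and sub: "sq r \<subseteq> D" and \<sigma>: "\<sigma> \<in> Z"
    and near: "\<And>x. x \<in> sq r \<Longrightarrow> (norm (u x - \<sigma>))\<^sup>2 \<le> well_scale (1/2) * (c / 8)"
  shows "E (r/2) \<le> 32 / (c^3 * r) * E r"
proof -
  define a where "a = well_scale (1/2)"
  have a: "0 < a" using well_scale by (simp add: a_def)
  obtain b b' where "cutoff r (r/2) r (2 / (r - r/2)) b b'" using cutoff_exists[of "r/2" r r] r by auto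
  then have b: "cutoff r (r/2) r (4 / r) b b'" by simp
  have ce: "continuous_on (sq r) e" using cont_sub[OF sub] by simp
  define J where "J = integral (sq r) (\<lambda>x. b (fst x) * b (snd x) * e x)"
  have cJ: "continuous_on (sq r) (\<lambda>x. b (fst x) * b (snd x) * e x)"
    by (intro continuous_intros ce cont_cutoff[OF b])
  have bb: "0 \<le> b (fst x) * b (snd x)" if "x \<in> sq r" for x
    using that cutoffD(2)[OF b, of "fst x"] cutoffD(2)[OF b, of "snd x"] by (cases x) (auto simp: mem_sq)
  have "c\<^sup>2 * integral (sq r) (\<lambda>x. b (fst x) * b (snd x) * logcut (1/2) a ((norm (u x - \<sigma>))\<^sup>2) * e x)
    \<le> integral (sq r) (\<lambda>x. c\<^sup>2 / 8 * (b (fst x) * b (snd x) * e x)) + (4 / r) / c * E r"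
    unfolding a_def
  proof (rule single_well_energy[OF _ order_refl sub b _ \<sigma>])
    show "continuous_on (sq r) (\<lambda>x. c\<^sup>2 / 8 * (b (fst x) * b (snd x) * e x))" by (intro continuous_intros cJ)
    fix x assume x: "x \<in> sq r"
    define q where "q = (norm (u x - \<sigma>))\<^sup>2"
    have q: "0 \<le> q" "q / a \<le> c / 8" using near[OF x] a by (auto simp: q_def a_def[symmetric] field_simps)
    then have "(q / a)\<^sup>2 \<le> (c / 8)\<^sup>2" using a by (intro power_mono) auto
    then have "4 * (1/2) * (q / a)\<^sup>2 \<le> 4 * (1/2) * (c / 8)\<^sup>2" by simp
    also have "\<dots> = c\<^sup>2 / 32" by (simp add: power_divide)
    finally have "4 * (1/2) * (q / a)\<^sup>2 \<le> c\<^sup>2 / 32" .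
    then have "\<bar>logcut' (1/2) a q\<bar> * q \<le> c\<^sup>2 / 32" using logcut'_bound_sq[of "1/2" a q] a q by linarith
    then have l: "2 * (\<bar>logcut' (1/2) a q\<bar> * q) \<le> c\<^sup>2 / 16" by simp
    have we: "w x \<le> 2 * e x" using V_nonneg by (simp add: e_def)
    have "2 * (\<bar>logcut' (1/2) a q\<bar> * q) * w x \<le> c\<^sup>2 / 16 * (2 * e x)"
      by (rule mult_mono[OF l we _ w_nonneg]) simp
    then have "b (fst x) * b (snd x) * (2 * (\<bar>logcut' (1/2) a q\<bar> * q) * w x) \<le> b (fst x) * b (snd x) * (c\<^sup>2 / 16 * (2 * e x))"
      by (rule mult_left_mono[OF _ bb[OF x]])
    then show "b (fst x) * b (snd x) * (2 * (\<bar>logcut' (1/2) (well_scale (1/2)) ((norm (u x - \<sigma>))\<^sup>2)\<bar> * (norm (u x - \<sigma>))\<^sup>2) * w x)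
       \<le> c\<^sup>2 / 8 * (b (fst x) * b (snd x) * e x)"
      by (simp add: q_def a_def algebra_simps)
  qed (use r in auto)
  also have "integral (sq r) (\<lambda>x. c\<^sup>2 / 8 * (b (fst x) * b (snd x) * e x)) = c\<^sup>2 / 8 * J" unfolding J_def by (rule integral_mult_right)
  finally have 1: "c\<^sup>2 * integral (sq r) (\<lambda>x. b (fst x) * b (snd x) * logcut (1/2) a ((norm (u x - \<sigma>))\<^sup>2) * e x) \<le> c\<^sup>2 / 8 * J + 4 / r / c * E r" .
  have "integral (sq r) (\<lambda>x. 1/4 * (b (fst x) * b (snd x) * e x))
     \<le> integral (sq r) (\<lambda>x. b (fst x) * b (snd x) * logcut (1/2) a ((norm (u x - \<sigma>))\<^sup>2) * e x)"
  proof (intro integral_sq_mono continuous_intros continuous_on_logcut_u sub a ce cont_cutoff[OF b])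
    fix x assume x: "x \<in> sq r"
    have "a * (c/8) \<le> a * 1" using c a by (intro mult_left_mono) auto
    then have "(norm (u x - \<sigma>))\<^sup>2 \<le> a" using near[OF x] by (simp add: a_def)
    then have g: "1/4 \<le> logcut (1/2) a ((norm (u x - \<sigma>))\<^sup>2)" using a by (intro logcut_ge) auto
    have "1/4 * (b (fst x) * b (snd x) * e x) \<le> logcut (1/2) a ((norm (u x - \<sigma>))\<^sup>2) * (b (fst x) * b (snd x) * e x)"
      by (rule mult_right_mono[OF g mult_nonneg_nonneg[OF bb[OF x] e_nonneg]])
    then show "1/4 * (b (fst x) * b (snd x) * e x) \<le> b (fst x) * b (snd x) * logcut (1/2) a ((norm (u x - \<sigma>))\<^sup>2) * e x"
      by (simp add: mult_ac)
  qed
  then have "1/4 * J \<le> integral (sq r) (\<lambda>x. b (fst x) * b (snd x) * logcut (1/2) a ((norm (u x - \<sigma>))\<^sup>2) * e x)"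
    unfolding integral_mult_right J_def .
  then have "c\<^sup>2 * (1/4 * J) \<le> c\<^sup>2 * integral (sq r) (\<lambda>x. b (fst x) * b (snd x) * logcut (1/2) a ((norm (u x - \<sigma>))\<^sup>2) * e x)"
    by (rule mult_left_mono) simp
  then have "c\<^sup>2 * J \<le> 32 / r / c * E r" using 1 by linarith
  then have "J \<le> 32 / (c^3 * r) * E r" using c r by (simp add: field_simps power2_eq_square power3_eq_cube)
  moreover have "E (r/2) \<le> J"
  proof -
    have s: "sq (r/2) \<subseteq> sq r" using r by (intro sq_mono) auto
    have "E (r/2) = integral (sq (r/2)) (\<lambda>x. b (fst x) * b (snd x) * e x)"
      unfolding E_def
    proof (rule integral_cong)
      fix x assume "x \<in> sq (r/2)"
      then have "\<bar>fst x\<bar> \<le> r/2" "\<bar>snd x\<bar> \<le> r/2" by (cases x; simp add: mem_sq)+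
      then have "b (fst x) = 1" "b (snd x) = 1" using cutoffD(5)[OF b] r by auto
      then show "e x = b (fst x) * b (snd x) * e x" by simp
    qed
    also have "\<dots> \<le> J" unfolding J_def
      using bb e_nonneg by (intro integral_subset_le s integrable_sq cJ continuous_on_subset[OF cJ s] ballI) auto
    finally show ?thesis .
  qed
  ultimately show ?thesis by linarith
qed

end

subsection \<open>Multi-well potentials\<close>

lemma smooth_onD:
  assumes "smooth_on f S"
  shows "continuous_on S f" "x \<in> S \<Longrightarrow> f differentiable (at x)"
    "smooth_on (\<lambda>x. frechet_derivative f (at x) v) S"
proof -
  have *: "Ck_on n f S" for n using assms by (simp add: smooth_on_def)
  show "continuous_on S f" using *[of 0] by simp
  show "x \<in> S \<Longrightarrow> f differentiable (at x)" using *[of 1] by simp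
  show "smooth_on (\<lambda>x. frechet_derivative f (at x) v) S"
    using *[of "Suc n" for n] by (simp add: smooth_on_def)
qed

lemma smooth_on_partial_deriv: "smooth_on f S \<Longrightarrow> smooth_on (partial_deriv i f) S"
  unfolding partial_deriv_def[abs_def] by (rule smooth_onD(3))

lemma linear_axis_expansion:
  fixes f :: "real^'n \<Rightarrow> 'b::real_vector"
  assumes "linear f"
  shows "f h = (\<Sum>i\<in>UNIV. (h $ i) *\<^sub>R f (axis i 1))"
proof -
  have "f h = f (\<Sum>i\<in>UNIV. (h $ i) *\<^sub>R axis i 1)"
    using basis_expansion[of h] by (simp add: scalar_mult_eq_scaleR)
  then show ?thesis by (simp add: linear_sum[OF assms] linear_cmul[OF assms])
qed

lemma has_derivative_partial_deriv:
  fixes f :: "real^'n::finite \<Rightarrow> 'b::real_normed_vector"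
  assumes "smooth_on f S" "x \<in> S"
  shows "(f has_derivative (\<lambda>h. \<Sum>i\<in>UNIV. (h $ i) *\<^sub>R partial_deriv i f x)) (at x)"
proof -
  have d: "(f has_derivative frechet_derivative f (at x)) (at x)"
    using smooth_onD(2)[OF assms] frechet_derivative_works by blast
  then have "frechet_derivative f (at x) h = (\<Sum>i\<in>UNIV. (h $ i) *\<^sub>R partial_deriv i f x)" for h
    unfolding partial_deriv_def by (rule linear_axis_expansion[OF has_derivative_linear])
  then have "frechet_derivative f (at x) = (\<lambda>h. \<Sum>i\<in>UNIV. (h $ i) *\<^sub>R partial_deriv i f x)" by (rule ext)
  then show ?thesis using d by simp
qed

text \<open>Differentiating the gradient componentwise yields the transpose of
  \<open>hessian V y\<close>; the two have the same quadratic form, as \<open>inner_hess_map\<close>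
  records.\<close>

definition hess_map :: "(real^'n::finite \<Rightarrow> real) \<Rightarrow> real^'n \<Rightarrow> real^'n \<Rightarrow> real^'n" where
  "hess_map V y h = (\<Sum>j\<in>UNIV. (\<Sum>i\<in>UNIV. h $ i * partial_deriv i (partial_deriv j V) y) *\<^sub>R axis j 1)"

lemma gradient_expansion: "gradient V y = (\<Sum>j\<in>UNIV. partial_deriv j V y *\<^sub>R axis j 1)"
  using basis_expansion[of "gradient V y"] by (simp add: scalar_mult_eq_scaleR gradient_def)

lemma has_derivative_gradient:
  assumes "smooth_on V S" "y \<in> S"
  shows "(V has_derivative (\<lambda>h. gradient V y \<bullet> h)) (at y)" "(gradient V has_derivative hess_map V y) (at y)"
proof -
  show "(V has_derivative (\<lambda>h. gradient V y \<bullet> h)) (at y)"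
    by (rule has_derivative_eq_rhs[OF has_derivative_partial_deriv[OF assms]])
      (simp add: fun_eq_iff inner_vec_def gradient_def mult.commute)
  show "(gradient V has_derivative hess_map V y) (at y)"
    unfolding gradient_expansion[abs_def] hess_map_def[abs_def]
    using has_derivative_partial_deriv[OF smooth_on_partial_deriv[OF assms(1)] assms(2)]
    by (intro has_derivative_sum has_derivative_scaleR_left) simp
qed

lemma inner_hess_map: "h \<bullet> hess_map V y h = h \<bullet> (hessian V y *v h)"
proof -
  have "h \<bullet> hess_map V y h = (\<Sum>j\<in>UNIV. \<Sum>i\<in>UNIV. h $ i * (partial_deriv i (partial_deriv j V) y * h $ j))"
    by (simp add: hess_map_def inner_sum_right inner_axis sum_distrib_right sum_distrib_left mult_ac)
  also have "\<dots> = (\<Sum>i\<in>UNIV. \<Sum>j\<in>UNIV. h $ i * (partial_deriv i (partial_deriv j V) y * h $ j))" by (rule sum.swap)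
  also have "\<dots> = h \<bullet> (hessian V y *v h)"
    by (simp add: inner_vec_def matrix_vector_mult_def hessian_def sum_distrib_left)
  finally show ?thesis .
qed

lemma norm_hess_map_le:
  "norm (hess_map V y h) \<le> (\<Sum>j\<in>UNIV. \<Sum>i\<in>UNIV. \<bar>partial_deriv i (partial_deriv j V) y\<bar>) * norm h"
proof -
  have "norm (hess_map V y h) \<le> (\<Sum>j\<in>UNIV. \<bar>\<Sum>i\<in>UNIV. h $ i * partial_deriv i (partial_deriv j V) y\<bar>)"
    unfolding hess_map_def by (rule order_trans[OF norm_sum]) simp
  also have "\<dots> \<le> (\<Sum>j\<in>UNIV. \<Sum>i\<in>UNIV. \<bar>h $ i * partial_deriv i (partial_deriv j V) y\<bar>)"
    by (intro sum_mono sum_abs)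
  also have "\<dots> \<le> (\<Sum>j\<in>UNIV. \<Sum>i\<in>UNIV. \<bar>partial_deriv i (partial_deriv j V) y\<bar> * norm h)"
    unfolding abs_mult mult.commute[of "\<bar>h $ _\<bar>"] by (intro sum_mono mult_left_mono component_le_norm_cart) simp
  finally show ?thesis by (simp add: sum_distrib_right)
qed

section \<open>Quadratic behaviour at the wells\<close>

lemma gradient_zero_at_min:
  assumes "(V has_derivative (\<lambda>h. g \<bullet> h)) (at \<sigma>)" "\<And>y. V \<sigma> \<le> (V y :: real)"
  shows "g = 0"
proof -
  have "(\<lambda>h. g \<bullet> h) = (\<lambda>h. 0)"
    by (rule differential_zero_maxmin[of \<sigma> UNIV V]) (use assms in auto)
  then show ?thesis by (metis inner_eq_zero_iff)
qed

text \<open>By compactness of the unit sphere the quadratic form of HV is at least m |h|^2 with m >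
  0, and near \<sigma> the remainder in the first order expansion of dV costs only half of it. This
  gives the bounds on dV; those on V follow by comparing V with quadratics along rays from
  \<sigma>.\<close>

lemma nondegenerate_minimum:
  fixes V :: "'b::euclidean_space \<Rightarrow> real"
  assumes V: "\<And>y. (V has_derivative (\<lambda>h. dV y \<bullet> h)) (at y)" and HV: "(dV has_derivative HV) (at \<sigma>)"
    and min: "V \<sigma> = 0" "\<And>y. 0 \<le> V y" and pos: "\<And>h. h \<noteq> 0 \<Longrightarrow> 0 < h \<bullet> HV h"
  obtains c d where "0 < c" "0 < d" "\<And>y. norm (y - \<sigma>) \<le> d \<Longrightarrow> c * (norm (y - \<sigma>))\<^sup>2 \<le> (y - \<sigma>) \<bullet> dV y \<and>
     c * (norm (y - \<sigma>))\<^sup>2 \<le> V y \<and> c * V y \<le> (norm (y - \<sigma>))\<^sup>2 \<and> c * (norm (dV y))\<^sup>2 \<le> V y"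
proof -
  have lin: "bounded_linear HV" using HV by (rule has_derivative_bounded_linear)
  have d0: "dV \<sigma> = 0" using gradient_zero_at_min[OF V] min by simp
  obtain b :: 'b where "b \<in> Basis" using nonempty_Basis by blast
  then have "sphere (0::'b) 1 \<noteq> {}" using norm_Basis[of b] by auto
  moreover have "continuous_on (sphere 0 1) (\<lambda>h. h \<bullet> HV h)"
    by (intro continuous_intros linear_continuous_on lin)
  ultimately obtain h0 where h0: "h0 \<in> sphere 0 1" "\<And>h. h \<in> sphere 0 1 \<Longrightarrow> h0 \<bullet> HV h0 \<le> h \<bullet> HV h"
    using continuous_attains_inf[OF compact_sphere] by blast
  define m where "m = h0 \<bullet> HV h0"
  have m: "0 < m" unfolding m_def using h0(1) by (intro pos) auto
  have quad: "m * (norm h)\<^sup>2 \<le> h \<bullet> HV h" for h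
  proof (cases "h = 0")
    case False
    define k where "k = h /\<^sub>R norm h"
    have k: "k \<bullet> HV k = (h \<bullet> HV h) / (norm h)\<^sup>2"
      by (simp add: k_def linear_cmul[OF bounded_linear.linear[OF lin]] power2_eq_square divide_inverse)
    have "k \<in> sphere 0 1" using False by (simp add: k_def)
    then have "(norm h)\<^sup>2 * m \<le> (norm h)\<^sup>2 * (k \<bullet> HV k)" unfolding m_def by (intro mult_left_mono h0) auto
    also have "\<dots> = h \<bullet> HV h" using False by (simp add: k)
    finally show ?thesis by (simp add: mult.commute)
  qed simp
  obtain B where B: "0 < B" "\<And>h. norm (HV h) \<le> B * norm h" using bounded_linear.pos_bounded[OF lin] by (metis mult.commute)
  obtain d where d: "0 < d" "\<And>y. norm (y - \<sigma>) < d \<Longrightarrow> norm (dV y - dV \<sigma> - HV (y - \<sigma>)) \<le> m/2 * norm (y - \<sigma>)"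
    using HV[unfolded has_derivative_at_alt] m half_gt_zero by blast
  define K where "K = B + m / 2"
  have K: "0 < K" using B m by (simp add: K_def)
  have low: "m/2 * (norm h)\<^sup>2 \<le> h \<bullet> dV (\<sigma> + h)" and up: "norm (dV (\<sigma> + h)) \<le> K * norm h" if "norm h < d" for h
  proof -
    have r: "norm (dV (\<sigma> + h) - HV h) \<le> m/2 * norm h" using d(2)[of "\<sigma> + h"] that by (simp add: d0)
    have "\<bar>h \<bullet> (dV (\<sigma> + h) - HV h)\<bar> \<le> norm h * norm (dV (\<sigma> + h) - HV h)" by (rule Cauchy_Schwarz_ineq2)
    also have "\<dots> \<le> norm h * (m/2 * norm h)" by (intro mult_left_mono r) auto
    also have "\<dots> = m/2 * (norm h)\<^sup>2" by (simp add: power2_eq_square)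
    finally have "\<bar>h \<bullet> dV (\<sigma> + h) - h \<bullet> HV h\<bar> \<le> m/2 * (norm h)\<^sup>2" by (simp add: inner_diff_right)
    then show "m/2 * (norm h)\<^sup>2 \<le> h \<bullet> dV (\<sigma> + h)" using quad[of h] by linarith
    have "norm (dV (\<sigma> + h)) \<le> norm (HV h) + norm (dV (\<sigma> + h) - HV h)" using norm_triangle_sub by blast
    then show "norm (dV (\<sigma> + h)) \<le> K * norm h" using r B(2)[of h] by (simp add: K_def distrib_right)
  qed
  have Vlow: "m/4 * (norm h)\<^sup>2 \<le> V (\<sigma> + h)" and Vup: "V (\<sigma> + h) \<le> K/2 * (norm h)\<^sup>2" if h: "norm h < d" for h
  proof -
    have g: "((\<lambda>t. V (\<sigma> + t *\<^sub>R h)) has_real_derivative dV (\<sigma> + t *\<^sub>R h) \<bullet> h) (at t)" for t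
    proof -
      have "((\<lambda>t. \<sigma> + t *\<^sub>R h) has_derivative (\<lambda>k. k *\<^sub>R h)) (at t)" by (auto intro!: derivative_eq_intros)
      from has_derivative_compose[OF this V] show ?thesis
        unfolding has_field_derivative_def by (rule has_derivative_eq_rhs) (auto simp: fun_eq_iff)
    qed
    have nt: "norm (t *\<^sub>R h) < d" if "0 \<le> t" "t \<le> 1" for t
      using h that mult_left_le_one_le[of "norm h" t] by simp
    have l: "m/2 * t * (norm h)\<^sup>2 \<le> dV (\<sigma> + t *\<^sub>R h) \<bullet> h" if t: "0 \<le> t" "t \<le> 1" for t
    proof (cases "t = 0")
      case False
      have "t * (m/2 * t * (norm h)\<^sup>2) \<le> t * (dV (\<sigma> + t *\<^sub>R h) \<bullet> h)"
        using low[OF nt[OF t]] by (simp add: power_mult_distrib power2_eq_square inner_commute mult_ac)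
      then show ?thesis using False t by simp
    qed (simp add: d0)
    have u: "dV (\<sigma> + t *\<^sub>R h) \<bullet> h \<le> K * t * (norm h)\<^sup>2" if t: "0 \<le> t" "t \<le> 1" for t
    proof -
      have "dV (\<sigma> + t *\<^sub>R h) \<bullet> h \<le> norm (dV (\<sigma> + t *\<^sub>R h)) * norm h" by (rule norm_cauchy_schwarz)
      also have "\<dots> \<le> K * norm (t *\<^sub>R h) * norm h" by (intro mult_right_mono up nt t) auto
      also have "\<dots> = K * t * (norm h)\<^sup>2" using t by (simp add: power2_eq_square)
      finally show ?thesis .
    qed
    have "V (\<sigma> + 0 *\<^sub>R h) - m/4 * 0\<^sup>2 * (norm h)\<^sup>2 \<le> V (\<sigma> + 1 *\<^sub>R h) - m/4 * 1\<^sup>2 * (norm h)\<^sup>2"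
    proof (rule DERIV_nonneg_imp_nondecreasing[where f = "\<lambda>t. V (\<sigma> + t *\<^sub>R h) - m/4 * t\<^sup>2 * (norm h)\<^sup>2"])
      fix t :: real assume t: "0 \<le> t" "t \<le> 1"
      have "((\<lambda>t. V (\<sigma> + t *\<^sub>R h) - m/4 * t\<^sup>2 * (norm h)\<^sup>2) has_real_derivative dV (\<sigma> + t *\<^sub>R h) \<bullet> h - m/2 * t * (norm h)\<^sup>2) (at t)"
        by (rule DERIV_diff[OF g]) (auto intro!: derivative_eq_intros)
      then show "\<exists>y. ((\<lambda>t. V (\<sigma> + t *\<^sub>R h) - m/4 * t\<^sup>2 * (norm h)\<^sup>2) has_real_derivative y) (at t) \<and> 0 \<le> y"
        using l[OF t] by (intro exI[of _ "dV (\<sigma> + t *\<^sub>R h) \<bullet> h - m/2 * t * (norm h)\<^sup>2"]) simp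
    qed simp
    then show "m/4 * (norm h)\<^sup>2 \<le> V (\<sigma> + h)" using min by simp
    have "K/2 * 0\<^sup>2 * (norm h)\<^sup>2 - V (\<sigma> + 0 *\<^sub>R h) \<le> K/2 * 1\<^sup>2 * (norm h)\<^sup>2 - V (\<sigma> + 1 *\<^sub>R h)"
    proof (rule DERIV_nonneg_imp_nondecreasing[where f = "\<lambda>t. K/2 * t\<^sup>2 * (norm h)\<^sup>2 - V (\<sigma> + t *\<^sub>R h)"])
      fix t :: real assume t: "0 \<le> t" "t \<le> 1"
      have "((\<lambda>t. K/2 * t\<^sup>2 * (norm h)\<^sup>2 - V (\<sigma> + t *\<^sub>R h)) has_real_derivative K * t * (norm h)\<^sup>2 - dV (\<sigma> + t *\<^sub>R h) \<bullet> h) (at t)"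
        by (rule DERIV_diff[OF _ g]) (auto intro!: derivative_eq_intros)
      then show "\<exists>y. ((\<lambda>t. K/2 * t\<^sup>2 * (norm h)\<^sup>2 - V (\<sigma> + t *\<^sub>R h)) has_real_derivative y) (at t) \<and> 0 \<le> y"
        using u[OF t] by (intro exI[of _ "K * t * (norm h)\<^sup>2 - dV (\<sigma> + t *\<^sub>R h) \<bullet> h"]) simp
    qed simp
    then show "V (\<sigma> + h) \<le> K/2 * (norm h)\<^sup>2" using min by simp
  qed
  \<comment> \<open>The first entry serves the two lower bounds, 2 / K the upper bound on V, and the
    last one compares |dV|^2 \<le> K^2 |h|^2 with V \<ge> m/4 |h|^2.\<close>
  define c where "c = min (m/4) (min (2/K) (m / (4 * K\<^sup>2)))"
  have c: "0 < c" "c \<le> m/4" "c \<le> 2/K" "c \<le> m / (4 * K\<^sup>2)" using m K by (auto simp: c_def)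
  have "c * (norm (y - \<sigma>))\<^sup>2 \<le> (y - \<sigma>) \<bullet> dV y \<and> c * (norm (y - \<sigma>))\<^sup>2 \<le> V y \<and>
      c * V y \<le> (norm (y - \<sigma>))\<^sup>2 \<and> c * (norm (dV y))\<^sup>2 \<le> V y" if y: "norm (y - \<sigma>) \<le> d/2" for y
  proof -
    define h where "h = y - \<sigma>"
    have h: "norm h < d" "\<sigma> + h = y" using y d(1) by (auto simp: h_def)
    have "c * (norm h)\<^sup>2 \<le> m/4 * (norm h)\<^sup>2" using c by (intro mult_right_mono) auto
    moreover have "c * V y \<le> 2/K * (K/2 * (norm h)\<^sup>2)"
      using Vup[OF h(1)] c min K by (intro mult_mono) (auto simp: h(2))
    moreover have "c * (norm (dV y))\<^sup>2 \<le> m / (4 * K\<^sup>2) * (K * norm h)\<^sup>2"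
      using up[OF h(1)] c m K by (intro mult_mono power_mono) (auto simp: h(2))
    moreover have "0 \<le> m * (norm h)\<^sup>2" using m by simp
    ultimately show ?thesis
      using low[OF h(1)] Vlow[OF h(1)] K unfolding h(2) h_def[symmetric] by (simp add: power_mult_distrib)
  qed
  then show ?thesis using c(1) d(1) by (intro that[of c "d/2"]) auto
qed

lemma bounded_on_cball:
  fixes f :: "'b::euclidean_space \<Rightarrow> real"
  assumes "continuous_on UNIV f"
  obtains B where "\<And>y. norm y \<le> M \<Longrightarrow> f y \<le> B"
proof -
  have "compact (f ` cball 0 M)" by (intro compact_continuous_image continuous_on_subset[OF assms]) auto
  then obtain B where "\<forall>z\<in>f ` cball 0 M. norm z \<le> B" using compact_imp_bounded bounded_iff by metis
  then have "f y \<le> B" if "norm y \<le> M" for y 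
    using that abs_ge_self[of "f y"] by (force intro: order_trans)
  then show ?thesis by (rule that)
qed

lemma multi_well_potential_nonneg:
  assumes "multi_well_potential V"
  shows "0 \<le> V y"
  using assms cInf_lower[of "V y" "range V"] by (auto simp: multi_well_potential_def)

text \<open>Outside a large ball V is at least 1, and on that ball with small balls about the wells
  removed V has a positive minimum by compactness. The level is the smaller of the two
  values.\<close>

lemma multi_well_small_near:
  assumes V: "multi_well_potential V" and a: "0 < a"
  shows "\<exists>\<delta>>0. \<forall>y. V y < \<delta> \<longrightarrow> (\<exists>\<sigma>\<in>zero_set V. norm (y - \<sigma>) \<le> a)"
proof -
  have "\<forall>\<^sub>F y in at_infinity. 1 \<le> V y"
    using V by (simp add: multi_well_potential_def filterlim_at_top)
  then obtain B where B: "\<And>y. B \<le> norm y \<Longrightarrow> 1 \<le> V y" by (auto simp: eventually_at_infinity)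
  define K where "K = cball 0 B - (\<Union>\<sigma>\<in>zero_set V. ball \<sigma> a)"
  have K: "compact K" unfolding K_def by (intro compact_diff open_UN) auto
  have cV: "continuous_on UNIV V" using V smooth_onD(1) by (auto simp: multi_well_potential_def)
  have "\<exists>\<delta>>0. \<forall>y\<in>K. \<delta> \<le> V y"
  proof (cases "K = {}")
    case False
    then obtain z where z: "z \<in> K" "\<And>y. y \<in> K \<Longrightarrow> V z \<le> V y"
      using continuous_attains_inf[OF K False continuous_on_subset[OF cV subset_UNIV]] by blast
    have "V z \<noteq> 0" using z(1) a by (auto simp: K_def zero_set_def)
    then have "0 < V z" using multi_well_potential_nonneg[OF V, of z] by simp
    then show ?thesis using z by blast
  qed (auto intro: exI[of _ 1])
  then obtain \<delta> where \<delta>: "0 < \<delta>" "\<And>y. y \<in> K \<Longrightarrow> \<delta> \<le> V y" by blast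
  have "\<exists>\<sigma>\<in>zero_set V. norm (y - \<sigma>) \<le> a" if "V y < min 1 \<delta>" for y
  proof -
    have "norm y < B" using that B[of y] by (meson min_less_iff_conj not_le)
    moreover have "y \<notin> K" using that \<delta>(2)[of y] by (meson min_less_iff_conj not_le)
    ultimately obtain \<sigma> where "\<sigma> \<in> zero_set V" "dist \<sigma> y < a" by (auto simp: K_def)
    then show ?thesis by (intro bexI[of _ \<sigma>]) (auto simp: dist_norm norm_minus_commute)
  qed
  then show ?thesis using \<delta>(1) by (intro exI[of _ "min 1 \<delta>"]) auto
qed

lemma finite_common_constants:
  fixes Q :: "'a \<Rightarrow> real \<Rightarrow> real \<Rightarrow> bool"
  assumes "finite Z" and ex: "\<And>\<sigma>. \<sigma> \<in> Z \<Longrightarrow> \<exists>c>0. \<exists>d>0. Q \<sigma> c d"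
    and mono: "\<And>\<sigma> c d c' d'. Q \<sigma> c d \<Longrightarrow> c' \<le> c \<Longrightarrow> d' \<le> d \<Longrightarrow> Q \<sigma> c' d'"
  shows "\<exists>c>0. \<exists>d>0. \<forall>\<sigma>\<in>Z. Q \<sigma> c d"
  using assms(1,2)
proof (induction Z rule: finite_induct)
  case empty
  then show ?case by (auto intro: exI[of _ 1])
next
  case (insert \<sigma> Z)
  then obtain c d where cd: "0 < c" "0 < d" "\<forall>\<sigma>\<in>Z. Q \<sigma> c d" by auto
  obtain c' d' where cd': "0 < c'" "0 < d'" "Q \<sigma> c' d'" using insert.prems[of \<sigma>] by auto
  have "\<forall>\<sigma>\<in>insert \<sigma> Z. Q \<sigma> (min c c') (min d d')" using cd(3) cd'(3) mono by (auto intro: mono)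
  then show ?case using cd cd' by (intro exI[of _ "min c c'"] conjI exI[of _ "min d d'"]) auto
qed

lemma multi_well_potential_locale:
  fixes V :: "real^'k::finite \<Rightarrow> real"
  assumes mw: "multi_well_potential V" and \<mu>: "0 < \<mu>"
  obtains c d M N H where "potential V (gradient V) (hess_map V) (zero_set V) c d M N H" "d \<le> \<mu>"
proof -
  have sm: "smooth_on V UNIV" and fin: "finite (zero_set V)" and pd: "\<And>\<sigma>. \<sigma> \<in> zero_set V \<Longrightarrow> pos_definite (hessian V \<sigma>)"
    using mw by (auto simp: multi_well_potential_def)
  obtain \<alpha> R where R: "\<alpha> > 0" "R > 0" "\<And>y. norm y > R \<Longrightarrow> \<alpha> * (norm y)\<^sup>2 \<le> y \<bullet> gradient V y"
    using mw unfolding multi_well_potential_def by blast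
  note V0 = multi_well_potential_nonneg[OF mw]
  have dV: "(V has_derivative (\<lambda>h. gradient V y \<bullet> h)) (at y)" "(gradient V has_derivative hess_map V y) (at y)" for y
    using has_derivative_gradient[OF sm] by auto
  define Q where "Q \<sigma> c d \<longleftrightarrow> (\<forall>y. norm (y - \<sigma>) \<le> d \<longrightarrow> c * (norm (y - \<sigma>))\<^sup>2 \<le> (y - \<sigma>) \<bullet> gradient V y \<and>
     c * (norm (y - \<sigma>))\<^sup>2 \<le> V y \<and> c * V y \<le> (norm (y - \<sigma>))\<^sup>2 \<and> c * (norm (gradient V y))\<^sup>2 \<le> V y)" for \<sigma> and c d :: real
  have "\<exists>c>0. \<exists>d>0. \<forall>\<sigma>\<in>zero_set V. Q \<sigma> c d"
  proof (rule finite_common_constants[OF fin])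
    fix \<sigma> assume \<sigma>: "\<sigma> \<in> zero_set V"
    have pos: "0 < h \<bullet> hess_map V \<sigma> h" if "h \<noteq> 0" for h
      using pd[OF \<sigma>] that unfolding pos_definite_def inner_hess_map by blast
    have z: "V \<sigma> = 0" using \<sigma> by (simp add: zero_set_def)
    obtain c d where cd: "0 < c" "0 < d" "\<And>y. norm (y - \<sigma>) \<le> d \<Longrightarrow> c * (norm (y - \<sigma>))\<^sup>2 \<le> (y - \<sigma>) \<bullet> gradient V y \<and>
     c * (norm (y - \<sigma>))\<^sup>2 \<le> V y \<and> c * V y \<le> (norm (y - \<sigma>))\<^sup>2 \<and> c * (norm (gradient V y))\<^sup>2 \<le> V y"
      using nondegenerate_minimum[OF dV(1) dV(2) z V0 pos] by blast
    have "Q \<sigma> c d" unfolding Q_def using cd(3) by blast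
    then show "\<exists>c>0. \<exists>d>0. Q \<sigma> c d" using cd(1,2) by blast
  next
    fix \<sigma> c d c' d' assume Q: "Q \<sigma> c d" and le: "c' \<le> c" "d' \<le> d"
    have m: "c' * z \<le> c * z" if "0 \<le> z" for z using le(1) that by (rule mult_right_mono)
    show "Q \<sigma> c' d'"
      unfolding Q_def
    proof (intro allI impI)
      fix y assume "norm (y - \<sigma>) \<le> d'"
      then have y: "norm (y - \<sigma>) \<le> d" using le by simp
      show "c' * (norm (y - \<sigma>))\<^sup>2 \<le> (y - \<sigma>) \<bullet> gradient V y \<and> c' * (norm (y - \<sigma>))\<^sup>2 \<le> V y \<and>
        c' * V y \<le> (norm (y - \<sigma>))\<^sup>2 \<and> c' * (norm (gradient V y))\<^sup>2 \<le> V y"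
        using Q[unfolded Q_def, rule_format, OF y] m[of "(norm (y - \<sigma>))\<^sup>2"] m[of "V y"] m[of "(norm (gradient V y))\<^sup>2"] V0[of y]
        by auto
    qed
  qed
  then obtain c' d' where cd: "0 < c'" "0 < d'" "\<And>\<sigma>. \<sigma> \<in> zero_set V \<Longrightarrow> Q \<sigma> c' d'" by blast
  define c where "c = min 1 c'"
  define d where "d = min \<mu> d'"
  have c: "0 < c" "c \<le> 1" "c \<le> c'" and d: "0 < d" "d \<le> d'" "d \<le> \<mu>" using cd \<mu> by (auto simp: c_def d_def)
  have Qd: "c * (norm (y - \<sigma>))\<^sup>2 \<le> (y - \<sigma>) \<bullet> gradient V y \<and>
     c * (norm (y - \<sigma>))\<^sup>2 \<le> V y \<and> c * V y \<le> (norm (y - \<sigma>))\<^sup>2 \<and> c * (norm (gradient V y))\<^sup>2 \<le> V y"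
    if "\<sigma> \<in> zero_set V" "norm (y - \<sigma>) \<le> d" for y \<sigma>
  proof -
    have m: "c * z \<le> c' * z" if "0 \<le> z" for z using c(3) that by (rule mult_right_mono)
    have y: "norm (y - \<sigma>) \<le> d'" using that d by simp
    show ?thesis
      using cd(3)[OF that(1), unfolded Q_def, rule_format, OF y] m[of "(norm (y - \<sigma>))\<^sup>2"] m[of "V y"] m[of "(norm (gradient V y))\<^sup>2"] V0[of y]
      by auto
  qed
  \<comment> \<open>R gives coercivity beyond \<open>M\<close>, the sum of norms is a crude bound
    for every well, and \<open>d\<close> makes room for the balls about the wells.\<close>
  define M where "M = R + (\<Sum>\<sigma>\<in>zero_set V. norm \<sigma>) + d"
  have S: "norm \<sigma> \<le> (\<Sum>\<sigma>\<in>zero_set V. norm \<sigma>)" if "\<sigma> \<in> zero_set V" for \<sigma>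
    using member_le_sum[OF that _ fin, of norm] by simp
  have S0: "0 \<le> (\<Sum>\<sigma>\<in>zero_set V. norm \<sigma>)" by (simp add: sum_nonneg)
  have cg: "continuous_on UNIV (\<lambda>y. norm (gradient V y))"
    using dV(2) by (intro continuous_on_norm continuous_at_imp_continuous_on ballI has_derivative_continuous) auto
  obtain N where N: "\<And>y. norm y \<le> M \<Longrightarrow> norm (gradient V y) \<le> N" using bounded_on_cball[OF cg] by blast
  have ch: "continuous_on UNIV (\<lambda>y. \<Sum>j\<in>UNIV. \<Sum>i\<in>UNIV. \<bar>partial_deriv i (partial_deriv j V) y\<bar>)"
    by (intro continuous_intros smooth_onD(1) smooth_on_partial_deriv sm)
  obtain H where H: "\<And>y. norm y \<le> M \<Longrightarrow> (\<Sum>j\<in>UNIV. \<Sum>i\<in>UNIV. \<bar>partial_deriv i (partial_deriv j V) y\<bar>) \<le> H"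
    using bounded_on_cball[OF ch] by blast
  have "potential V (gradient V) (hess_map V) (zero_set V) c d M N H"
  proof
    fix y \<sigma> :: "real^'k" assume \<sigma>: "\<sigma> \<in> zero_set V" "norm (y - \<sigma>) \<le> d"
    show "c * (norm (y - \<sigma>))\<^sup>2 \<le> (y - \<sigma>) \<bullet> gradient V y" "c * (norm (y - \<sigma>))\<^sup>2 \<le> V y"
      "c * V y \<le> (norm (y - \<sigma>))\<^sup>2" "c * (norm (gradient V y))\<^sup>2 \<le> V y"
      using Qd[OF \<sigma>] by auto
    show "norm y \<le> M" using norm_triangle_sub[of y \<sigma>] \<sigma>(2) S[OF \<sigma>(1)] R(2) by (simp add: M_def)
  next
    fix y :: "real^'k" assume "M < norm y"
    then have y: "R < norm y" using S0 d by (simp add: M_def)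
    then have "0 < norm y" using R(2) by linarith
    then have "0 < \<alpha> * (norm y)\<^sup>2" using R(1) by (intro mult_pos_pos zero_less_power)
    then show "0 < y \<bullet> gradient V y" using R(3)[OF y] by linarith
  next
    fix y h :: "real^'k" assume "norm y \<le> M"
    then show "norm (hess_map V y h) \<le> H * norm h"
      using norm_hess_map_le[of V y h] H mult_right_mono[OF H norm_ge_zero] order_trans by blast
  next
    show "0 \<le> M" using S0 R(2) d(1) by (simp add: M_def)
  next
    fix a :: real assume "0 < a"
    then show "\<exists>\<delta>>0. \<forall>y. V y < \<delta> \<longrightarrow> (\<exists>\<sigma>\<in>zero_set V. norm (y - \<sigma>) \<le> a)" by (rule multi_well_small_near[OF mw])
  qed (fact V0 dV fin c(1,2) d(1) N)+
  then show ?thesis using d(3) by (rule that)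
qed

subsection \<open>Rescaling\<close>

lemma Basis_real_pair: "(Basis :: (real \<times> real) set) = {(1,0), (0,1)}"
  by (auto simp: Basis_prod_def)

lemma Basis_real_2: "(Basis :: (real^2) set) = {axis 1 1, axis 2 1}"
  by (auto simp: Basis_vec_def UNIV_2)

definition plane0 :: "real \<times> real \<Rightarrow> real^2" where
  "plane0 p = fst p *\<^sub>R axis 1 1 + snd p *\<^sub>R axis 2 1"

lemma plane0_nth [simp]: "plane0 p $ 1 = fst p" "plane0 p $ 2 = snd p"
  by (simp_all add: plane0_def axis_def)

lemma continuous_on_plane0 [continuous_intros]: "continuous_on S f \<Longrightarrow> continuous_on S (\<lambda>x. plane0 (f x))"
  unfolding plane0_def by (intro continuous_intros)

lemma measurable_plane0 [measurable]: "plane0 \<in> borel_measurable borel"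
  by (intro borel_measurable_continuous_onI continuous_intros)

text \<open>Both measures agree on boxes. This carries integrals over \<open>real^2\<close> to pairs
  of reals, where Fubini and the estimates on squares live.\<close>

lemma lborel_plane0: "lborel = distr lborel borel plane0"
proof (rule lborel_eqI)
  fix l u :: "real^2" assume le: "\<And>b. b \<in> Basis \<Longrightarrow> l \<bullet> b \<le> u \<bullet> b"
  have le': "l $ 1 \<le> u $ 1" "l $ 2 \<le> u $ 2"
    using le[of "axis 1 1"] le[of "axis 2 1"] by (auto simp: Basis_real_2 inner_axis)
  have "plane0 -` box l u = box (l $ 1, l $ 2) (u $ 1, u $ 2)"
    by (auto simp: box_def Basis_real_2 Basis_real_pair inner_axis)
  then have "emeasure (distr lborel borel plane0) (box l u) = emeasure lborel (box (l $ 1, l $ 2) (u $ 1, u $ 2))"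
    by (subst emeasure_distr) auto
  also have "\<dots> = ennreal ((u $ 1 - l $ 1) * (u $ 2 - l $ 2))"
    using le' by (subst emeasure_lborel_box) (auto simp: Basis_real_pair)
  also have "(u $ 1 - l $ 1) * (u $ 2 - l $ 2) = (\<Prod>b\<in>Basis. (u - l) \<bullet> b)"
    by (simp add: Basis_real_2 axis_eq_axis inner_axis)
  finally show "emeasure (distr lborel borel plane0) (box l u) = (\<Prod>b\<in>Basis. (u - l) \<bullet> b)" .
qed simp

text \<open>The chart centred at \<open>x\<close> in which the equation has parameter 1.\<close>

definition plane :: "real^2 \<Rightarrow> real \<Rightarrow> real \<times> real \<Rightarrow> real^2" where
  "plane x \<epsilon> p = x + \<epsilon> *\<^sub>R plane0 p"

lemma continuous_on_plane [continuous_intros]: "continuous_on S f \<Longrightarrow> continuous_on S (\<lambda>p. plane x \<epsilon> (f p))"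
  unfolding plane_def by (intro continuous_intros)

lemma nn_integral_plane:
  assumes \<epsilon>: "0 < \<epsilon>" and f: "f \<in> borel_measurable borel"
  shows "(\<integral>\<^sup>+y. f y \<partial>lborel) = ennreal (\<epsilon>\<^sup>2) * (\<integral>\<^sup>+p. f (plane x \<epsilon> p) \<partial>lborel)"
proof -
  have m: "(\<lambda>y. x + \<epsilon> *\<^sub>R y) \<in> borel_measurable borel" by (intro borel_measurable_continuous_onI continuous_intros)
  have "(\<integral>\<^sup>+y. f y \<partial>lborel) = (\<integral>\<^sup>+y. f y \<partial>density (distr lborel borel (\<lambda>y. x + \<epsilon> *\<^sub>R y)) (\<lambda>_. ennreal (\<epsilon>\<^sup>2)))"
    using lborel_affine[of \<epsilon> x] \<epsilon> by (simp add: ennreal_power)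
  also have "\<dots> = (\<integral>\<^sup>+y. ennreal (\<epsilon>\<^sup>2) * f (x + \<epsilon> *\<^sub>R y) \<partial>lborel)"
    using f m by (subst nn_integral_density) (auto simp: nn_integral_distr)
  also have "\<dots> = ennreal (\<epsilon>\<^sup>2) * (\<integral>\<^sup>+y. f (x + \<epsilon> *\<^sub>R y) \<partial>lborel)"
    by (rule nn_integral_cmult) (use measurable_compose[OF m f] in simp)
  also have "(\<integral>\<^sup>+y. f (x + \<epsilon> *\<^sub>R y) \<partial>lborel) = (\<integral>\<^sup>+y. f (x + \<epsilon> *\<^sub>R y) \<partial>distr lborel borel plane0)"
    by (simp add: lborel_plane0[symmetric])
  also have "\<dots> = (\<integral>\<^sup>+p. f (plane x \<epsilon> p) \<partial>lborel)"
    unfolding plane_def by (rule nn_integral_distr) (use measurable_compose[OF m f] in simp_all)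
  finally show ?thesis .
qed

section \<open>Derivatives in the rescaled coordinates\<close>

lemma norm_jacobian_sq:
  fixes u :: "real^2 \<Rightarrow> real^'k::finite"
  assumes "u differentiable (at y)"
  shows "(norm (jacobian u (at y)))\<^sup>2 = (norm (partial_deriv 1 u y))\<^sup>2 + (norm (partial_deriv 2 u y))\<^sup>2"
proof -
  have "(norm (jacobian u (at y)))\<^sup>2 = (\<Sum>i\<in>UNIV. \<Sum>j\<in>UNIV. (partial_deriv j u y $ i)\<^sup>2)"
    unfolding power2_norm_eq_inner
    by (simp add: inner_vec_def jacobian_def matrix_def partial_deriv_def power2_eq_square)
  also have "\<dots> = (\<Sum>j\<in>UNIV. \<Sum>i\<in>UNIV. (partial_deriv j u y $ i)\<^sup>2)" by (rule sum.swap)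
  also have "\<dots> = (norm (partial_deriv 1 u y))\<^sup>2 + (norm (partial_deriv 2 u y))\<^sup>2"
    unfolding power2_norm_eq_inner by (simp add: UNIV_2 inner_vec_def power2_eq_square)
  finally show ?thesis .
qed

lemma plane_derivs:
  assumes f: "smooth_on f \<Omega>" and p: "plane x \<epsilon> (s,t) \<in> \<Omega>"
  shows "((\<lambda>s. f (plane x \<epsilon> (s,t))) has_vector_derivative \<epsilon> *\<^sub>R partial_deriv 1 f (plane x \<epsilon> (s,t))) (at s)"
    "((\<lambda>t. f (plane x \<epsilon> (s,t))) has_vector_derivative \<epsilon> *\<^sub>R partial_deriv 2 f (plane x \<epsilon> (s,t))) (at t)"
proof -
  note d = has_derivative_partial_deriv[OF f p]
  have "((\<lambda>s. plane x \<epsilon> (s,t)) has_derivative (\<lambda>h. (h * \<epsilon>) *\<^sub>R axis 1 1)) (at s)"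
    unfolding plane_def plane0_def by (auto intro!: derivative_eq_intros simp: scaleR_add_right mult.commute)
  from has_derivative_compose[OF this d]
  show "((\<lambda>s. f (plane x \<epsilon> (s,t))) has_vector_derivative \<epsilon> *\<^sub>R partial_deriv 1 f (plane x \<epsilon> (s,t))) (at s)"
    unfolding has_vector_derivative_def by (rule has_derivative_eq_rhs) (auto simp: fun_eq_iff UNIV_2 axis_def)
  have "((\<lambda>t. plane x \<epsilon> (s,t)) has_derivative (\<lambda>h. (h * \<epsilon>) *\<^sub>R axis 2 1)) (at t)"
    unfolding plane_def plane0_def by (auto intro!: derivative_eq_intros simp: scaleR_add_right mult.commute)
  from has_derivative_compose[OF this d]
  show "((\<lambda>t. f (plane x \<epsilon> (s,t))) has_vector_derivative \<epsilon> *\<^sub>R partial_deriv 2 f (plane x \<epsilon> (s,t))) (at t)"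
    unfolding has_vector_derivative_def by (rule has_derivative_eq_rhs) (auto simp: fun_eq_iff UNIV_2 axis_def)
qed

lemma continuous_on_comp_plane:
  assumes "smooth_on f \<Omega>"
  shows "continuous_on (plane x \<epsilon> -` \<Omega>) (\<lambda>p. f (plane x \<epsilon> p))"
  by (rule continuous_on_compose2[OF smooth_onD(1)[OF assms]]) (auto intro!: continuous_intros)

lemma open_slices:
  fixes D :: "(real \<times> real) set"
  assumes "open D" "(s,t) \<in> D"
  shows "open {s. (s,t) \<in> D}" "open {t. (s,t) \<in> D}"
  using open_vimage[OF assms(1), of "\<lambda>s. (s,t)"] open_vimage[OF assms(1), of "\<lambda>t. (s,t)"]
    continuous_on_Pair[OF continuous_on_id continuous_on_const] continuous_on_Pair[OF continuous_on_const continuous_on_id]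
  by (auto simp: vimage_def)

text \<open>Differentiating the equation in one variable yields third derivatives in an order other
  than that of the locale. Symmetry for the second derivatives comes first; applied once more to
  \<open>w1\<close> and to \<open>w2\<close>, it brings the third derivatives to the required
  form.\<close>

lemma (in potential) planar_of_solution:
  fixes u :: "real^2 \<Rightarrow> 'b"
  assumes \<epsilon>: "0 < \<epsilon>" and \<Omega>: "open \<Omega>" and sm: "smooth_on u \<Omega>"
    and eq: "\<And>y. y \<in> \<Omega> \<Longrightarrow> partial_deriv 1 (partial_deriv 1 u) y + partial_deriv 2 (partial_deriv 2 u) y = (1 / \<epsilon>\<^sup>2) *\<^sub>R dV (u y)"
  shows "\<exists>u11 u12 u22 u111 u122 u112 u222. planar V dV HV Z c d M N H (plane x \<epsilon> -` \<Omega>) (\<lambda>p. u (plane x \<epsilon> p))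
     (\<lambda>p. \<epsilon> *\<^sub>R partial_deriv 1 u (plane x \<epsilon> p)) (\<lambda>p. \<epsilon> *\<^sub>R partial_deriv 2 u (plane x \<epsilon> p)) u11 u12 u22 u111 u122 u112 u222"
proof -
  define D where "D = plane x \<epsilon> -` \<Omega>"
  have D: "open D" unfolding D_def
    by (rule open_vimage[OF \<Omega>]) (intro continuous_intros)
  have inD: "plane x \<epsilon> (s,t) \<in> \<Omega>" if "(s,t) \<in> D" for s t using that by (simp add: D_def)
  define w0 where "w0 p = u (plane x \<epsilon> p)" for p
  define w1 where "w1 p = \<epsilon> *\<^sub>R partial_deriv 1 u (plane x \<epsilon> p)" for p
  define w2 where "w2 p = \<epsilon> *\<^sub>R partial_deriv 2 u (plane x \<epsilon> p)" for p
  define w11 where "w11 p = \<epsilon>\<^sup>2 *\<^sub>R partial_deriv 1 (partial_deriv 1 u) (plane x \<epsilon> p)" for p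
  define w12 where "w12 p = \<epsilon>\<^sup>2 *\<^sub>R partial_deriv 2 (partial_deriv 1 u) (plane x \<epsilon> p)" for p
  define w21 where "w21 p = \<epsilon>\<^sup>2 *\<^sub>R partial_deriv 1 (partial_deriv 2 u) (plane x \<epsilon> p)" for p
  define w22 where "w22 p = \<epsilon>\<^sup>2 *\<^sub>R partial_deriv 2 (partial_deriv 2 u) (plane x \<epsilon> p)" for p
  note smp = smooth_on_partial_deriv
  have s1: "smooth_on (partial_deriv i u) \<Omega>" for i by (intro smp sm)
  have s2: "smooth_on (partial_deriv i (partial_deriv j u)) \<Omega>" for i j by (intro smp sm)
  have s3: "smooth_on (partial_deriv l (partial_deriv i (partial_deriv j u))) \<Omega>" for i j l by (intro smp sm)
  have cc: "continuous_on D (\<lambda>p. k *\<^sub>R f (plane x \<epsilon> p))" if "smooth_on f \<Omega>" for k and f :: "real^2 \<Rightarrow> 'b"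
    using continuous_on_comp_plane[OF that, of x \<epsilon>] unfolding D_def by (intro continuous_intros)
  have ds: "((\<lambda>s. k *\<^sub>R f (plane x \<epsilon> (s,t))) has_vector_derivative (k * \<epsilon>) *\<^sub>R partial_deriv 1 f (plane x \<epsilon> (s,t))) (at s)"
    and dt: "((\<lambda>t. k *\<^sub>R f (plane x \<epsilon> (s,t))) has_vector_derivative (k * \<epsilon>) *\<^sub>R partial_deriv 2 f (plane x \<epsilon> (s,t))) (at t)"
    if "smooth_on f \<Omega>" "(s,t) \<in> D" for k s t and f :: "real^2 \<Rightarrow> 'b"
    using bounded_linear.has_vector_derivative[OF bounded_linear_scaleR_right[of k] plane_derivs(1)[OF that(1) inD[OF that(2)]]]
      bounded_linear.has_vector_derivative[OF bounded_linear_scaleR_right[of k] plane_derivs(2)[OF that(1) inD[OF that(2)]]]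
    by simp_all
  have e2: "\<epsilon> * \<epsilon> = \<epsilon>\<^sup>2" and e3: "\<epsilon>\<^sup>2 * \<epsilon> = \<epsilon>^3" by (simp_all add: power2_eq_square power3_eq_cube)
  have d0: "((\<lambda>s. w0 (s,t)) has_vector_derivative w1 (s,t)) (at s)"
      "((\<lambda>t. w0 (s,t)) has_vector_derivative w2 (s,t)) (at t)" if "(s,t) \<in> D" for s t
    unfolding w0_def w1_def w2_def by (rule plane_derivs[OF sm inD[OF that]])+
  have d1t: "((\<lambda>t. w1 (s,t)) has_vector_derivative w12 (s,t)) (at t)" if "(s,t) \<in> D" for s t
    unfolding w1_def w12_def e2[symmetric] by (rule dt[OF s1 that])
  have d2s: "((\<lambda>s. w2 (s,t)) has_vector_derivative w21 (s,t)) (at s)" if "(s,t) \<in> D" for s t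
    unfolding w2_def w21_def e2[symmetric] by (rule ds[OF s1 that])
  have d1s: "((\<lambda>s. w1 (s,t)) has_vector_derivative w11 (s,t)) (at s)" if "(s,t) \<in> D" for s t
    unfolding w1_def w11_def e2[symmetric] by (rule ds[OF s1 that])
  have d2t: "((\<lambda>t. w2 (s,t)) has_vector_derivative w22 (s,t)) (at t)" if "(s,t) \<in> D" for s t
    unfolding w2_def w22_def e2[symmetric] by (rule dt[OF s1 that])
  have mix: "w12 p = w21 p" if "p \<in> D" for p
  proof -
    obtain s t where p: "p = (s,t)" by (cases p)
    have "w12 (s,t) = w21 (s,t)"
    proof (rule mixed_partials_eq[OF D])
      show "continuous_on D w1" "continuous_on D w2" "continuous_on D w12" "continuous_on D w21"
        unfolding w1_def[abs_def] w2_def[abs_def] w12_def[abs_def] w21_def[abs_def] by (intro cc s1 s2)+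
      show "(s,t) \<in> D" using that p by simp
    qed (rule d0 d1t d2s, assumption)+
    then show ?thesis using p by simp
  qed
  have dw: "((\<lambda>s. w0 (s,t)) has_vector_derivative w1 (s,t)) (at s)"
      "((\<lambda>t. w0 (s,t)) has_vector_derivative w2 (s,t)) (at t)"
      "((\<lambda>s. w1 (s,t)) has_vector_derivative w11 (s,t)) (at s)"
      "((\<lambda>t. w1 (s,t)) has_vector_derivative w12 (s,t)) (at t)"
      "((\<lambda>s. w2 (s,t)) has_vector_derivative w12 (s,t)) (at s)"
      "((\<lambda>t. w2 (s,t)) has_vector_derivative w22 (s,t)) (at t)" if "(s,t) \<in> D" for s t
    using d0[OF that] d1s[OF that] d1t[OF that] d2s[OF that] d2t[OF that] by (simp_all only: mix[OF that])
  define t3 where "t3 i j k p = \<epsilon>^3 *\<^sub>R partial_deriv i (partial_deriv j (partial_deriv k u)) (plane x \<epsilon> p)" for i j k :: 2 and p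
  have ddw: "((\<lambda>s. w11 (s,t)) has_vector_derivative t3 1 1 1 (s,t)) (at s)"
      "((\<lambda>t. w12 (s,t)) has_vector_derivative t3 2 2 1 (s,t)) (at t)"
      "((\<lambda>s. w12 (s,t)) has_vector_derivative t3 1 2 1 (s,t)) (at s)"
      "((\<lambda>t. w22 (s,t)) has_vector_derivative t3 2 2 2 (s,t)) (at t)"
      "((\<lambda>s. w22 (s,t)) has_vector_derivative t3 1 2 2 (s,t)) (at s)"
      "((\<lambda>t. w11 (s,t)) has_vector_derivative t3 2 1 1 (s,t)) (at t)" if "(s,t) \<in> D" for s t
    unfolding w11_def w12_def w22_def t3_def e3[symmetric] by (rule ds[OF s2 that] dt[OF s2 that])+
  have ct3: "continuous_on D (t3 i j k)" for i j k unfolding t3_def[abs_def] by (intro cc s3)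
  have cw: "continuous_on D w0" "continuous_on D w1" "continuous_on D w2" "continuous_on D w11" "continuous_on D w12" "continuous_on D w22"
    using cc[OF sm, of 1] unfolding w0_def[abs_def] w1_def[abs_def] w2_def[abs_def] w11_def[abs_def] w12_def[abs_def] w22_def[abs_def]
    by (simp, (intro cc s1 s2)+)
  have mix2: "t3 2 2 1 (s,t) = t3 1 2 2 (s,t)" if "(s,t) \<in> D" for s t
    by (rule mixed_partials_eq[OF D dw(5,6) ddw(2,5) cw(5,6) ct3 ct3 that])
  have mix1: "t3 2 1 1 (s,t) = t3 1 2 1 (s,t)" if "(s,t) \<in> D" for s t
    by (rule mixed_partials_eq[OF D dw(3,4) ddw(6,3) cw(4,5) ct3 ct3 that])
  have weq: "w11 p + w22 p = dV (w0 p)" if "p \<in> D" for p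
    using eq[of "plane x \<epsilon> p"] that \<epsilon> by (simp add: w11_def w22_def w0_def D_def scaleR_add_right[symmetric])
  have dchain: "((\<lambda>z. dV (f z)) has_vector_derivative HV (f z) f') (at z)"
    if "(f has_vector_derivative f') (at z)" for f f' z
  proof -
    have l: "linear (HV (f z))" using dV_deriv by (rule has_derivative_linear)
    from has_derivative_compose[OF that[unfolded has_vector_derivative_def] dV_deriv] show ?thesis
      unfolding has_vector_derivative_def by (rule has_derivative_eq_rhs) (simp add: fun_eq_iff linear_cmul[OF l])
  qed
  have deq1: "t3 1 1 1 (s,t) + t3 2 2 1 (s,t) = HV (w0 (s,t)) (w1 (s,t))" if st: "(s,t) \<in> D" for s t
  proof -
    have "((\<lambda>s. w11 (s,t) + w22 (s,t)) has_vector_derivative t3 1 1 1 (s,t) + t3 1 2 2 (s,t)) (at s)"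
      by (intro has_vector_derivative_add ddw st)
    then have "((\<lambda>s. dV (w0 (s,t))) has_vector_derivative t3 1 1 1 (s,t) + t3 1 2 2 (s,t)) (at s)"
      by (rule has_vector_derivative_transform_within_open[OF _ open_slices(1)[OF D st]]) (use st weq in auto)
    from vector_derivative_unique_at[OF this dchain[OF dw(1)[OF st]]] show ?thesis using mix2[OF st] by simp
  qed
  have deq2: "t3 1 2 1 (s,t) + t3 2 2 2 (s,t) = HV (w0 (s,t)) (w2 (s,t))" if st: "(s,t) \<in> D" for s t
  proof -
    have "((\<lambda>t. w11 (s,t) + w22 (s,t)) has_vector_derivative t3 2 1 1 (s,t) + t3 2 2 2 (s,t)) (at t)"
      by (intro has_vector_derivative_add ddw st)
    then have "((\<lambda>t. dV (w0 (s,t))) has_vector_derivative t3 2 1 1 (s,t) + t3 2 2 2 (s,t)) (at t)"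
      by (rule has_vector_derivative_transform_within_open[OF _ open_slices(2)[OF D st]]) (use st weq in auto)
    from vector_derivative_unique_at[OF this dchain[OF dw(2)[OF st]]] show ?thesis using mix1[OF st] by simp
  qed
  have "planar V dV HV Z c d M N H D w0 w1 w2 w11 w12 w22 (t3 1 1 1) (t3 2 2 1) (t3 1 2 1) (t3 2 2 2)"
  proof (intro planar.intro potential_axioms planar_axioms.intro)
    fix p :: "real \<times> real" assume "p \<in> D"
    then show "t3 1 1 1 p + t3 2 2 1 p = HV (w0 p) (w1 p)" "t3 1 2 1 p + t3 2 2 2 p = HV (w0 p) (w2 p)"
      using deq1 deq2 by (cases p; simp)+
  qed (fact dw ddw cw weq)+
  then show ?thesis unfolding w0_def[abs_def] w1_def[abs_def] w2_def[abs_def] D_def by blast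
qed

subsection \<open>The clearing-out property\<close>

lemma inj_plane: "0 < \<epsilon> \<Longrightarrow> plane x \<epsilon> p = plane x \<epsilon> q \<Longrightarrow> p = q"
  by (metis add_left_cancel less_irrefl plane0_nth plane_def prod_eqI scaleR_cancel_left)

lemma dist_plane:
  assumes "0 < \<epsilon>" "p \<in> sq \<rho>"
  shows "dist x (plane x \<epsilon> p) \<le> 2 * (\<rho> * \<epsilon>)"
proof -
  have "norm (plane0 p) \<le> \<bar>fst p\<bar> + \<bar>snd p\<bar>"
    unfolding plane0_def by (rule order_trans[OF norm_triangle_ineq]) simp
  also have "\<dots> \<le> 2 * \<rho>" using assms(2) by (cases p) (auto simp: mem_sq)
  finally have "\<epsilon> * norm (plane0 p) \<le> \<epsilon> * (2 * \<rho>)" using assms(1) by (intro mult_left_mono) auto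
  then show ?thesis using assms(1) by (simp add: plane_def dist_norm mult_ac)
qed

lemma plane_covers:
  assumes "0 < \<epsilon>" "dist x y \<le> \<rho> * \<epsilon>"
  shows "y \<in> plane x \<epsilon> ` sq \<rho>"
proof
  define p where "p = ((y $ 1 - x $ 1) / \<epsilon>, (y $ 2 - x $ 2) / \<epsilon>)"
  have "\<bar>(y - x) $ i\<bar> \<le> \<rho> * \<epsilon>" for i
    using component_le_norm_cart[of "y - x" i] assms(2) by (simp add: dist_norm norm_minus_commute)
  from this[of 1] this[of 2] show "p \<in> sq \<rho>"
    using assms(1) by (simp add: p_def mem_sq abs_divide pos_divide_le_eq)
  show "y = plane x \<epsilon> p"
    using assms(1) by (simp add: vec_eq_iff forall_2 plane_def p_def)
qed

text \<open>The area scales by \<epsilon>^2 and the density by 1 / \<epsilon>, which leaves one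
  factor \<epsilon>. Measurability is claimed for the density times the indicator, since
  \<open>u\<close> is controlled on \<Omega> alone; it is used when the integral of a sum over
  covering squares is split.\<close>

lemma energy_plane_sq:
  fixes V :: "real^'k::finite \<Rightarrow> real" and u :: "real^2 \<Rightarrow> real^'k"
  assumes \<epsilon>: "0 < \<epsilon>" and sm: "smooth_on u \<Omega>" and sub: "sq \<rho> \<subseteq> plane x \<epsilon> -` \<Omega>"
    and V: "\<And>y. 0 \<le> V y" "continuous_on UNIV V"
  defines "e \<equiv> \<lambda>p. ((norm (\<epsilon> *\<^sub>R partial_deriv 1 u (plane x \<epsilon> p)))\<^sup>2 + (norm (\<epsilon> *\<^sub>R partial_deriv 2 u (plane x \<epsilon> p)))\<^sup>2) / 2
      + V (u (plane x \<epsilon> p))"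
  shows "(\<lambda>y. ennreal (energy_density V \<epsilon> u y) * indicator (plane x \<epsilon> ` sq \<rho>) y) \<in> borel_measurable borel"
    "energy V \<epsilon> u (plane x \<epsilon> ` sq \<rho>) = ennreal (\<epsilon> * integral (sq \<rho>) e)"
proof -
  let ?S = "plane x \<epsilon> ` sq \<rho>"
  define h where "h y = \<epsilon> * ((norm (partial_deriv 1 u y))\<^sup>2 + (norm (partial_deriv 2 u y))\<^sup>2) / 2 + 1 / \<epsilon> * V (u y)" for y
  have S\<Omega>: "?S \<subseteq> \<Omega>" using sub by auto
  have "compact ?S" unfolding sq_def by (intro compact_continuous_image continuous_intros compact_cbox)
  then have Sb: "?S \<in> sets borel" by (intro borel_closed compact_imp_closed)
  have c1: "continuous_on ?S u" "continuous_on ?S (partial_deriv i u)" for i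
    using smooth_onD(1)[OF sm] smooth_onD(1)[OF smooth_on_partial_deriv[OF sm]] S\<Omega> continuous_on_subset by blast+
  have "continuous_on ?S h" unfolding h_def[abs_def]
    by (intro continuous_intros c1 continuous_on_compose2[OF V(2) c1(1)]) auto
  from borel_measurable_continuous_on_indicator[OF Sb this]
  have hm: "(\<lambda>y. indicator ?S y *\<^sub>R h y) \<in> borel_measurable borel" .
  have dh: "ennreal (energy_density V \<epsilon> u y) * indicator ?S y = ennreal (indicator ?S y *\<^sub>R h y)" for y
  proof (cases "y \<in> ?S")
    case True
    then have "u differentiable (at y)" using S\<Omega> smooth_onD(2)[OF sm] by blast
    then show ?thesis using True by (simp add: energy_density_def norm_jacobian_sq h_def)
  qed simp
  show "(\<lambda>y. ennreal (energy_density V \<epsilon> u y) * indicator ?S y) \<in> borel_measurable borel"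
    unfolding dh by (rule measurable_compose[OF hm measurable_ennreal])
  have "energy V \<epsilon> u ?S = (\<integral>\<^sup>+y. ennreal (indicator ?S y *\<^sub>R h y) \<partial>lborel)"
    unfolding energy_def dh ..
  also have "\<dots> = ennreal (\<epsilon>\<^sup>2) * (\<integral>\<^sup>+p. ennreal (indicator ?S (plane x \<epsilon> p) *\<^sub>R h (plane x \<epsilon> p)) \<partial>lborel)"
    by (rule nn_integral_plane[OF \<epsilon> measurable_compose[OF hm measurable_ennreal]])
  also have "(\<integral>\<^sup>+p. ennreal (indicator ?S (plane x \<epsilon> p) *\<^sub>R h (plane x \<epsilon> p)) \<partial>lborel) = (\<integral>\<^sup>+p. ennreal (e p / \<epsilon>) * indicator (sq \<rho>) p \<partial>lborel)"
  proof (rule nn_integral_cong)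
    fix p
    have "plane x \<epsilon> p \<in> ?S \<longleftrightarrow> p \<in> sq \<rho>" using inj_plane[OF \<epsilon>] by blast
    moreover have "h (plane x \<epsilon> p) = e p / \<epsilon>" using \<epsilon> by (simp add: h_def e_def power2_eq_square field_simps)
    ultimately show "ennreal (indicator ?S (plane x \<epsilon> p) *\<^sub>R h (plane x \<epsilon> p)) = ennreal (e p / \<epsilon>) * indicator (sq \<rho>) p"
      by (simp add: indicator_def)
  qed
  also have "\<dots> = ennreal (integral (sq \<rho>) (\<lambda>p. e p / \<epsilon>))"
  proof (rule nn_integral_has_integral_lebesgue')
    show "0 \<le> e p / \<epsilon>" for p using V(1) \<epsilon> by (simp add: e_def)
    have c: "continuous_on (sq \<rho>) (\<lambda>p. f (plane x \<epsilon> p))" if "smooth_on f \<Omega>" for f :: "real^2 \<Rightarrow> real^'k"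
      by (rule continuous_on_subset[OF continuous_on_comp_plane[OF that] sub])
    have "continuous_on (sq \<rho>) e" unfolding e_def
      by (intro continuous_intros c sm smooth_on_partial_deriv continuous_on_compose2[OF V(2) c[OF sm]]) auto
    then have "continuous_on (sq \<rho>) (\<lambda>p. e p / \<epsilon>)" using \<epsilon> by (intro continuous_intros) auto
    then show "((\<lambda>p. e p / \<epsilon>) has_integral integral (sq \<rho>) (\<lambda>p. e p / \<epsilon>)) (sq \<rho>)"
      unfolding sq_def by (intro integrable_integral integrable_continuous)
  qed
  also have "integral (sq \<rho>) (\<lambda>p. e p / \<epsilon>) = integral (sq \<rho>) e / \<epsilon>" by (rule integral_divide)
  also have "ennreal (\<epsilon>\<^sup>2) * ennreal (integral (sq \<rho>) e / \<epsilon>) = ennreal (\<epsilon> * integral (sq \<rho>) e)"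
    using \<epsilon> by (subst ennreal_mult'[symmetric]) (auto simp: power2_eq_square)
  finally show "energy V \<epsilon> u ?S = ennreal (\<epsilon> * integral (sq \<rho>) e)" .
qed

lemma energy_mono: "A \<subseteq> B \<Longrightarrow> energy V \<epsilon> u A \<le> energy V \<epsilon> u B"
  unfolding energy_def by (intro nn_integral_mono) (auto simp: indicator_def)

section \<open>From small energy to small potential at a point\<close>

lemma planar_at_point:
  fixes V :: "real^'k::finite \<Rightarrow> real" and u :: "real^2 \<Rightarrow> real^'k"
  assumes pot: "potential V (gradient V) (hess_map V) (zero_set V) c d M N H"
    and \<Omega>: "open \<Omega>" and \<epsilon>: "0 < \<epsilon>" and sol: "allen_cahn_solution V \<epsilon> \<Omega> u"
  obtains u11 u12 u22 u111 u122 u112 u222 where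
    "planar V (gradient V) (hess_map V) (zero_set V) c d M N H (plane x \<epsilon> -` \<Omega>) (\<lambda>p. u (plane x \<epsilon> p))
     (\<lambda>p. \<epsilon> *\<^sub>R partial_deriv 1 u (plane x \<epsilon> p)) (\<lambda>p. \<epsilon> *\<^sub>R partial_deriv 2 u (plane x \<epsilon> p)) u11 u12 u22 u111 u122 u112 u222"
proof -
  have "partial_deriv 1 (partial_deriv 1 u) y + partial_deriv 2 (partial_deriv 2 u) y = (1 / \<epsilon>\<^sup>2) *\<^sub>R gradient V (u y)"
    if "y \<in> \<Omega>" for y
  proof -
    have "- laplacian u y = - ((1 / \<epsilon>\<^sup>2) *\<^sub>R gradient V (u y))" using sol that unfolding allen_cahn_solution_def by blast
    then have "laplacian u y = (1 / \<epsilon>\<^sup>2) *\<^sub>R gradient V (u y)" by (rule neg_equal_iff_equal[THEN iffD1])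
    then show ?thesis by (simp add: laplacian_def UNIV_2)
  qed
  moreover have "smooth_on u \<Omega>" using sol by (simp add: allen_cahn_solution_def)
  ultimately show ?thesis using potential.planar_of_solution[OF pot \<epsilon> \<Omega>, of u x] that by blast
qed

text \<open>The squares are centred at the point \<open>x\<close> under consideration, so each point
  of the smaller disc is reached by its own chain of scales, ending with
  \<open>potential_at_center\<close>.\<close>

lemma small_energy_imp_small_potential:
  fixes V :: "real^'k::finite \<Rightarrow> real"
  assumes pot: "potential V (gradient V) (hess_map V) (zero_set V) c d M N H" and \<delta>s: "0 < \<delta>s"
  obtains \<eta> where "0 < \<eta>"
    "\<And>\<Omega> x0 \<epsilon> r (u :: real^2 \<Rightarrow> real^'k) x. open \<Omega> \<Longrightarrow> 0 < \<epsilon> \<Longrightarrow> \<epsilon> \<le> r \<Longrightarrow> ball x0 r \<subseteq> \<Omega> \<Longrightarrow>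
      allen_cahn_solution V \<epsilon> \<Omega> u \<Longrightarrow> energy V \<epsilon> u (ball x0 r) \<le> ennreal (\<eta> * r) \<Longrightarrow> x \<in> ball x0 (3 * r / 4) \<Longrightarrow> V (u x) \<le> \<delta>s"
proof -
  interpret potential V "gradient V" "hess_map V" "zero_set V" c d M N H by (rule pot)
  obtain \<tau> \<delta> \<delta>0 m1 where \<tau>: "0 < \<tau>" "\<tau> \<le> 1/2" "well_level \<tau> \<delta>" and \<delta>0: "well_level (1/2) \<delta>0" and m1: "1 \<le> m1"
    and dec: "\<And>m. m1 \<le> m \<Longrightarrow> decay_const1 \<delta>0 * (96 * (card (zero_set V) * (16 * \<tau> + 2 / (m * c))) / c\<^sup>2) + decay_const2 / m \<le> 1/4"
    using decay_parameters by blast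
  have \<delta>pos: "0 < \<delta>" "0 < \<delta>0" using \<tau>(3) \<delta>0 by (auto simp: well_level_def)
  define K where "K = 2 * N * sqrt (G (1/64))"
  \<comment> \<open>Chosen so that the Lipschitz error in \<open>potential_at_center\<close> is at
    most \<delta>s / 2.\<close>
  define \<rho> where "\<rho> = min (3/64) (\<delta>s / (2 * (\<bar>K\<bar> + 1)))"
  have \<rho>: "0 < \<rho>" "\<rho> \<le> 3/64" unfolding \<rho>_def by (use \<delta>s in simp, rule min.cobounded1)
  have "K * \<rho> \<le> (\<bar>K\<bar> + 1) * (\<delta>s / (2 * (\<bar>K\<bar> + 1)))" using \<rho> by (intro mult_mono) (auto simp: \<rho>_def)
  also have "\<dots> = \<delta>s / 2" by (simp add: field_simps)
  finally have K\<rho>: "K * \<rho> \<le> \<delta>s / 2" .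
  \<comment> \<open>The first entry admits every decay step, the second the pointwise bounds on the
    last square (m = 1/32), and the third keeps the energy divided by 4 \<rho>^2 below \<delta>s /
    2.\<close>
  define \<eta>1 where "\<eta>1 = min (c * \<delta> / 384) (min (c * \<delta>0 / 384 / 32 / m1) (2 * \<rho>\<^sup>2 * \<delta>s / m1))"
  have \<eta>1: "0 < \<eta>1" "\<eta>1 \<le> c * \<delta> / 384" "\<eta>1 \<le> c * \<delta>0 / 384 / 32 / m1" "\<eta>1 \<le> 2 * \<rho>\<^sup>2 * \<delta>s / m1"
    unfolding \<eta>1_def using c \<delta>pos m1 \<rho> \<delta>s by auto
  have \<eta>m1: "\<eta>1 * m1 \<le> c * \<delta>0 / 384 / 32" "\<eta>1 * m1 \<le> 2 * \<rho>\<^sup>2 * \<delta>s"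
    using \<eta>1(3,4) m1 by (auto simp: pos_le_divide_eq)
  have "V (u x) \<le> \<delta>s" if \<Omega>: "open \<Omega>" and \<epsilon>: "0 < \<epsilon>" "\<epsilon> \<le> r" and bs: "ball x0 r \<subseteq> \<Omega>"
    and sol: "allen_cahn_solution V \<epsilon> \<Omega> u" and en: "energy V \<epsilon> u (ball x0 r) \<le> ennreal (\<eta>1 / 32 * r)" and x: "x \<in> ball x0 (3 * r / 4)"
    for \<Omega> x0 \<epsilon> r x and u :: "real^2 \<Rightarrow> real^'k"
  proof -
    obtain u11 u12 u22 u111 u122 u112 u222 where
      "planar V (gradient V) (hess_map V) (zero_set V) c d M N H (plane x \<epsilon> -` \<Omega>) (\<lambda>p. u (plane x \<epsilon> p))
       (\<lambda>p. \<epsilon> *\<^sub>R partial_deriv 1 u (plane x \<epsilon> p)) (\<lambda>p. \<epsilon> *\<^sub>R partial_deriv 2 u (plane x \<epsilon> p)) u11 u12 u22 u111 u122 u112 u222"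
      using planar_at_point[OF pot \<Omega> \<epsilon>(1) sol] by blast
    then interpret P: planar V "gradient V" "hess_map V" "zero_set V" c d M N H "plane x \<epsilon> -` \<Omega>" "\<lambda>p. u (plane x \<epsilon> p)"
       "\<lambda>p. \<epsilon> *\<^sub>R partial_deriv 1 u (plane x \<epsilon> p)" "\<lambda>p. \<epsilon> *\<^sub>R partial_deriv 2 u (plane x \<epsilon> p)" u11 u12 u22 u111 u122 u112 u222 .
    have sm: "smooth_on u \<Omega>" using sol by (simp add: allen_cahn_solution_def)
    \<comment> \<open>The largest square has physical half side 4 m \<epsilon> = r / 8, so it stays
      within r / 4 of \<open>x\<close> and inside the disc of radius r; \<epsilon> \<le> r gives m
      \<ge> 1/32. The same 32 turns the energy hypothesis into E \<le> \<eta>1 m.\<close>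
    define m where "m = r / \<epsilon> / 32"
    have m: "1/32 \<le> m" using \<epsilon> by (simp add: m_def)
    have r: "4 * m * \<epsilon> = r / 8" using \<epsilon> by (simp add: m_def)
    have Tb: "plane x \<epsilon> ` sq (4 * m) \<subseteq> ball x0 r"
    proof
      fix y assume "y \<in> plane x \<epsilon> ` sq (4 * m)"
      then have "dist x y \<le> r / 4" using dist_plane[OF \<epsilon>(1), of _ "4*m" x] r by fastforce
      moreover have "dist x0 x < 3 * r / 4" using x by simp
      ultimately show "y \<in> ball x0 r" using dist_triangle[of x0 y x] by simp
    qed
    then have sub: "sq (4*m) \<subseteq> plane x \<epsilon> -` \<Omega>" using bs by auto
    have cV: "continuous_on UNIV V" using continuous_on_V[OF continuous_on_id] .
    have "ennreal (\<epsilon> * P.E (4*m)) = energy V \<epsilon> u (plane x \<epsilon> ` sq (4*m))"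
      unfolding P.E_def P.e_def[abs_def] P.w_def using energy_plane_sq(2)[OF \<epsilon>(1) sm sub V_nonneg cV] by simp
    also have "\<dots> \<le> ennreal (\<eta>1 / 32 * r)" using energy_mono[OF Tb] en order_trans by blast
    finally have "\<epsilon> * P.E (4*m) \<le> \<eta>1 / 32 * r" using \<eta>1(1) \<epsilon> by (simp add: ennreal_le_iff)
    then have E: "P.E (4*m) \<le> \<eta>1 * m" using \<epsilon>(1) by (simp add: m_def field_simps)
    have E8: "P.E (1/8) \<le> \<eta>1 * m1"
    proof (rule P.energy_iteration[OF m1 less_imp_le[OF \<eta>1(1)] _ m sub E])
      fix m' assume m': "m1 \<le> m'" "sq (4*m') \<subseteq> plane x \<epsilon> -` \<Omega>" "P.E (4*m') \<le> \<eta>1 * m'"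
      have "P.E (4*m') \<le> c * \<delta> / 384 * m'" using m'(3) mult_right_mono[OF \<eta>1(2), of m'] m'(1) m1 by linarith
      then have "P.E m' \<le> (decay_const1 \<delta>0 * (96 * (card (zero_set V) * (16 * \<tau> + 2 / (m' * c))) / c\<^sup>2) + decay_const2 / m') * P.E (4*m')"
        using m' m1 by (intro P.energy_decay[OF _ m'(2) \<tau>(1,3,2) _ \<delta>0]) auto
      also have "\<dots> \<le> 1/4 * P.E (4*m')" by (rule mult_right_mono[OF dec[OF m'(1)] P.E_nonneg[OF m'(2)]])
      finally show "P.E m' \<le> 1/4 * P.E (4*m')" .
    qed
    have s8: "sq (1/8) \<subseteq> plane x \<epsilon> -` \<Omega>" using sub sq_mono[of "1/8" "4*m"] m by auto
    have "V (u (plane x \<epsilon> (0,0))) \<le> P.E (1/8) / (4 * \<rho>\<^sup>2) + 2 * N * sqrt (G (1/64)) * \<rho>"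
      using E8 \<eta>m1(1) by (intro P.potential_at_center[OF s8 \<delta>0 _ \<rho>]) auto
    also have "\<dots> \<le> \<delta>s / 2 + \<delta>s / 2"
    proof (rule add_mono)
      have "P.E (1/8) \<le> 2 * \<rho>\<^sup>2 * \<delta>s" using E8 \<eta>m1(2) by linarith
      then show "P.E (1/8) / (4 * \<rho>\<^sup>2) \<le> \<delta>s / 2" using \<rho> by (simp add: field_simps)
      show "2 * N * sqrt (G (1/64)) * \<rho> \<le> \<delta>s / 2" using K\<rho> by (simp add: K_def)
    qed
    finally show ?thesis by (simp add: plane_def plane0_def)
  qed
  then show ?thesis using \<eta>1(1) by (intro that[of "\<eta>1 / 32"]) auto
qed

text \<open>The closed ball about one centre and the union of the other closed balls are disjoint
  closed sets covering \<open>S\<close>, so one of the two misses it.\<close>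

lemma connected_near_one_point:
  fixes S :: "'a::metric_space set"
  assumes "connected S" "S \<noteq> {}" "finite Z" and cover: "\<And>y. y \<in> S \<Longrightarrow> \<exists>\<sigma>\<in>Z. dist \<sigma> y \<le> k"
    and disj: "\<And>\<sigma> \<sigma>'. \<sigma> \<in> Z \<Longrightarrow> \<sigma>' \<in> Z \<Longrightarrow> \<sigma> \<noteq> \<sigma>' \<Longrightarrow> cball \<sigma> k \<inter> cball \<sigma>' k = {}"
  obtains \<sigma> where "\<sigma> \<in> Z" "\<And>y. y \<in> S \<Longrightarrow> dist \<sigma> y \<le> k"
proof -
  obtain y0 where y0: "y0 \<in> S" using assms(2) by blast
  then obtain \<sigma> where \<sigma>: "\<sigma> \<in> Z" "dist \<sigma> y0 \<le> k" using cover by blast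
  define B where "B = (\<Union>\<sigma>'\<in>Z - {\<sigma>}. cball \<sigma>' k)"
  have "closed B" unfolding B_def using assms(3) by (intro closed_UN) auto
  moreover have "S \<subseteq> cball \<sigma> k \<union> B" using cover by (force simp: B_def)
  moreover have "cball \<sigma> k \<inter> B = {}" using disj \<sigma>(1) by (auto simp: B_def)
  ultimately have "cball \<sigma> k \<inter> S = {} \<or> B \<inter> S = {}"
    using connected_closedD[OF assms(1), of "cball \<sigma> k" B] by auto
  then have "B \<inter> S = {}" using y0 \<sigma>(2) by auto
  then have "dist \<sigma> y \<le> k" if "y \<in> S" for y using \<open>S \<subseteq> cball \<sigma> k \<union> B\<close> that by auto
  then show ?thesis using \<sigma>(1) that by blast
qed

theorem proposition4:
  fixes V :: "real^'k::finite \<Rightarrow> real" and \<mu>\<^sub>0 :: real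
  assumes "multi_well_potential V" and "well_radius V \<mu>\<^sub>0"
  shows "\<exists>\<eta>\<^sub>0>0. \<exists>C\<^sub>n\<^sub>r\<^sub>g>0.
    \<forall>(\<Omega> :: (real^2) set) x\<^sub>0 \<epsilon> r (u :: real^2 \<Rightarrow> real^'k).
      smooth_bounded_domain \<Omega> \<longrightarrow> x\<^sub>0 \<in> \<Omega> \<longrightarrow> 0 < \<epsilon> \<longrightarrow> \<epsilon> \<le> r \<longrightarrow> ball x\<^sub>0 r \<subseteq> \<Omega> \<longrightarrow>
      allen_cahn_solution V \<epsilon> \<Omega> u \<longrightarrow>
      energy V \<epsilon> u (ball x\<^sub>0 r) / ennreal r \<le> ennreal \<eta>\<^sub>0 \<longrightarrow>
      (\<exists>\<sigma>\<in>zero_set V.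
         (\<forall>x\<in>ball x\<^sub>0 (3 * r / 4). norm (u x - \<sigma>) \<le> \<mu>\<^sub>0 / 2) \<and>
         energy V \<epsilon> u (ball x\<^sub>0 (5 * r / 8))
           \<le> ennreal (C\<^sub>n\<^sub>r\<^sub>g * (\<epsilon> / r)) * energy V \<epsilon> u (ball x\<^sub>0 r))"
proof -
  have \<mu>: "0 < \<mu>\<^sub>0" and sep: "disjoint_family_on (\<lambda>\<sigma>. ball \<sigma> (2 * \<mu>\<^sub>0)) (zero_set V)"
    using assms(2) by (auto simp: well_radius_def)
  obtain c d M N H where pot: "potential V (gradient V) (hess_map V) (zero_set V) c d M N H" and d\<mu>: "d \<le> \<mu>\<^sub>0 / 2"
    using multi_well_potential_locale[OF assms(1) half_gt_zero[OF \<mu>]] by blast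
  interpret potential V "gradient V" "hess_map V" "zero_set V" c d M N H by (rule pot)
  \<comment> \<open>The distance to the well demanded by \<open>energy_decay_near_well\<close>; it
    also lies below \<open>d\<close>, hence below \<open>\<mu>\<^sub>0 / 2\<close>.\<close>
  define k where "k = sqrt (well_scale (1/2) * (c / 8))"
  have k: "0 < k" "k\<^sup>2 = well_scale (1/2) * (c / 8)" using well_scale(1)[of "1/2"] c by (auto simp: k_def)
  have "k\<^sup>2 \<le> d\<^sup>2 * 1" unfolding k(2) using well_scale[of "1/2"] c by (intro mult_mono) auto
  then have "k\<^sup>2 \<le> d\<^sup>2" by simp
  from power2_le_imp_le[OF this] have "k \<le> d" using d by simp
  then have k\<mu>: "k \<le> \<mu>\<^sub>0 / 2" using d\<mu> by simp
  obtain \<delta> where \<delta>: "0 < \<delta>" "\<And>y. V y < \<delta> \<Longrightarrow> \<exists>\<sigma>\<in>zero_set V. norm (y - \<sigma>) \<le> k" using near_well[OF k(1)] by blast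
  obtain \<eta> where \<eta>: "0 < \<eta>"
    "\<And>\<Omega> x0 \<epsilon> r (u :: real^2 \<Rightarrow> real^'k) x. open \<Omega> \<Longrightarrow> 0 < \<epsilon> \<Longrightarrow> \<epsilon> \<le> r \<Longrightarrow> ball x0 r \<subseteq> \<Omega> \<Longrightarrow>
      allen_cahn_solution V \<epsilon> \<Omega> u \<Longrightarrow> energy V \<epsilon> u (ball x0 r) \<le> ennreal (\<eta> * r) \<Longrightarrow> x \<in> ball x0 (3 * r / 4) \<Longrightarrow> V (u x) \<le> \<delta> / 2"
    using small_energy_imp_small_potential[OF pot half_gt_zero[OF \<delta>(1)]] by blast
  \<comment> \<open>A finite net for the normalised disc, fixed in advance, so that the number of
    squares and hence the constant depend neither on the solution nor on \<epsilon> and r.\<close>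
  obtain A where A: "finite A" "A \<subseteq> cball (0 :: real^2) (5/8)" "cball 0 (5/8) \<subseteq> (\<Union>p\<in>A. ball p (1/64))"
  proof (rule compactE_image[OF compact_cball, of "cball 0 (5/8)" "\<lambda>p. ball p (1/64)"])
    show "cball (0 :: real^2) (5/8) \<subseteq> (\<Union>p\<in>cball 0 (5/8). ball p (1/64))"
    proof
      fix p :: "real^2" assume "p \<in> cball 0 (5/8)"
      moreover have "p \<in> ball p (1/64)" by simp
      ultimately show "p \<in> (\<Union>p\<in>cball 0 (5/8). ball p (1/64))" by blast
    qed
  next
    fix A :: "(real^2) set" assume "A \<subseteq> cball 0 (5/8)" "finite A" "cball 0 (5/8) \<subseteq> (\<Union>p\<in>A. ball p (1/64))"
    then show thesis by (intro that[of A])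
  qed simp
  \<comment> \<open>1024 = 32 * 32: one factor comes from \<open>energy_decay_near_well\<close>, the
    other from the side \<rho> = r / (32 \<epsilon>) of the squares. The added 1 makes positivity
    immediate.\<close>
  define C where "C = card A * (1024 / c^3) + 1"
  have C: "0 < C" using c by (simp add: C_def add_nonneg_pos)
  have main: "\<exists>\<sigma>\<in>zero_set V. (\<forall>x\<in>ball x0 (3 * r / 4). norm (u x - \<sigma>) \<le> \<mu>\<^sub>0 / 2) \<and>
         energy V \<epsilon> u (ball x0 (5 * r / 8)) \<le> ennreal (C * (\<epsilon> / r)) * energy V \<epsilon> u (ball x0 r)"
    if dom: "smooth_bounded_domain \<Omega>" and \<epsilon>: "0 < \<epsilon>" "\<epsilon> \<le> r" and bs: "ball x0 r \<subseteq> \<Omega>"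
      and sol: "allen_cahn_solution V \<epsilon> \<Omega> u" and en: "energy V \<epsilon> u (ball x0 r) / ennreal r \<le> ennreal \<eta>"
    for \<Omega> x0 \<epsilon> r and u :: "real^2 \<Rightarrow> real^'k"
  proof -
    have \<Omega>: "open \<Omega>" using dom by (simp add: smooth_bounded_domain_def)
    have sm: "smooth_on u \<Omega>" using sol by (simp add: allen_cahn_solution_def)
    have r: "0 < r" using \<epsilon> by simp
    have "energy V \<epsilon> u (ball x0 r) = energy V \<epsilon> u (ball x0 r) / ennreal r * ennreal r"
      using r unfolding ennreal_divide_times by (subst ennreal_divide_self) auto
    also have "\<dots> \<le> ennreal \<eta> * ennreal r" by (intro mult_right_mono en) simp
    also have "\<dots> = ennreal (\<eta> * r)" using \<eta>(1) r by (simp add: ennreal_mult')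
    finally have en': "energy V \<epsilon> u (ball x0 r) \<le> ennreal (\<eta> * r)" .
    have Vs: "V (u x) < \<delta>" if "x \<in> ball x0 (3 * r / 4)" for x
      using \<eta>(2)[OF \<Omega> \<epsilon> bs sol en' that] \<delta>(1) by linarith
    have b34: "ball x0 (3 * r / 4) \<subseteq> \<Omega>" using bs r by (auto simp: subset_iff)
    have cu: "continuous_on (ball x0 (3 * r / 4)) u" by (rule continuous_on_subset[OF smooth_onD(1)[OF sm] b34])
    \<comment> \<open>Small potential alone could lead to different wells at different points;
      connectedness of the image and disjointness of the balls of radius
      \<open>2 * \<mu>\<^sub>0\<close> exclude this.\<close>
    obtain \<sigma> where \<sigma>: "\<sigma> \<in> zero_set V" "\<And>y. y \<in> u ` ball x0 (3 * r / 4) \<Longrightarrow> dist \<sigma> y \<le> k"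
    proof (rule connected_near_one_point[OF _ _ finite_Z])
      show "connected (u ` ball x0 (3 * r / 4))" by (intro connected_continuous_image cu connected_ball)
      show "u ` ball x0 (3 * r / 4) \<noteq> {}" using r by simp
      show "\<exists>\<sigma>\<in>zero_set V. dist \<sigma> y \<le> k" if "y \<in> u ` ball x0 (3 * r / 4)" for y
      proof -
        have "V y < \<delta>" using that Vs by blast
        then obtain \<sigma> where "\<sigma> \<in> zero_set V" "norm (y - \<sigma>) \<le> k" using \<delta>(2) by blast
        then show ?thesis by (intro bexI[of _ \<sigma>]) (simp_all add: dist_norm norm_minus_commute)
      qed
      show "cball \<sigma> k \<inter> cball \<sigma>' k = {}" if "\<sigma> \<in> zero_set V" "\<sigma>' \<in> zero_set V" "\<sigma> \<noteq> \<sigma>'" for \<sigma> \<sigma>'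
      proof -
        have "ball \<sigma> (2 * \<mu>\<^sub>0) \<inter> ball \<sigma>' (2 * \<mu>\<^sub>0) = {}" using sep that by (auto simp: disjoint_family_on_def)
        moreover have "cball z k \<subseteq> ball z (2 * \<mu>\<^sub>0)" for z :: "real^'k" using k\<mu> \<mu> by auto
        ultimately show ?thesis by blast
      qed
    qed blast
    have near: "norm (u x - \<sigma>) \<le> k" if "x \<in> ball x0 (3 * r / 4)" for x
      using \<sigma>(2)[of "u x"] that by (auto simp: dist_norm norm_minus_commute)
    \<comment> \<open>Squares of physical half side r / 32 centred in the disc of radius 5 r / 8
      stay within (5/8 + 1/16) r < 3 r / 4 of x0, where \<open>u\<close> is near \<sigma>. Their
      concentric halves, of half side r / 64, cover that disc by the choice of the net.\<close>
    define \<rho> where "\<rho> = r / \<epsilon> / 32"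
    have \<rho>: "0 < \<rho>" "\<rho> * \<epsilon> = r / 32" using \<epsilon> r by (auto simp: \<rho>_def)
    define Q where "Q p = plane (x0 + r *\<^sub>R p) \<epsilon> ` sq (\<rho>/2)" for p
    have local: "energy V \<epsilon> u (Q p) \<le> ennreal (1024 / c^3 * (\<epsilon> / r)) * energy V \<epsilon> u (ball x0 r)"
      and Qm: "(\<lambda>y. ennreal (energy_density V \<epsilon> u y) * indicator (Q p) y) \<in> borel_measurable borel" if p: "p \<in> A" for p
    proof -
      define x where "x = x0 + r *\<^sub>R p"
      have "norm p \<le> 5/8" using A(2) p by auto
      then have dx: "dist x0 x \<le> r * (5/8)" using r by (simp add: x_def dist_norm mult_left_mono)
      obtain u11 u12 u22 u111 u122 u112 u222 where
        "planar V (gradient V) (hess_map V) (zero_set V) c d M N H (plane x \<epsilon> -` \<Omega>) (\<lambda>p. u (plane x \<epsilon> p))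
         (\<lambda>p. \<epsilon> *\<^sub>R partial_deriv 1 u (plane x \<epsilon> p)) (\<lambda>p. \<epsilon> *\<^sub>R partial_deriv 2 u (plane x \<epsilon> p)) u11 u12 u22 u111 u122 u112 u222"
        using planar_at_point[OF pot \<Omega> \<epsilon>(1) sol] by blast
      then interpret P: planar V "gradient V" "hess_map V" "zero_set V" c d M N H "plane x \<epsilon> -` \<Omega>" "\<lambda>p. u (plane x \<epsilon> p)"
         "\<lambda>p. \<epsilon> *\<^sub>R partial_deriv 1 u (plane x \<epsilon> p)" "\<lambda>p. \<epsilon> *\<^sub>R partial_deriv 2 u (plane x \<epsilon> p)" u11 u12 u22 u111 u122 u112 u222 .
      have T: "plane x \<epsilon> q \<in> ball x0 (3 * r / 4)" if "q \<in> sq \<rho>" for q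
      proof -
        have "dist x (plane x \<epsilon> q) \<le> 2 * (r / 32)" using dist_plane[OF \<epsilon>(1) that, of x] by (simp add: \<rho>(2))
        then show ?thesis using dist_triangle[of x0 "plane x \<epsilon> q" x] dx r by simp
      qed
      have sub: "sq \<rho> \<subseteq> plane x \<epsilon> -` \<Omega>" using T b34 by blast
      have sub2: "sq (\<rho>/2) \<subseteq> plane x \<epsilon> -` \<Omega>" using sub sq_mono[of "\<rho>/2" \<rho>] \<rho> by auto
      have Tb: "plane x \<epsilon> ` sq \<rho> \<subseteq> ball x0 r" using T r by (force simp: image_subset_iff)
      have cV: "continuous_on UNIV V" using continuous_on_V[OF continuous_on_id] .
      have en: "energy V \<epsilon> u (plane x \<epsilon> ` sq \<rho>') = ennreal (\<epsilon> * P.E \<rho>')" if "sq \<rho>' \<subseteq> plane x \<epsilon> -` \<Omega>" for \<rho>'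
        unfolding P.E_def P.e_def[abs_def] P.w_def using energy_plane_sq(2)[OF \<epsilon>(1) sm that V_nonneg cV] by simp
      show "(\<lambda>y. ennreal (energy_density V \<epsilon> u y) * indicator (Q p) y) \<in> borel_measurable borel"
        unfolding Q_def x_def[symmetric] by (rule energy_plane_sq(1)[OF \<epsilon>(1) sm sub2 V_nonneg cV])
      have "P.E (\<rho>/2) \<le> 32 / (c^3 * \<rho>) * P.E \<rho>"
      proof (rule P.energy_decay_near_well[OF \<rho>(1) sub \<sigma>(1)])
        fix q assume "q \<in> sq \<rho>"
        then have "norm (u (plane x \<epsilon> q) - \<sigma>) \<le> k" by (intro near T)
        then have "(norm (u (plane x \<epsilon> q) - \<sigma>))\<^sup>2 \<le> k\<^sup>2" by (intro power_mono) auto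
        then show "(norm (u (plane x \<epsilon> q) - \<sigma>))\<^sup>2 \<le> well_scale (1/2) * (c / 8)" unfolding k(2) .
      qed
      also have "32 / (c^3 * \<rho>) = 1024 / c^3 * (\<epsilon> / r)" using \<epsilon> r c by (simp add: \<rho>_def)
      finally have "\<epsilon> * P.E (\<rho>/2) \<le> \<epsilon> * (1024 / c^3 * (\<epsilon> / r) * P.E \<rho>)" using \<epsilon>(1) by (intro mult_left_mono) auto
      then have "energy V \<epsilon> u (Q p) \<le> ennreal (1024 / c^3 * (\<epsilon> / r) * (\<epsilon> * P.E \<rho>))"
        unfolding Q_def x_def[symmetric] en[OF sub2] by (intro ennreal_leI) (simp add: mult_ac)
      also have "\<dots> = ennreal (1024 / c^3 * (\<epsilon> / r)) * energy V \<epsilon> u (plane x \<epsilon> ` sq \<rho>)"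
        unfolding en[OF sub] using c \<epsilon> r by (intro ennreal_mult') auto
      also have "\<dots> \<le> ennreal (1024 / c^3 * (\<epsilon> / r)) * energy V \<epsilon> u (ball x0 r)"
        by (intro mult_left_mono energy_mono Tb) simp
      finally show "energy V \<epsilon> u (Q p) \<le> ennreal (1024 / c^3 * (\<epsilon> / r)) * energy V \<epsilon> u (ball x0 r)" .
    qed
    have cover: "\<exists>p\<in>A. y \<in> Q p" if y: "y \<in> ball x0 (5 * r / 8)" for y
    proof -
      define z where "z = (1 / r) *\<^sub>R (y - x0)"
      have yz: "y = x0 + r *\<^sub>R z" using r by (simp add: z_def)
      have "norm z = dist x0 y / r" using r by (simp add: z_def dist_norm norm_minus_commute)
      then have "norm z \<le> 5/8" using y r by (simp add: pos_divide_le_eq)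
      then obtain p where p: "p \<in> A" "dist p z < 1/64" using A(3) by (force simp: subset_iff)
      have "dist (x0 + r *\<^sub>R p) y = r * dist p z"
        using r by (simp add: yz dist_norm scaleR_diff_right[symmetric])
      also have "\<dots> \<le> r * (1/64)" using p(2) r by (intro mult_left_mono) auto
      also have "\<dots> = \<rho> / 2 * \<epsilon>" using \<rho>(2) by simp
      finally show ?thesis using p(1) plane_covers[OF \<epsilon>(1)] unfolding Q_def by blast
    qed
    \<comment> \<open>Overlapping squares can only increase the right side, because the density is
      taken with values in \<open>ennreal\<close>.\<close>
    have "energy V \<epsilon> u (ball x0 (5 * r / 8)) \<le> (\<integral>\<^sup>+y. (\<Sum>p\<in>A. ennreal (energy_density V \<epsilon> u y) * indicator (Q p) y) \<partial>lborel)"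
      unfolding energy_def
    proof (rule nn_integral_mono)
      fix y
      show "ennreal (energy_density V \<epsilon> u y) * indicator (ball x0 (5 * r / 8)) y
         \<le> (\<Sum>p\<in>A. ennreal (energy_density V \<epsilon> u y) * indicator (Q p) y)"
      proof (cases "y \<in> ball x0 (5 * r / 8)")
        case True
        then obtain p where p: "p \<in> A" "y \<in> Q p" using cover by blast
        have "ennreal (energy_density V \<epsilon> u y) * indicator (Q p) y \<le> (\<Sum>p\<in>A. ennreal (energy_density V \<epsilon> u y) * indicator (Q p) y)"
          by (rule member_le_sum[OF p(1) _ A(1)]) simp
        then show ?thesis using True p(2) by simp
      qed simp
    qed
    also have "\<dots> = (\<Sum>p\<in>A. energy V \<epsilon> u (Q p))"
      unfolding energy_def using Qm by (intro nn_integral_sum) simp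
    also have "\<dots> \<le> (\<Sum>p\<in>A. ennreal (1024 / c^3 * (\<epsilon> / r)) * energy V \<epsilon> u (ball x0 r))"
      by (intro sum_mono local)
    also have "\<dots> = ennreal (card A * (1024 / c^3 * (\<epsilon> / r))) * energy V \<epsilon> u (ball x0 r)"
      unfolding sum_constant ennreal_of_nat_eq_real_of_nat ennreal_mult'[OF of_nat_0_le_iff] mult.assoc ..
    also have "\<dots> \<le> ennreal (C * (\<epsilon> / r)) * energy V \<epsilon> u (ball x0 r)"
    proof (intro mult_right_mono ennreal_leI)
      have "C * (\<epsilon> / r) = card A * (1024 / c^3 * (\<epsilon> / r)) + \<epsilon> / r" unfolding C_def distrib_right mult.assoc by simp
      then show "card A * (1024 / c^3 * (\<epsilon> / r)) \<le> C * (\<epsilon> / r)" using \<epsilon> r by simp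
    qed simp
    finally have "energy V \<epsilon> u (ball x0 (5 * r / 8)) \<le> ennreal (C * (\<epsilon> / r)) * energy V \<epsilon> u (ball x0 r)" .
    moreover have "norm (u x - \<sigma>) \<le> \<mu>\<^sub>0 / 2" if "x \<in> ball x0 (3 * r / 4)" for x using near[OF that] k\<mu> by linarith
    ultimately show ?thesis using \<sigma>(1) by blast
  qed
  show ?thesis
  proof (rule exI[of _ \<eta>], intro conjI exI[of _ C] allI impI)
    show "0 < \<eta>" "0 < C" by (fact \<eta>(1) C)+
  qed (rule main)
qed

end
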